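(* \textsc{2-Colored $P_4$ Deletion} remains NP-hard on bicolored graphs in which both the blue subgraph and the red subgraph are cluster graphs and the maximum degree is five.
   Context: A bicolored graph is a simple graph whose edges are each colored blue or red (both colors present). The blue (red) subgraph is $(V,E_{\mathrm{blue}})$ (resp. $(V,E_{\mathrm{red}})$). A cluster graph is a disjoint union of cliques. A bicolored $P_4$ is a path on four vertices containing edges of both colors. \textsc{2-Colored $P_4$ Deletion}: given a bicolored graph $G$ and an integer $k$, decide whether there is a set $S$ of at most $k$ edges such that $G-S$ contains no bicolored $P_4$ as an induced subgraph. *)

theory Defs
  imports
    "HOL-Library.Disjoint_Sets"
    "HOL-Computational_Algebra.Polynomial"
begin

section \<open>Multi-tape Turing machines\<close>

text \<open>
  Tapes are infinite in both directions and are stored relative to the head: the head always scans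
  cell 0, and a head movement shifts the tape contents. Symbol 0 is the blank; the bits are the
  symbols 1 (\<^const>\<open>False\<close>) and 2 (\<^const>\<open>True\<close>). State 0 is initial and state 1 is halting.
\<close>

type_synonym tape = "int \<Rightarrow> nat"
type_synonym config = "nat \<times> tape list"

record tm =
  tm_tapes :: nat
  tm_states :: nat
  tm_symbols :: nat
  tm_delta :: "nat \<Rightarrow> nat list \<Rightarrow> nat \<times> (nat \<times> int) list"

definition wf_tm :: "tm \<Rightarrow> bool" where
  "wf_tm M \<longleftrightarrow>
     1 \<le> tm_tapes M \<and> 2 \<le> tm_states M \<and> 3 \<le> tm_symbols M \<and>
     (\<forall>q w. q < tm_states M \<and> length w = tm_tapes M \<and> set w \<subseteq> {..<tm_symbols M} \<longrightarrow>
        (case tm_delta M q w of (q', acts) \<Rightarrow>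
           q' < tm_states M \<and> length acts = tm_tapes M \<and>
           set acts \<subseteq> {..<tm_symbols M} \<times> {-1, 0, 1}))"

definition act :: "nat \<times> int \<Rightarrow> tape \<Rightarrow> tape" where
  "act a t = (\<lambda>i. (t(0 := fst a)) (i + snd a))"

definition step :: "tm \<Rightarrow> config \<Rightarrow> config" where
  "step M c = (case c of (q, ts) \<Rightarrow>
     if q = 1 then c
     else (case tm_delta M q (map (\<lambda>t. t 0) ts) of (q', acts) \<Rightarrow> (q', map2 act acts ts)))"

definition tape_of :: "bool list \<Rightarrow> tape" where
  "tape_of x = (\<lambda>i. if 0 \<le> i \<and> i < int (length x) then (if x ! nat i then 2 else 1) else 0)"

definition init_config :: "tm \<Rightarrow> bool list list \<Rightarrow> config" where
  "init_config M xs = (0, map tape_of (xs @ replicate (tm_tapes M - length xs) []))"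

text \<open>
  The output is the string on the first tape that starts at the head and extends to the right up to
  the next blank.
\<close>

definition computes_within :: "tm \<Rightarrow> bool list list \<Rightarrow> bool list \<Rightarrow> nat \<Rightarrow> bool" where
  "computes_within M xs y T \<longleftrightarrow>
     (\<exists>n\<le>T. \<exists>ts. (step M ^^ n) (init_config M xs) = (1, ts) \<and>
        (\<forall>i\<in>{0..int (length y)}. hd ts i = tape_of y i))"

text \<open>The \<open>m\<close> arguments are given on the first \<open>m\<close> tapes.\<close>

definition poly_time_computable :: "nat \<Rightarrow> (bool list list \<Rightarrow> bool list) \<Rightarrow> bool" where
  "poly_time_computable m f \<longleftrightarrow>
     (\<exists>M p. wf_tm M \<and> m \<le> tm_tapes M \<and>
        (\<forall>xs. length xs = m \<longrightarrow>
           computes_within M xs (f xs) (poly p (sum_list (map length xs)))))"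


section \<open>NP and NP-hardness\<close>

definition NP :: "bool list set set" where
  "NP = {L. \<exists>V p. poly_time_computable 2 (\<lambda>xs. [V (xs ! 0) (xs ! 1)]) \<and>
     (\<forall>x. x \<in> L \<longleftrightarrow> (\<exists>y. length y \<le> poly p (length x) \<and> V x y))}"

text \<open>
  A decision problem consists of a set \<open>I\<close> of instances, a set \<open>Y\<close> of instances with answer
  ``yes'' and an encoding of instances as bit strings. Every value of a reduction has to be (the
  encoding of) an instance in \<open>I\<close>, so that restricting a problem to a subclass is a restriction of
  \<open>I\<close>.
\<close>

definition NP_hard :: "('i \<Rightarrow> bool list) \<Rightarrow> 'i set \<Rightarrow> 'i set \<Rightarrow> bool" where
  "NP_hard enc I Y \<longleftrightarrow>
     (\<forall>L\<in>NP. \<exists>g. poly_time_computable 1 (\<lambda>xs. enc (g (xs ! 0))) \<and>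
        (\<forall>x. g x \<in> I \<and> (x \<in> L \<longleftrightarrow> g x \<in> Y)))"


section \<open>Bicolored graphs\<close>

record 'v bgraph =
  verts :: "'v set"
  blue :: "'v set set"
  red :: "'v set set"

definition edges :: "'v bgraph \<Rightarrow> 'v set set" where
  "edges G = blue G \<union> red G"

definition bicolored_graph :: "'v bgraph \<Rightarrow> bool" where
  "bicolored_graph G \<longleftrightarrow>
     finite (verts G) \<and> edges G \<subseteq> {e. e \<subseteq> verts G \<and> card e = 2} \<and>
     blue G \<inter> red G = {} \<and> blue G \<noteq> {} \<and> red G \<noteq> {}"

definition cluster_graph :: "'v set \<Rightarrow> 'v set set \<Rightarrow> bool" where
  "cluster_graph V E \<longleftrightarrow>
     (\<exists>P. partition_on V P \<and> E = {e. card e = 2 \<and> (\<exists>C\<in>P. e \<subseteq> C)})"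

definition vertex_degree :: "'v bgraph \<Rightarrow> 'v \<Rightarrow> nat" where
  "vertex_degree G v = card {e \<in> edges G. v \<in> e}"

definition max_degree :: "'v bgraph \<Rightarrow> nat" where
  "max_degree G = Max (vertex_degree G ` verts G)"

definition delete_edges :: "'v bgraph \<Rightarrow> 'v set set \<Rightarrow> 'v bgraph" where
  "delete_edges G S = G\<lparr>blue := blue G - S, red := red G - S\<rparr>"

definition has_induced_bicolored_P4 :: "'v bgraph \<Rightarrow> bool" where
  "has_induced_bicolored_P4 G \<longleftrightarrow>
     (\<exists>a b c d. {a, b, c, d} \<subseteq> verts G \<and> distinct [a, b, c, d] \<and>
        {a, b} \<in> edges G \<and> {b, c} \<in> edges G \<and> {c, d} \<in> edges G \<and>
        {a, c} \<notin> edges G \<and> {a, d} \<notin> edges G \<and> {b, d} \<notin> edges G \<and>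
        {{a, b}, {b, c}, {c, d}} \<inter> blue G \<noteq> {} \<and>
        {{a, b}, {b, c}, {c, d}} \<inter> red G \<noteq> {})"

definition two_colored_P4_deletion :: "'v bgraph \<Rightarrow> nat \<Rightarrow> bool" where
  "two_colored_P4_deletion G k \<longleftrightarrow>
     (\<exists>S\<subseteq>edges G. card S \<le> k \<and> \<not> has_induced_bicolored_P4 (delete_edges G S))"


section \<open>Instances as bit strings\<close>

text \<open>
  An instance is a graph with vertex set \<open>{0..<n}\<close> together with the number \<open>k\<close>. Its encoding
  consists of \<open>n\<close> in unary, terminated by \<^const>\<open>False\<close>, the two-bit entries (blue, red) of the
  adjacency matrix in row-major order, and \<open>k\<close> in binary, least significant bit first.
\<close>

fun binary :: "nat \<Rightarrow> bool list" where
  "binary k = (if k = 0 then [] else odd k # binary (k div 2))"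

declare binary.simps [simp del]

definition encode_instance :: "nat bgraph \<times> nat \<Rightarrow> bool list" where
  "encode_instance = (\<lambda>(G, k). let n = card (verts G) in
     replicate n True @ [False] @
     concat (map (\<lambda>(i, j). [{i, j} \<in> blue G, {i, j} \<in> red G]) (List.product [0..<n] [0..<n])) @
     binary k)"

definition bicolored_instances :: "(nat bgraph \<times> nat) set" where
  "bicolored_instances = {(G, k). bicolored_graph G \<and> verts G = {..<card (verts G)}}"

lemma binary_inject: "binary k = binary l \<Longrightarrow> k = l"
proof (induction k arbitrary: l rule: less_induct)
  case (less k)
  have Nil: "binary m = [] \<longleftrightarrow> m = 0" for m
    by (subst binary.simps) simp
  have Cons: "binary m = odd m # binary (m div 2)" if "m \<noteq> 0" for m
    using that by (subst binary.simps) simp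
  show ?case
  proof (cases "k = 0 \<or> l = 0")
    case True
    then show ?thesis
      using less.prems Nil[of k] Nil[of l] by metis
  next
    case False
    then have *: "odd k = odd l" "binary (k div 2) = binary (l div 2)"
      using less.prems Cons[of k] Cons[of l] by simp_all
    have "k div 2 < k"
      using False by simp
    then have "k div 2 = l div 2"
      using *(2) by (rule less.IH)
    moreover have "k mod 2 = l mod 2"
      using *(1) by (simp add: mod_2_eq_odd)
    ultimately show ?thesis
      by (metis div_mult_mod_eq)
  qed
qed

lemma replicate_True_inject:
  "replicate m True @ False # xs = replicate n True @ False # ys \<Longrightarrow> m = n \<and> xs = ys"
proof (induction m arbitrary: n)
  case 0
  then show ?case by (cases n) auto
next
  case (Suc m)
  show ?case
  proof (cases n)
    case 0
    then show ?thesis using Suc.prems by simp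
  next
    case n: (Suc n')
    have "replicate m True @ False # xs = replicate n' True @ False # ys"
      using Suc.prems by (simp add: n)
    then have "m = n' \<and> xs = ys"
      by (rule Suc.IH)
    then show ?thesis by (simp add: n)
  qed
qed

lemma concat_pairs_inject:
  "concat (map (\<lambda>(i, j). [f i j, g i j]) ps) @ xs = concat (map (\<lambda>(i, j). [f' i j, g' i j]) ps) @ ys
   \<Longrightarrow> xs = ys \<and> (\<forall>(i, j)\<in>set ps. f i j = f' i j \<and> g i j = g' i j)"
  by (induction ps) auto

lemma edge_set_eqI:
  assumes "E \<subseteq> {e. e \<subseteq> V \<and> card e = 2}" "E' \<subseteq> {e. e \<subseteq> V \<and> card e = 2}"
    and "\<And>i j. i \<in> V \<Longrightarrow> j \<in> V \<Longrightarrow> {i, j} \<in> E \<longleftrightarrow> {i, j} \<in> E'"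
  shows "E = E'"
proof (rule set_eqI)
  fix e
  show "e \<in> E \<longleftrightarrow> e \<in> E'"
  proof (cases "e \<subseteq> V \<and> card e = 2")
    case True
    then obtain i j where e: "e = {i, j}"
      unfolding card_2_iff by blast
    then have "i \<in> V" "j \<in> V"
      using True by auto
    then show ?thesis
      unfolding e by (rule assms(3))
  next
    case False
    then have "e \<notin> E" "e \<notin> E'"
      using subsetD[OF assms(1), of e] subsetD[OF assms(2), of e] unfolding mem_Collect_eq by argo+
    then show ?thesis by simp
  qed
qed

lemma inj_on_encode_instance: "inj_on encode_instance bicolored_instances"
proof (rule inj_onI, clarify)
  fix G H :: "nat bgraph" and k l
  assume G: "(G, k) \<in> bicolored_instances" and H: "(H, l) \<in> bicolored_instances"
    and eq: "encode_instance (G, k) = encode_instance (H, l)"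
  define n where "n = card (verts G)"
  have "n = card (verts H)"
    using eq unfolding encode_instance_def Let_def case_prod_conv append_Cons append_Nil n_def
    by (rule replicate_True_inject[THEN conjunct1])
  then have n: "card (verts H) = n" ..
  have eq': "concat (map (\<lambda>(i, j). [{i, j} \<in> blue G, {i, j} \<in> red G]) (List.product [0..<n] [0..<n])) @ binary k
     = concat (map (\<lambda>(i, j). [{i, j} \<in> blue H, {i, j} \<in> red H]) (List.product [0..<n] [0..<n])) @ binary l"
    using eq n by (simp add: encode_instance_def n_def Let_def)
  note * = concat_pairs_inject[OF eq']
  have inst: "bicolored_graph G'" "verts G' = {..<card (verts G')}"
    if "(G', m) \<in> bicolored_instances" for G' m
    using that by (simp_all only: bicolored_instances_def mem_Collect_eq case_prod_conv)
  have V: "verts G = {..<n}" "verts H = {..<n}"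
    using inst(2)[OF G] inst(2)[OF H] unfolding n n_def[symmetric] .
  have "bicolored_graph G" "bicolored_graph H"
    by (rule inst(1)[OF G], rule inst(1)[OF H])
  then have E: "blue G \<subseteq> {e. e \<subseteq> {..<n} \<and> card e = 2}" "blue H \<subseteq> {e. e \<subseteq> {..<n} \<and> card e = 2}"
    "red G \<subseteq> {e. e \<subseteq> {..<n} \<and> card e = 2}" "red H \<subseteq> {e. e \<subseteq> {..<n} \<and> card e = 2}"
    unfolding bicolored_graph_def edges_def V by blast+
  have "blue G = blue H"
    by (rule edge_set_eqI[OF E(1,2)]) (use * in auto)
  moreover have "red G = red H"
    by (rule edge_set_eqI[OF E(3,4)]) (use * in auto)
  ultimately show "G = H \<and> k = l"
    using V * binary_inject[of k l] by simp
qed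

end

theory Submission
  imports Defs
begin

text \<open>
  Every language in NP is reduced to satisfiability of 3-CNF formulas by the tableau method of Cook and Levin,
  and satisfiability to 2-Colored \<open>P\<^sub>4\<close> Deletion.

  In the graphs constructed here the blue cliques have at most four and the red cliques at most three vertices,
  and there are no alternating 4-cycles. If no induced bicolored \<open>P\<^sub>4\<close> remains, then a vertex with remaining edges
  of both colors has red neighbors without blue edges and blue neighbors without red edges. A discharging argument
  then shows that at most \<open>3/2 |V|\<close> edges remain, with equality exactly if each component is a blue \<open>K\<^sub>4\<close>, possibly
  sharing one vertex with a red triangle. Thus the question becomes which blue 4-cliques are kept: a red triangle
  meets one or three kept cliques, and in the former case it uses up the only extension of the kept clique that it
  meets. Red triangles therefore express parity constraints, a clique that is forced to be kept (by vertices without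
  red edges) links the cliques it meets pairwise, and because it can be extended only once, such a clique with two
  triangles expresses a disjunction.

  The computability of the reduction is obtained from arithmetic: all bits of the adjacency matrix are expressions
  built from addition, subtraction, bounded sums and lookups in the input. Such expressions are evaluated in
  polynomial time by a Turing machine that stores numbers as head positions.
\<close>


section \<open>Structured programs for Turing machines\<close>

text \<open>The ratio 3/2 is that of the extremal components: a blue K4 has 6 edges on 4 vertices,
  together with a red triangle 9 edges on 6 vertices. The obstacle is the degree. A blue K4 has only
  four slots, and if it can be given up, each slot must lie in a red triangle, because its vertices
  survive nowhere else. Hence the value of a variable is copied along a ring. Two slots of each copy
  are linked to the positions at distance two; since the ring has odd length, these links alone
  equate all copies. The other two slots are linked to the adjacent positions, and there a
  constraint can be inserted: the link triangles of the variables concerned are exchanged for two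
  triangles across the variables, one at each end of the replaced links, which state the same parity
  constraint twice. The constant false is represented by blue singletons, which can never be kept;
  these need red triangles as well, and therefore an inequality is stated at two places. On the
  machine side, all labels are closed formulas in the number of the vertex, so that counters of
  polynomial size are enough memory.\<close>

datatype cmd =
    Do "nat list \<Rightarrow> (nat \<times> int) list"
  | Seq cmd cmd (infixr ";;" 60)
  | While "nat list \<Rightarrow> bool" cmd

definition heads :: "tape list \<Rightarrow> nat list" where
  "heads ts = map (\<lambda>t. t 0) ts"

definition idle :: "nat list \<Rightarrow> (nat \<times> int) list" where
  "idle w = map (\<lambda>a. (a, 0)) w"

primrec cmd_states :: "cmd \<Rightarrow> nat" where
  "cmd_states (Do f) = 1"
| "cmd_states (c ;; d) = cmd_states c + cmd_states d"
| "cmd_states (While P c) = Suc (cmd_states c)"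

text \<open>
  The program occupies the states \<open>s, s + 1, \<dots>\<close>, is entered in state \<open>s\<close> and left to state \<open>e\<close>.
\<close>

primrec code :: "cmd \<Rightarrow> nat \<Rightarrow> nat \<Rightarrow> nat \<Rightarrow> nat list \<Rightarrow> nat \<times> (nat \<times> int) list" where
  "code (Do f) s e q w = (e, f w)"
| "code (c ;; d) s e q w =
     (if q < s + cmd_states c then code c s (s + cmd_states c) q w
      else code d (s + cmd_states c) e q w)"
| "code (While P c) s e q w =
     (if q = s then (if P w then Suc s else e, idle w) else code c (Suc s) s q w)"

text \<open>The number is the exact number of machine steps. Sequencing is free, because a program
  exits directly into the first state of its successor; every test of a loop is one idle transition
  in the state that belongs to the loop.\<close>

inductive exec :: "cmd \<Rightarrow> tape list \<Rightarrow> nat \<Rightarrow> tape list \<Rightarrow> bool" where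
  Do: "exec (Do f) ts 1 (map2 act (f (heads ts)) ts)"
| Seq: "exec c ts m ts' \<Longrightarrow> exec d ts' n ts'' \<Longrightarrow> exec (c ;; d) ts (m + n) ts''"
| WhileF: "\<not> P (heads ts) \<Longrightarrow> exec (While P c) ts 1 ts"
| WhileT: "P (heads ts) \<Longrightarrow> exec c ts m ts' \<Longrightarrow> exec (While P c) ts' n ts'' \<Longrightarrow>
    exec (While P c) ts (Suc (m + n)) ts''"

text \<open>The alphabet has four symbols: the blank, the two bits and the marker 3 of the
  origin.\<close>

primrec wf_cmd :: "nat \<Rightarrow> cmd \<Rightarrow> bool" where
  "wf_cmd N (Do f) \<longleftrightarrow> (\<forall>w. length w = N \<and> set w \<subseteq> {..<4} \<longrightarrow>
     length (f w) = N \<and> set (f w) \<subseteq> {..<4} \<times> {-1, 0, 1})"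
| "wf_cmd N (c ;; d) \<longleftrightarrow> wf_cmd N c \<and> wf_cmd N d"
| "wf_cmd N (While P c) \<longleftrightarrow> wf_cmd N c"

lemma cmd_states_pos: "0 < cmd_states c"
  by (induction c) auto

lemma map2_act_idle: "map2 act (idle (heads ts)) ts = ts"
  by (rule nth_equalityI) (auto simp: idle_def heads_def act_def)

text \<open>The machine is only required to agree with \<open>code\<close> on the states of the
  program, so the induction applies to subprograms inside the same machine. The condition
  \<open>1 < s\<close> keeps these states away from the halting state, where \<open>step\<close>
  does nothing.\<close>

lemma exec_simulation:
  assumes "exec c ts k ts'"
    and "\<And>q w. s \<le> q \<Longrightarrow> q < s + cmd_states c \<Longrightarrow> tm_delta M q w = code c s e q w" and "1 < s"
  shows "(step M ^^ k) (s, ts) = (e, ts')"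
  using assms
proof (induction arbitrary: s e)
  case (Do f ts)
  have "tm_delta M s (heads ts) = (e, f (heads ts))"
    using Do.prems(1)[of s "heads ts"] by simp
  then show ?case
    using Do.prems(2) by (simp add: step_def heads_def)
next
  case (Seq c ts m ts' d n ts'')
  have "(step M ^^ m) (s, ts) = (s + cmd_states c, ts')"
    using Seq.prems by (intro Seq.IH(1)) auto
  moreover have "(step M ^^ n) (s + cmd_states c, ts') = (e, ts'')"
    using Seq.prems by (intro Seq.IH(2)) auto
  ultimately show ?case
    by (subst add.commute) (simp add: funpow_add)
next
  case (WhileF P ts c)
  have "tm_delta M s (heads ts) = (e, idle (heads ts))"
    using WhileF.prems(1)[of s "heads ts"] WhileF.hyps by simp
  then show ?case
    using WhileF.prems(2) map2_act_idle[of ts] by (simp add: step_def heads_def)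
next
  case (WhileT P ts c m ts' n ts'')
  have "tm_delta M s (heads ts) = (Suc s, idle (heads ts))"
    using WhileT.prems(1)[of s "heads ts"] WhileT.hyps by simp
  then have "step M (s, ts) = (Suc s, ts)"
    using WhileT.prems(2) map2_act_idle[of ts] by (simp add: step_def heads_def)
  moreover have "(step M ^^ m) (Suc s, ts) = (s, ts')"
    using WhileT.prems by (intro WhileT.IH(1)) auto
  moreover have "(step M ^^ n) (s, ts') = (e, ts'')"
    using WhileT.prems by (intro WhileT.IH(2)) auto
  moreover have "Suc (m + n) = n + (m + 1)" by simp
  ultimately show ?case
    by (simp only: funpow_add o_apply One_nat_def funpow.simps id_apply)
qed

lemma code_in_states:
  assumes "s \<le> q" "q < s + cmd_states c"
  shows "fst (code c s e q w) \<in> insert e {s..<s + cmd_states c}"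
  using assms
proof (induction c arbitrary: s e)
  case (Seq c d)
  show ?case
    using Seq.prems cmd_states_pos[of d] Seq.IH(1)[of s "s + cmd_states c"] Seq.IH(2)[of "s + cmd_states c" e]
    by (cases "q < s + cmd_states c"; simp) linarith+
next
  case (While P c)
  show ?case
    using While.prems While.IH[of "Suc s" s] cmd_states_pos[of c] by (cases "q = s"; simp) linarith
qed auto

lemma code_acts:
  assumes "wf_cmd N c" "length w = N" "set w \<subseteq> {..<4}"
  shows "length (snd (code c s e q w)) = N \<and> set (snd (code c s e q w)) \<subseteq> {..<4} \<times> {-1, 0, 1}"
  using assms by (induction c arbitrary: s e) (auto simp: idle_def)

lemma poly_nat_mono: "a \<le> b \<Longrightarrow> poly p a \<le> poly p b" for a b :: nat
  by (induction p) (auto intro!: add_mono mult_mono)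

lemma poly_time_computable_cmd:
  assumes wf: "wf_cmd N c" and N: "1 \<le> N"
    and run: "\<And>x. \<exists>t\<le>poly p (length x). \<exists>ts. exec c (map tape_of (x # replicate (N - 1) [])) t ts \<and>
      (\<forall>i\<in>{0..int (length (f x))}. hd ts i = tape_of (f x) i)"
  shows "poly_time_computable 1 (\<lambda>xs. f (xs ! 0))"
proof -
  \<comment> \<open>The states 0 and 1 are reserved, so the program starts in state 2 and exits to
    state 1. The idle transition from 0 to 2 is the additional step in \<open>p + 1\<close>.\<close>
  define M where "M = \<lparr>tm_tapes = N, tm_states = 2 + cmd_states c, tm_symbols = 4,
    tm_delta = \<lambda>q w. if q = 0 then (2, idle w) else if q = 1 then (1, idle w) else code c 2 1 q w\<rparr>"
  have idle: "length (idle w) = N \<and> set (idle w) \<subseteq> {..<4} \<times> {-1, 0, 1}"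
    if "length w = N" "set w \<subseteq> {..<4}" for w
    using that by (auto simp: idle_def)
  have "wf_tm M"
    unfolding wf_tm_def
  proof (intro conjI allI impI)
    fix q w assume qw: "q < tm_states M \<and> length w = tm_tapes M \<and> set w \<subseteq> {..<tm_symbols M}"
    then have w: "length w = N" "set w \<subseteq> {..<4}" and q: "q < 2 + cmd_states c"
      by (auto simp: M_def)
    have *: "fst (tm_delta M q w) < 2 + cmd_states c \<and> length (snd (tm_delta M q w)) = N \<and>
       set (snd (tm_delta M q w)) \<subseteq> {..<4} \<times> {-1, 0, 1}"
    proof (cases "q = 0 \<or> q = 1")
      case True
      then show ?thesis using idle[OF w] cmd_states_pos[of c] by (auto simp: M_def)
    next
      case False
      then show ?thesis
        using code_acts[OF wf w, of 2 1 q] code_in_states[of 2 q c 1 w] q by (auto simp: M_def)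
    qed
    then show "case tm_delta M q w of (q', acts) \<Rightarrow>
      q' < tm_states M \<and> length acts = tm_tapes M \<and> set acts \<subseteq> {..<tm_symbols M} \<times> {- 1, 0, 1}"
      by (auto simp: M_def split: prod.splits)
  qed (use N in \<open>auto simp: M_def\<close>)
  moreover have "computes_within M xs (f (xs ! 0)) (poly (p + 1) (sum_list (map length xs)))"
    if len: "length xs = 1" for xs
  proof -
    obtain x where xs: "xs = [x]"
      using len by (auto simp: length_Suc_conv)
    define ts0 where "ts0 = map tape_of (x # replicate (N - 1) [])"
    obtain t ts where t: "t \<le> poly p (length x)" and ex: "exec c ts0 t ts"
      and out: "\<forall>i\<in>{0..int (length (f x))}. hd ts i = tape_of (f x) i"
      using run[of x] unfolding ts0_def by blast
    have init: "init_config M xs = (0, ts0)"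
      by (simp add: init_config_def xs ts0_def M_def)
    have "step M (0, ts0) = (2, ts0)"
      using map2_act_idle[of ts0] by (simp add: step_def M_def heads_def)
    moreover have "(step M ^^ t) (2, ts0) = (1, ts)"
      by (rule exec_simulation[OF ex]) (auto simp: M_def)
    ultimately have "(step M ^^ Suc t) (init_config M xs) = (1, ts)"
      unfolding init by (simp only: funpow_Suc_right o_apply)
    moreover have "Suc t \<le> poly (p + 1) (sum_list (map length xs))"
      using t by (simp add: xs)
    ultimately show ?thesis
      unfolding computes_within_def using out by (auto simp: xs)
  qed
  moreover have "1 \<le> tm_tapes M"
    using N by (simp add: M_def)
  ultimately show ?thesis
    unfolding poly_time_computable_def by blast
qed

section \<open>Execution within a time bound\<close>

definition execs :: "cmd \<Rightarrow> tape list \<Rightarrow> nat \<Rightarrow> tape list \<Rightarrow> bool" where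
  "execs c ts b ts' \<longleftrightarrow> (\<exists>t\<le>b. exec c ts t ts')"

lemma execs_mono: "execs c ts b ts' \<Longrightarrow> b \<le> b' \<Longrightarrow> execs c ts b' ts'"
  unfolding execs_def by (meson order_trans)

lemma execs_Seq: "execs c ts m ts' \<Longrightarrow> execs d ts' n ts'' \<Longrightarrow> execs (c ;; d) ts (m + n) ts''"
  unfolding execs_def by (meson exec.Seq add_mono)

text \<open>The family \<open>S\<close> gives the tapes after each number of rounds. A round costs
  \<open>b\<close> and one test, and the last summand is the test that fails.\<close>

lemma execs_While:
  assumes "\<And>k. k < n \<Longrightarrow> P (heads (S k))" "\<And>k. k < n \<Longrightarrow> execs c (S k) b (S (Suc k))"
    and "\<not> P (heads (S n))"
  shows "execs (While P c) (S 0) (n * (b + 1) + 1) (S n)"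
  using assms
proof (induction n arbitrary: S)
  case 0
  then show ?case
    unfolding execs_def using exec.WhileF by auto
next
  case (Suc n)
  have "execs (While P c) (S (Suc 0)) (n * (b + 1) + 1) (S (Suc n))"
    using Suc.IH[of "\<lambda>k. S (Suc k)"] Suc.prems by auto
  then obtain t where t: "t \<le> n * (b + 1) + 1" "exec (While P c) (S (Suc 0)) t (S (Suc n))"
    unfolding execs_def by blast
  obtain t' where t': "t' \<le> b" "exec c (S 0) t' (S (Suc 0))"
    using Suc.prems(2)[of 0] unfolding execs_def by blast
  have "exec (While P c) (S 0) (Suc (t' + t)) (S (Suc n))"
    using Suc.prems(1)[of 0] t t' by (intro exec.WhileT) auto
  moreover have "Suc (t' + t) \<le> Suc n * (b + 1) + 1"
    using t(1) t'(1) by simp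
  ultimately show ?case
    unfolding execs_def by blast
qed


section \<open>Counters as head positions\<close>

text \<open>
  Tape 0 receives the output. On every other tape the symbol 3 marks the origin and the tape stores
  the distance of the head from the origin. Tape 1 also holds the input, to the right of its origin.
\<close>

definition reg_tape :: "bool list \<Rightarrow> (nat \<Rightarrow> nat) \<Rightarrow> bool list \<Rightarrow> nat \<Rightarrow> tape" where
  "reg_tape x R out r =
     (if r = 0 then (\<lambda>i. tape_of out (i + int (length out)))
      else (\<lambda>i. if i + int (R r) = 0 then 3 else if r = 1 then tape_of x (i + int (R r) - 1) else 0))"

definition conf :: "nat \<Rightarrow> bool list \<Rightarrow> (nat \<Rightarrow> nat) \<Rightarrow> bool list \<Rightarrow> tape list" where
  "conf N x R out = map (reg_tape x R out) [0..<N]"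

definition move :: "(nat list \<Rightarrow> nat \<Rightarrow> int) \<Rightarrow> cmd" where
  "move d = Do (\<lambda>w. map (\<lambda>r. (w ! r, d w r)) [0..<length w])"

text \<open>Reading a counter destroys it. A copy is therefore made by a transfer to the target and
  to a scratch register, followed by a transfer back.\<close>

definition transfer :: "nat \<Rightarrow> nat set \<Rightarrow> cmd" where
  "transfer a B = While (\<lambda>w. w ! a \<noteq> 3)
     (move (\<lambda>w r. if r = a then -1 else if r \<in> B then 1 else 0))"

lemma tape_of_less_3: "tape_of x i < 3"
  by (simp add: tape_of_def)

lemma heads_conf_zero: "1 \<le> r \<Longrightarrow> r < N \<Longrightarrow> heads (conf N x R out) ! r = 3 \<longleftrightarrow> R r = 0"
  using tape_of_less_3[of x "int (R r) - 1"]
  by (auto simp: heads_def conf_def reg_tape_def)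

text \<open>The marker occupies the origin, so position \<open>p\<close> of the input is scanned at
  distance \<open>p + 1\<close>.\<close>

lemma heads_conf_input:
  "1 < N \<Longrightarrow> R 1 = Suc p \<Longrightarrow> heads (conf N x R out) ! 1 = tape_of x (int p)"
  by (auto simp: heads_def conf_def reg_tape_def)

lemma execs_move:
  assumes "\<And>r. 1 \<le> r \<Longrightarrow> r < N \<Longrightarrow> int (R' r) = int (R r) + d (heads (conf N x R out)) r"
    and "d (heads (conf N x R out)) 0 = 0"
  shows "execs (move d) (conf N x R out) 1 (conf N x R' out)"
proof -
  let ?w = "heads (conf N x R out)"
  have "map2 act (map (\<lambda>r. (?w ! r, d ?w r)) [0..<length ?w]) (conf N x R out) = conf N x R' out"
  proof (rule nth_equalityI)
    fix r assume "r < length (map2 act (map (\<lambda>r. (?w ! r, d ?w r)) [0..<length ?w]) (conf N x R out))"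
    then have r: "r < N" by (simp add: conf_def heads_def)
    have "act (reg_tape x R out r 0, d ?w r) (reg_tape x R out r) = (\<lambda>i. reg_tape x R out r (i + d ?w r))"
      by (auto simp: act_def)
    also have "\<dots> = reg_tape x R' out r"
      using assms(1)[of r] assms(2) r by (cases "r = 0") (auto simp: reg_tape_def fun_eq_iff algebra_simps)
    finally show "map2 act (map (\<lambda>r. (?w ! r, d ?w r)) [0..<length ?w]) (conf N x R out) ! r = conf N x R' out ! r"
      using r by (simp add: conf_def heads_def)
  qed (simp add: conf_def heads_def)
  then show ?thesis
    unfolding execs_def move_def using exec.Do[of "\<lambda>w. map (\<lambda>r. (w ! r, d w r)) [0..<length w]" "conf N x R out"]
    by auto
qed

lemma execs_transfer:
  assumes "1 \<le> a" "a < N" "a \<notin> B" "0 \<notin> B"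
  shows "execs (transfer a B) (conf N x R out) (2 * R a + 1)
    (conf N x (\<lambda>r. if r = a then 0 else if r \<in> B then R r + R a else R r) out)"
proof -
  define S where "S k = (\<lambda>r. if r = a then R a - k else if r \<in> B then R r + k else R r)" for k
  have "execs (transfer a B) (conf N x (S 0) out) (R a * (1 + 1) + 1) (conf N x (S (R a)) out)"
    unfolding transfer_def
  proof (rule execs_While)
    fix k assume k: "k < R a"
    show "heads (conf N x (S k) out) ! a \<noteq> 3"
      using heads_conf_zero[of a N x "S k" out] assms k by (simp add: S_def)
    show "execs (move (\<lambda>w r. if r = a then -1 else if r \<in> B then 1 else 0)) (conf N x (S k) out) 1
       (conf N x (S (Suc k)) out)"
      by (rule execs_move) (use k assms in \<open>auto simp: S_def\<close>)
  qed (use heads_conf_zero[of a N x "S (R a)" out] assms in \<open>simp add: S_def\<close>)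
  moreover have "S 0 = R" "S (R a) = (\<lambda>r. if r = a then 0 else if r \<in> B then R r + R a else R r)"
    using assms(3) by (auto simp: S_def fun_eq_iff)
  ultimately show ?thesis
    by (simp add: mult_2_right mult_2)
qed

lemma execs_clear:
  assumes "1 \<le> a" "a < N"
  shows "execs (transfer a {}) (conf N x R out) (2 * R a + 1) (conf N x (R(a := 0)) out)"
proof -
  have "(\<lambda>r. if r = a then 0 else if r \<in> {} then R r + R a else R r) = R(a := 0)"
    by auto
  then show ?thesis
    using execs_transfer[of a N "{}" x R out] assms by simp
qed

lemma wf_move: "(\<And>w r. d w r \<in> {-1, 0, 1}) \<Longrightarrow> wf_cmd N (move d)"
  by (fastforce simp: move_def set_conv_nth subset_iff)

lemma wf_transfer: "wf_cmd N (transfer a B)"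
  by (simp add: transfer_def wf_move)


section \<open>Arithmetic expressions with bounded sums\<close>

text \<open>
  Variables are de Bruijn indices; \<open>Sum a b\<close> binds the index 0 in \<open>b\<close>. \<open>Inp a\<close> is the tape symbol
  of the input at position \<open>a\<close>, that is 0 behind the end of the input.
\<close>

datatype exp = One | Len | Var nat | Inp exp | Add exp exp | Sub exp exp | Sum exp exp

primrec eval :: "exp \<Rightarrow> (nat \<Rightarrow> nat) \<Rightarrow> bool list \<Rightarrow> nat" where
  "eval One \<rho> x = 1"
| "eval Len \<rho> x = length x"
| "eval (Var i) \<rho> x = \<rho> i"
| "eval (Inp a) \<rho> x = tape_of x (int (eval a \<rho> x))"
| "eval (Add a b) \<rho> x = eval a \<rho> x + eval b \<rho> x"
| "eval (Sub a b) \<rho> x = eval a \<rho> x - eval b \<rho> x"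
| "eval (Sum a b) \<rho> x = (\<Sum>k<eval a \<rho> x. eval b (case_nat k \<rho>) x)"

text \<open>The scratch registers used from \<open>f\<close> on. Their number depends on the
  expression only, so that a fixed number of tapes serves all inputs.\<close>

primrec temps :: "exp \<Rightarrow> nat" where
  "temps One = 0"
| "temps Len = 1"
| "temps (Var i) = 1"
| "temps (Inp a) = 1 + temps a"
| "temps (Add a b) = max (temps a) (temps b)"
| "temps (Sub a b) = 2 + max (temps a) (temps b)"
| "temps (Sum a b) = 2 + max (temps a) (temps b)"

definition inc_if :: "(nat list \<Rightarrow> bool) \<Rightarrow> nat \<Rightarrow> cmd" where
  "inc_if P r = move (\<lambda>w i. if i = r \<and> P w then 1 else 0)"

definition dec :: "nat \<Rightarrow> cmd" where
  "dec r = move (\<lambda>w i. if i = r then -1 else 0)"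

text \<open>
  The code adds the value to register \<open>r\<close>. Register \<open>vs i\<close> holds the variable \<open>i\<close>, and the
  registers from \<open>f\<close> on are zero before and after.
\<close>

primrec compile :: "exp \<Rightarrow> (nat \<Rightarrow> nat) \<Rightarrow> nat \<Rightarrow> nat \<Rightarrow> cmd" where
  "compile One vs r f = inc_if (\<lambda>_. True) r"
| "compile Len vs r f = transfer 2 {r, f} ;; transfer f {2}"
| "compile (Var i) vs r f = transfer (vs i) {r, f} ;; transfer f {vs i}"
| "compile (Inp a) vs r f = compile a vs f (f + 1) ;; inc_if (\<lambda>_. True) 1 ;; transfer f {1} ;;
     inc_if (\<lambda>w. w ! 1 \<noteq> 0) r ;; inc_if (\<lambda>w. w ! 1 = 2) r ;; transfer 1 {}"
| "compile (Add a b) vs r f = compile a vs r f ;; compile b vs r f"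
| "compile (Sub a b) vs r f = compile a vs f (f + 2) ;; compile b vs (f + 1) (f + 2) ;;
     While (\<lambda>w. w ! f \<noteq> 3 \<and> w ! (f + 1) \<noteq> 3) (move (\<lambda>w i. if i = f \<or> i = f + 1 then -1 else 0)) ;;
     transfer f {r} ;; transfer (f + 1) {}"
| "compile (Sum a b) vs r f = compile a vs f (f + 1) ;;
     While (\<lambda>w. w ! f \<noteq> 3)
       (dec f ;; compile b (case_nat (f + 1) vs) r (f + 2) ;; inc_if (\<lambda>_. True) (f + 1)) ;;
     transfer (f + 1) {}"

lemma wf_inc_if: "wf_cmd N (inc_if P r)"
  by (simp add: inc_if_def wf_move)

lemma wf_dec: "wf_cmd N (dec r)"
  by (simp add: dec_def wf_move)

lemma wf_compile: "wf_cmd N (compile e vs r f)"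
  by (induction e arbitrary: vs r f) (simp_all add: wf_inc_if wf_dec wf_transfer wf_move)

lemma execs_inc_if:
  assumes "1 \<le> r"
  shows "execs (inc_if P r) (conf N x R out) 1
    (conf N x (R(r := R r + of_bool (P (heads (conf N x R out))))) out)"
  unfolding inc_if_def by (rule execs_move) (use assms in auto)

lemma execs_dec:
  assumes "1 \<le> r" "0 < R r"
  shows "execs (dec r) (conf N x R out) 1 (conf N x (R(r := R r - 1)) out)"
  unfolding dec_def by (rule execs_move) (use assms in auto)

text \<open>The context of a loop body: the counter \<open>f\<close> runs down while the bound variable \<open>f + 1\<close> runs up.\<close>

lemma execs_count_loop:
  assumes "1 \<le> f" "f + 1 < N" "R f = n" "R (f + 1) = 0"
    and body: "\<And>k. k < n \<Longrightarrow> execs c (conf N x ((R' k)(f := n - Suc k, f + 1 := k)) (out k)) b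
      (conf N x ((R' (Suc k))(f := n - Suc k, f + 1 := k)) (out (Suc k)))"
    and R: "R' 0 = R" and R'_zero: "\<And>k. R' k (f + 1) = 0 \<and> R' k f = n"
  shows "execs (While (\<lambda>w. w ! f \<noteq> 3) (dec f ;; c ;; inc_if (\<lambda>_. True) (f + 1)) ;; transfer (f + 1) {})
    (conf N x R (out 0)) (n * (b + 5) + 2) (conf N x ((R' n)(f := 0)) (out n))"
proof -
  define S where "S k = conf N x ((R' k)(f := n - k, f + 1 := k)) (out k)" for k
  have "execs (While (\<lambda>w. w ! f \<noteq> 3) (dec f ;; c ;; inc_if (\<lambda>_. True) (f + 1))) (S 0)
     (n * ((1 + (b + 1)) + 1) + 1) (S n)"
  proof (rule execs_While)
    fix k assume k: "k < n"
    show "heads (S k) ! f \<noteq> 3"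
      unfolding S_def using heads_conf_zero[of f N x "(R' k)(f := n - k, f + 1 := k)" "out k"] assms(1,2) k by simp
    have "execs (dec f) (S k) 1 (conf N x (((R' k)(f := n - k, f + 1 := k))(f := n - k - 1)) (out k))"
      unfolding S_def using execs_dec[of f "(R' k)(f := n - k, f + 1 := k)"] assms(1) k by simp
    moreover have "((R' k)(f := n - k, f + 1 := k))(f := n - k - 1) = (R' k)(f := n - Suc k, f + 1 := k)"
      using k by (auto simp: fun_eq_iff)
    ultimately have 1: "execs (dec f) (S k) 1 (conf N x ((R' k)(f := n - Suc k, f + 1 := k)) (out k))"
      by simp
    have "execs (inc_if (\<lambda>_. True) (f + 1)) (conf N x ((R' (Suc k))(f := n - Suc k, f + 1 := k)) (out (Suc k))) 1 (S (Suc k))"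
      using execs_inc_if[of "f + 1" "\<lambda>_. True" N x "(R' (Suc k))(f := n - Suc k, f + 1 := k)" "out (Suc k)"]
      by (simp add: S_def)
    from execs_Seq[OF 1 execs_Seq[OF body[OF k] this]]
    show "execs (dec f ;; c ;; inc_if (\<lambda>_. True) (f + 1)) (S k) (1 + (b + 1)) (S (Suc k))" .
  next
    show "\<not> heads (S n) ! f \<noteq> 3"
      unfolding S_def using heads_conf_zero[of f N x "(R' n)(f := n - n, f + 1 := n)" "out n"] assms(1,2) by simp
  qed
  moreover have "execs (transfer (f + 1) {}) (S n) (2 * n + 1) (conf N x ((R' n)(f := 0)) (out n))"
  proof -
    have "((R' n)(f := n - n, f + 1 := n))(f + 1 := 0) = (R' n)(f := 0)"
      using R'_zero[of n] by (auto simp: fun_eq_iff)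
    then show ?thesis
      unfolding S_def using execs_clear[of "f + 1" N x "(R' n)(f := n - n, f + 1 := n)" "out n"] assms(1,2)
      by simp
  qed
  ultimately have "execs (While (\<lambda>w. w ! f \<noteq> 3) (dec f ;; c ;; inc_if (\<lambda>_. True) (f + 1)) ;; transfer (f + 1) {}) (S 0)
     ((n * ((1 + (b + 1)) + 1) + 1) + (2 * n + 1)) (conf N x ((R' n)(f := 0)) (out n))"
    by (rule execs_Seq)
  moreover have "S 0 = conf N x R (out 0)"
    using assms(3,4) by (simp add: S_def R fun_upd_idem)
  moreover have "(n * ((1 + (b + 1)) + 1) + 1) + (2 * n + 1) = n * (b + 5) + 2"
    by (simp add: algebra_simps)
  ultimately show ?thesis by metis
qed

text \<open>One polynomial bounds time and value, because a transfer takes time proportional to the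
  value and a value may become the range of a bound variable. The target differs from all variable
  registers, as it changes while variables are still being read; several variables may share a
  register.\<close>

definition compile_correct :: "exp \<Rightarrow> nat poly \<Rightarrow> bool" where
  "compile_correct e p \<longleftrightarrow> (\<forall>N x R out vs r f \<rho> B.
     f + temps e \<le> N \<and> 3 \<le> r \<and> r < f \<and> f \<le> N \<and> (\<forall>i. 2 \<le> vs i \<and> vs i < f \<and> vs i \<noteq> r) \<and> R 1 = 0 \<and>
     R 2 = length x \<and> length x \<le> B \<and> (\<forall>k\<ge>f. R k = 0) \<and> (\<forall>i. R (vs i) = \<rho> i) \<and> (\<forall>i. \<rho> i \<le> B) \<longrightarrow>
     eval e \<rho> x \<le> poly p B \<and>
     execs (compile e vs r f) (conf N x R out) (poly p B) (conf N x (R(r := R r + eval e \<rho> x)) out))"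

lemma compile_correctD:
  assumes "compile_correct e p" "f + temps e \<le> N" "3 \<le> r" "r < f" "f \<le> N"
    "\<And>i. 2 \<le> vs i \<and> vs i < f \<and> vs i \<noteq> r" "R 1 = 0" "R 2 = length x" "length x \<le> B" "\<And>k. k \<ge> f \<Longrightarrow> R k = 0"
    "\<And>i. R (vs i) = \<rho> i" "\<And>i. \<rho> i \<le> B"
  shows "eval e \<rho> x \<le> poly p B \<and>
    execs (compile e vs r f) (conf N x R out) (poly p B) (conf N x (R(r := R r + eval e \<rho> x)) out)"
  using assms unfolding compile_correct_def by blast

lemma compile_correct: "\<exists>p. compile_correct e p"
proof (induction e)
  case One
  have "compile_correct One 1"
    unfolding compile_correct_def
  proof (intro allI impI conjI)
    fix N :: nat and x :: "bool list" and R out and vs \<rho> :: "nat \<Rightarrow> nat" and r f B :: nat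
    assume "f + temps One \<le> N \<and> 3 \<le> r \<and> r < f \<and> f \<le> N \<and> (\<forall>i. 2 \<le> vs i \<and> vs i < f \<and> vs i \<noteq> r) \<and> R 1 = 0 \<and>
     R 2 = length x \<and> length x \<le> B \<and> (\<forall>k\<ge>f. R k = 0) \<and> (\<forall>i. R (vs i) = \<rho> i) \<and> (\<forall>i. \<rho> i \<le> B)"
    then show "execs (compile One vs r f) (conf N x R out) (poly 1 B) (conf N x (R(r := R r + eval One \<rho> x)) out)"
      using execs_inc_if[of r "\<lambda>_. True" N x R out] by simp
  qed simp
  then show ?case ..
next
  case Len
  have "compile_correct Len [:2, 4:]"
    unfolding compile_correct_def
  proof (intro allI impI)
    fix N :: nat and x :: "bool list" and R out and vs \<rho> :: "nat \<Rightarrow> nat" and r f B :: nat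
    assume "f + temps Len \<le> N \<and> 3 \<le> r \<and> r < f \<and> f \<le> N \<and> (\<forall>i. 2 \<le> vs i \<and> vs i < f \<and> vs i \<noteq> r) \<and> R 1 = 0 \<and>
     R 2 = length x \<and> length x \<le> B \<and> (\<forall>k\<ge>f. R k = 0) \<and> (\<forall>i. R (vs i) = \<rho> i) \<and> (\<forall>i. \<rho> i \<le> B)"
    then have *: "f < N" "2 \<le> r" "r < f" "2 < f" "2 \<noteq> r" "R f = 0" "R 2 = length x" "length x \<le> B"
      by auto
    define R1 where "R1 = (\<lambda>k. if k = 2 then 0 else if k \<in> {r, f} then R k + R 2 else R k)"
    have 1: "execs (transfer 2 {r, f}) (conf N x R out) (2 * R 2 + 1) (conf N x R1 out)"
      unfolding R1_def by (rule execs_transfer) (use * in auto)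
    have 2: "execs (transfer f {2}) (conf N x R1 out) (2 * R1 f + 1)
       (conf N x (\<lambda>k. if k = f then 0 else if k \<in> {2} then R1 k + R1 f else R1 k) out)"
      by (rule execs_transfer) (use * in auto)
    have "(\<lambda>k. if k = f then 0 else if k \<in> {2} then R1 k + R1 f else R1 k) = R(r := R r + eval Len \<rho> x)"
      using * by (auto simp: R1_def fun_eq_iff)
    moreover have "R1 f = length x"
      using * by (simp add: R1_def)
    ultimately have "execs (compile Len vs r f) (conf N x R out) ((2 * length x + 1) + (2 * length x + 1))
       (conf N x (R(r := R r + eval Len \<rho> x)) out)"
      using execs_Seq[OF 1 2] * by simp
    then show "eval Len \<rho> x \<le> poly [:2, 4:] B \<and>
      execs (compile Len vs r f) (conf N x R out) (poly [:2, 4:] B) (conf N x (R(r := R r + eval Len \<rho> x)) out)"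
      using * by (auto elim!: execs_mono)
  qed
  then show ?case ..
next
  case (Var i)
  have "compile_correct (Var i) [:2, 4:]"
    unfolding compile_correct_def
  proof (intro allI impI)
    fix N :: nat and x :: "bool list" and R out and vs \<rho> :: "nat \<Rightarrow> nat" and r f B :: nat
    assume "f + temps (Var i) \<le> N \<and> 3 \<le> r \<and> r < f \<and> f \<le> N \<and> (\<forall>i. 2 \<le> vs i \<and> vs i < f \<and> vs i \<noteq> r) \<and> R 1 = 0 \<and>
     R 2 = length x \<and> length x \<le> B \<and> (\<forall>k\<ge>f. R k = 0) \<and> (\<forall>i. R (vs i) = \<rho> i) \<and> (\<forall>i. \<rho> i \<le> B)"
    then have *: "f < N" "2 \<le> r" "r < f" "2 \<le> vs i" "vs i < f" "vs i \<noteq> r" "R f = 0" "R (vs i) = \<rho> i" "\<rho> i \<le> B"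
      by auto
    define R1 where "R1 = (\<lambda>k. if k = vs i then 0 else if k \<in> {r, f} then R k + R (vs i) else R k)"
    have 1: "execs (transfer (vs i) {r, f}) (conf N x R out) (2 * R (vs i) + 1) (conf N x R1 out)"
      unfolding R1_def by (rule execs_transfer) (use * in auto)
    have 2: "execs (transfer f {vs i}) (conf N x R1 out) (2 * R1 f + 1)
       (conf N x (\<lambda>k. if k = f then 0 else if k \<in> {vs i} then R1 k + R1 f else R1 k) out)"
      by (rule execs_transfer) (use * in auto)
    have "(\<lambda>k. if k = f then 0 else if k \<in> {vs i} then R1 k + R1 f else R1 k) = R(r := R r + eval (Var i) \<rho> x)"
      using * by (auto simp: R1_def fun_eq_iff)
    moreover have "R1 f = \<rho> i"
      using * by (simp add: R1_def)
    ultimately have "execs (compile (Var i) vs r f) (conf N x R out) ((2 * \<rho> i + 1) + (2 * \<rho> i + 1))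
       (conf N x (R(r := R r + eval (Var i) \<rho> x)) out)"
      using execs_Seq[OF 1 2] * by simp
    then show "eval (Var i) \<rho> x \<le> poly [:2, 4:] B \<and>
      execs (compile (Var i) vs r f) (conf N x R out) (poly [:2, 4:] B) (conf N x (R(r := R r + eval (Var i) \<rho> x)) out)"
      using * by (auto elim!: execs_mono)
  qed
  then show ?case ..
next
  case (Inp a)
  then obtain p where p: "compile_correct a p" ..
  have "compile_correct (Inp a) (p + (2 * p + 4) + (2 * p + 4))"
    unfolding compile_correct_def
  proof (intro allI impI)
    fix N :: nat and x :: "bool list" and R out and vs \<rho> :: "nat \<Rightarrow> nat" and r f B :: nat
    assume asm: "f + temps (Inp a) \<le> N \<and> 3 \<le> r \<and> r < f \<and> f \<le> N \<and> (\<forall>i. 2 \<le> vs i \<and> vs i < f \<and> vs i \<noteq> r) \<and> R 1 = 0 \<and>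
     R 2 = length x \<and> length x \<le> B \<and> (\<forall>k\<ge>f. R k = 0) \<and> (\<forall>i. R (vs i) = \<rho> i) \<and> (\<forall>i. \<rho> i \<le> B)"
    define v where "v = eval a \<rho> x"
    have vs: "2 \<le> vs i \<and> vs i < f" for i using asm by auto
    have a: "v \<le> poly p B \<and> execs (compile a vs f (f + 1)) (conf N x R out) (poly p B) (conf N x (R(f := R f + v)) out)"
      unfolding v_def
    proof (rule compile_correctD[OF p])
      show "2 \<le> vs i \<and> vs i < f + 1 \<and> vs i \<noteq> f" for i using vs[of i] by auto
    qed (use asm in auto)
    then have a2: "execs (compile a vs f (f + 1)) (conf N x R out) (poly p B) (conf N x (R(f := v)) out)"
      using asm by simp
    \<comment> \<open>The extra increment skips the cell of the marker, so that head 1 will scan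
      position \<open>v\<close>.\<close>
    define R2 where "R2 = R(f := v, 1 := 1)"
    have 1: "execs (inc_if (\<lambda>_. True) 1) (conf N x (R(f := v)) out) 1 (conf N x R2 out)"
      using execs_inc_if[of 1 "\<lambda>_. True" N x "R(f := v)" out] asm by (simp add: R2_def)
    define R3 where "R3 = R(1 := Suc v)"
    have 2: "execs (transfer f {1}) (conf N x R2 out) (2 * v + 1) (conf N x R3 out)"
    proof -
      have "(\<lambda>r. if r = f then 0 else if r \<in> {1} then R2 r + R2 f else R2 r) = R3"
        using asm by (auto simp: R2_def R3_def fun_eq_iff)
      then show ?thesis
        using execs_transfer[of f N "{1}" x R2 out] asm by (simp add: R2_def)
    qed
    have N: "1 < N" using asm by linarith
    let ?s = "tape_of x (int v)"
    have s: "heads (conf N x (R3(r := k)) out) ! 1 = ?s" for k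
      by (rule heads_conf_input) (use N asm in \<open>auto simp: R3_def\<close>)
    have s': "heads (conf N x R3 out) ! 1 = ?s"
      by (rule heads_conf_input) (use N in \<open>auto simp: R3_def\<close>)
    define R4 where "R4 = R3(r := R r + of_bool (?s \<noteq> 0))"
    have 3: "execs (inc_if (\<lambda>w. w ! 1 \<noteq> 0) r) (conf N x R3 out) 1 (conf N x R4 out)"
      using execs_inc_if[of r "\<lambda>w. w ! 1 \<noteq> 0" N x R3 out] asm s' by (simp add: R4_def R3_def)
    define R5 where "R5 = R3(r := R r + ?s)"
    \<comment> \<open>The codes of blank, \<open>False\<close> and \<open>True\<close> are 0, 1, 2,
      so two conditional increments add the symbol itself.\<close>
    have "?s = of_bool (?s \<noteq> 0) + of_bool (?s = 2)"
      by (auto simp: tape_of_def)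
    then have R5: "R5 = R4(r := R4 r + of_bool (?s = 2))"
      by (auto simp: R5_def R4_def fun_eq_iff)
    have 4: "execs (inc_if (\<lambda>w. w ! 1 = 2) r) (conf N x R4 out) 1 (conf N x R5 out)"
      using execs_inc_if[of r "\<lambda>w. w ! 1 = 2" N x R4 out] asm s
      unfolding R5 by (simp add: R4_def)
    have 5: "execs (transfer 1 {}) (conf N x R5 out) (2 * (Suc v) + 1) (conf N x (R(r := R r + eval (Inp a) \<rho> x)) out)"
    proof -
      have "R5(1 := 0) = R(r := R r + eval (Inp a) \<rho> x)"
        using asm by (auto simp: R5_def R3_def v_def fun_eq_iff)
      then show ?thesis
        using execs_clear[of 1 N x R5 out] N asm by (simp add: R5_def R3_def)
    qed
    have "execs (compile (Inp a) vs r f) (conf N x R out)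
      (poly p B + (1 + ((2 * v + 1) + (1 + (1 + (2 * (Suc v) + 1))))))
      (conf N x (R(r := R r + eval (Inp a) \<rho> x)) out)"
      using execs_Seq[OF a2 execs_Seq[OF 1 execs_Seq[OF 2 execs_Seq[OF 3 execs_Seq[OF 4 5]]]]] by simp
    moreover have "poly p B + (1 + ((2 * v + 1) + (1 + (1 + (2 * (Suc v) + 1))))) \<le> poly (p + (2 * p + 4) + (2 * p + 4)) B"
      using a by simp
    moreover have "eval (Inp a) \<rho> x \<le> poly (p + (2 * p + 4) + (2 * p + 4)) B"
      using tape_of_less_3[of x "int (eval a \<rho> x)"] by simp
    ultimately show "eval (Inp a) \<rho> x \<le> poly (p + (2 * p + 4) + (2 * p + 4)) B \<and>
      execs (compile (Inp a) vs r f) (conf N x R out) (poly (p + (2 * p + 4) + (2 * p + 4)) B)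
      (conf N x (R(r := R r + eval (Inp a) \<rho> x)) out)"
      using execs_mono by blast
  qed
  then show ?case ..
next
  case (Add a b)
  then obtain p q where p: "compile_correct a p" and q: "compile_correct b q" by blast
  have "compile_correct (Add a b) (p + q)"
    unfolding compile_correct_def
  proof (intro allI impI)
    fix N :: nat and x :: "bool list" and R out and vs \<rho> :: "nat \<Rightarrow> nat" and r f B :: nat
    assume asm: "f + temps (Add a b) \<le> N \<and> 3 \<le> r \<and> r < f \<and> f \<le> N \<and> (\<forall>i. 2 \<le> vs i \<and> vs i < f \<and> vs i \<noteq> r) \<and> R 1 = 0 \<and>
     R 2 = length x \<and> length x \<le> B \<and> (\<forall>k\<ge>f. R k = 0) \<and> (\<forall>i. R (vs i) = \<rho> i) \<and> (\<forall>i. \<rho> i \<le> B)"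
    let ?R = "R(r := R r + eval a \<rho> x)"
    have 1: "eval a \<rho> x \<le> poly p B \<and> execs (compile a vs r f) (conf N x R out) (poly p B) (conf N x ?R out)"
      by (rule compile_correctD[OF p]) (use asm in auto)
    have 2: "eval b \<rho> x \<le> poly q B \<and> execs (compile b vs r f) (conf N x ?R out) (poly q B)
      (conf N x (?R(r := ?R r + eval b \<rho> x)) out)"
      by (rule compile_correctD[OF q]) (use asm in auto)
    show "eval (Add a b) \<rho> x \<le> poly (p + q) B \<and> execs (compile (Add a b) vs r f) (conf N x R out)
      (poly (p + q) B) (conf N x (R(r := R r + eval (Add a b) \<rho> x)) out)"
      using execs_Seq[OF 1[THEN conjunct2] 2[THEN conjunct2]] 1 2 by (simp add: add.assoc)
  qed
  then show ?case ..
next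
  case (Sub a b)
  then obtain p q where p: "compile_correct a p" and q: "compile_correct b q" by blast
  have "compile_correct (Sub a b) (p + q + (2 * p + 1) + (2 * p + 1) + (2 * q + 1))"
    unfolding compile_correct_def
  proof (intro allI impI)
    fix N :: nat and x :: "bool list" and R out and vs \<rho> :: "nat \<Rightarrow> nat" and r f B :: nat
    assume asm: "f + temps (Sub a b) \<le> N \<and> 3 \<le> r \<and> r < f \<and> f \<le> N \<and> (\<forall>i. 2 \<le> vs i \<and> vs i < f \<and> vs i \<noteq> r) \<and> R 1 = 0 \<and>
     R 2 = length x \<and> length x \<le> B \<and> (\<forall>k\<ge>f. R k = 0) \<and> (\<forall>i. R (vs i) = \<rho> i) \<and> (\<forall>i. \<rho> i \<le> B)"
    define u v where "u = eval a \<rho> x" and "v = eval b \<rho> x"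
    have vs: "2 \<le> vs i \<and> vs i < f" for i using asm by auto
    have f: "2 \<le> f" "f + 1 < N" using asm by auto
    have "u \<le> poly p B \<and> execs (compile a vs f (f + 2)) (conf N x R out) (poly p B) (conf N x (R(f := R f + u)) out)"
      unfolding u_def
    proof (rule compile_correctD[OF p])
      show "2 \<le> vs i \<and> vs i < f + 2 \<and> vs i \<noteq> f" for i using vs[of i] by auto
    qed (use asm in auto)
    then have a: "u \<le> poly p B" "execs (compile a vs f (f + 2)) (conf N x R out) (poly p B) (conf N x (R(f := u)) out)"
      using asm by auto
    have "v \<le> poly q B \<and> execs (compile b vs (f + 1) (f + 2)) (conf N x (R(f := u)) out) (poly q B)
       (conf N x ((R(f := u))(f + 1 := (R(f := u)) (f + 1) + v)) out)"
      unfolding v_def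
    proof (rule compile_correctD[OF q])
      show "2 \<le> vs i \<and> vs i < f + 2 \<and> vs i \<noteq> f + 1" for i using vs[of i] by auto
      show "(R(f := u)) (vs i) = \<rho> i" for i using vs[of i] asm by auto
    qed (use asm in auto)
    then have b: "v \<le> poly q B" "execs (compile b vs (f + 1) (f + 2)) (conf N x (R(f := u)) out) (poly q B)
       (conf N x (R(f := u, f + 1 := v)) out)"
      using asm by auto
    \<comment> \<open>Both counters run down together until one of them is zero. This leaves the
      truncated difference \<open>u - v\<close> in register \<open>f\<close> and the remainder
      \<open>v - u\<close>, which is discarded, in register \<open>f + 1\<close>.\<close>
    define S where "S k = R(f := u - k, f + 1 := v - k)" for k
    have c: "execs (While (\<lambda>w. w ! f \<noteq> 3 \<and> w ! (f + 1) \<noteq> 3) (move (\<lambda>w i. if i = f \<or> i = f + 1 then -1 else 0)))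
      (conf N x (S 0) out) (min u v * (1 + 1) + 1) (conf N x (S (min u v)) out)"
    proof (rule execs_While)
      fix k assume k: "k < min u v"
      show "heads (conf N x (S k) out) ! f \<noteq> 3 \<and> heads (conf N x (S k) out) ! (f + 1) \<noteq> 3"
        using heads_conf_zero[of f N x "S k" out] heads_conf_zero[of "f + 1" N x "S k" out] f k
        by (simp add: S_def)
      show "execs (move (\<lambda>w i. if i = f \<or> i = f + 1 then - 1 else 0)) (conf N x (S k) out) 1 (conf N x (S (Suc k)) out)"
        by (rule execs_move) (use k f in \<open>auto simp: S_def\<close>)
    next
      have "S (min u v) f = 0 \<or> S (min u v) (f + 1) = 0"
        by (auto simp: S_def)
      then show "\<not> (heads (conf N x (S (min u v)) out) ! f \<noteq> 3 \<and> heads (conf N x (S (min u v)) out) ! (f + 1) \<noteq> 3)"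
        using heads_conf_zero[of f N x "S (min u v)" out] heads_conf_zero[of "f + 1" N x "S (min u v)" out] f
        by auto
    qed
    define R2 where "R2 = R(r := R r + (u - v), f + 1 := v - u)"
    have d: "execs (transfer f {r}) (conf N x (S (min u v)) out) (2 * (u - v) + 1) (conf N x R2 out)"
    proof -
      have "(\<lambda>k. if k = f then 0 else if k \<in> {r} then S (min u v) k + S (min u v) f else S (min u v) k) = R2"
        using asm by (auto simp: R2_def S_def fun_eq_iff)
      moreover have "S (min u v) f = u - v" by (simp add: S_def)
      ultimately show ?thesis
        using execs_transfer[of f N "{r}" x "S (min u v)" out] asm f by simp
    qed
    have e: "execs (transfer (f + 1) {}) (conf N x R2 out) (2 * (v - u) + 1) (conf N x (R(r := R r + (u - v))) out)"
    proof -
      have "R2(f + 1 := 0) = R(r := R r + (u - v))"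
        using asm by (auto simp: R2_def fun_eq_iff)
      moreover have "R2 (f + 1) = v - u" by (simp add: R2_def)
      ultimately show ?thesis
        using execs_clear[of "f + 1" N x R2 out] f by simp
    qed
    have S0: "S 0 = R(f := u, f + 1 := v)" by (simp add: S_def)
    have "execs (compile (Sub a b) vs r f) (conf N x R out)
      (poly p B + (poly q B + ((min u v * (1 + 1) + 1) + ((2 * (u - v) + 1) + (2 * (v - u) + 1)))))
      (conf N x (R(r := R r + (u - v))) out)"
      using execs_Seq[OF a(2) execs_Seq[OF b(2) execs_Seq[OF c[unfolded S0] execs_Seq[OF d e]]]] by simp
    moreover have "poly p B + (poly q B + ((min u v * (1 + 1) + 1) + ((2 * (u - v) + 1) + (2 * (v - u) + 1))))
       \<le> poly (p + q + (2 * p + 1) + (2 * p + 1) + (2 * q + 1)) B"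
      using a(1) b(1) by (simp add: min_def, arith)
    ultimately show "eval (Sub a b) \<rho> x \<le> poly (p + q + (2 * p + 1) + (2 * p + 1) + (2 * q + 1)) B \<and>
      execs (compile (Sub a b) vs r f) (conf N x R out) (poly (p + q + (2 * p + 1) + (2 * p + 1) + (2 * q + 1)) B)
      (conf N x (R(r := R r + eval (Sub a b) \<rho> x)) out)"
      using execs_mono a(1) unfolding u_def v_def by (auto simp del: compile.simps)
  qed
  then show ?case ..
next
  case (Sum a b)
  then obtain p q where p: "compile_correct a p" and q: "compile_correct b q" by blast
  \<comment> \<open>The bound variable ranges below the value of \<open>a\<close>, which may exceed
    \<open>B\<close>; the bound for the body is therefore taken at
    \<open>B + poly p B\<close>.\<close>
  define q' where "q' = pcompose q ([:0, 1:] + p)"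
  have q': "poly q' B = poly q (B + poly p B)" for B
    by (simp add: q'_def poly_pcompose)
  have "compile_correct (Sum a b) (p + p * (q' + 5) + 2)"
    unfolding compile_correct_def
  proof (intro allI impI)
    fix N :: nat and x :: "bool list" and R out and vs \<rho> :: "nat \<Rightarrow> nat" and r f B :: nat
    assume asm: "f + temps (Sum a b) \<le> N \<and> 3 \<le> r \<and> r < f \<and> f \<le> N \<and> (\<forall>i. 2 \<le> vs i \<and> vs i < f \<and> vs i \<noteq> r) \<and> R 1 = 0 \<and>
     R 2 = length x \<and> length x \<le> B \<and> (\<forall>k\<ge>f. R k = 0) \<and> (\<forall>i. R (vs i) = \<rho> i) \<and> (\<forall>i. \<rho> i \<le> B)"
    define n where "n = eval a \<rho> x"
    define g where "g k = eval b (case_nat k \<rho>) x" for k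
    have vs: "2 \<le> vs i \<and> vs i < f" for i using asm by auto
    have f: "2 \<le> f" "f + 1 < N" using asm by auto
    have "n \<le> poly p B \<and> execs (compile a vs f (f + 1)) (conf N x R out) (poly p B) (conf N x (R(f := R f + n)) out)"
      unfolding n_def
    proof (rule compile_correctD[OF p])
      show "2 \<le> vs i \<and> vs i < f + 1 \<and> vs i \<noteq> f" for i using vs[of i] by auto
    qed (use asm in auto)
    then have a: "n \<le> poly p B" "execs (compile a vs f (f + 1)) (conf N x R out) (poly p B) (conf N x (R(f := n)) out)"
      using asm by auto
    define R' where "R' k = R(f := n, r := R r + (\<Sum>i<k. g i))" for k
    have b: "g k \<le> poly q' B" "execs (compile b (case_nat (f + 1) vs) r (f + 2)) (conf N x ((R' k)(f := n - Suc k, f + 1 := k)) out) (poly q' B)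
        (conf N x ((R' (Suc k))(f := n - Suc k, f + 1 := k)) out)" if "k < n" for k
    proof -
      let ?R = "(R' k)(f := n - Suc k, f + 1 := k)"
      have *: "g k \<le> poly q (B + poly p B) \<and>
        execs (compile b (case_nat (f + 1) vs) r (f + 2)) (conf N x ?R out) (poly q (B + poly p B)) (conf N x (?R(r := ?R r + g k)) out)"
        unfolding g_def
      proof (rule compile_correctD[OF q])
        show "2 \<le> case_nat (f + 1) vs i \<and> case_nat (f + 1) vs i < f + 2 \<and> case_nat (f + 1) vs i \<noteq> r" for i
          using vs asm by (auto split: nat.splits simp: less_SucI)
        show "?R (case_nat (f + 1) vs i) = case_nat k \<rho> i" for i
        proof (cases i)
          case (Suc j)
          have *: "vs j < f" "vs j \<noteq> r" "R (vs j) = \<rho> j"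
            using asm by blast+
          then have "vs j \<noteq> f" "vs j \<noteq> Suc f" by linarith+
          with * Suc show ?thesis
            by (simp add: R'_def)
        qed simp
        show "case_nat k \<rho> i \<le> B + poly p B" for i
          using asm that a(1) by (auto split: nat.splits simp: trans_le_add1)
      qed (use asm in \<open>auto simp: R'_def\<close>)
      have "?R(r := ?R r + g k) = (R' (Suc k))(f := n - Suc k, f + 1 := k)"
        using asm by (auto simp: R'_def fun_eq_iff)
      with * show "g k \<le> poly q' B" "execs (compile b (case_nat (f + 1) vs) r (f + 2)) (conf N x ?R out) (poly q' B)
        (conf N x ((R' (Suc k))(f := n - Suc k, f + 1 := k)) out)"
        by (simp_all only: q')
    qed
    have c: "execs (While (\<lambda>w. w ! f \<noteq> 3)
       (dec f ;; compile b (case_nat (f + 1) vs) r (f + 2) ;; inc_if (\<lambda>_. True) (f + 1)) ;; transfer (f + 1) {})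
       (conf N x (R(f := n)) out) (n * (poly q' B + 5) + 2) (conf N x ((R' n)(f := 0)) out)"
      by (rule execs_count_loop[of f N "R(f := n)" n _ x R' "\<lambda>_. out" "poly q' B"])
         (use f asm b in \<open>auto simp: R'_def\<close>)
    have "(R' n)(f := 0) = R(r := R r + eval (Sum a b) \<rho> x)"
      using asm by (auto simp: R'_def g_def n_def fun_eq_iff)
    with execs_Seq[OF a(2) c]
    have "execs (compile (Sum a b) vs r f) (conf N x R out) (poly p B + (n * (poly q' B + 5) + 2))
      (conf N x (R(r := R r + eval (Sum a b) \<rho> x)) out)"
      by simp
    moreover have "poly p B + (n * (poly q' B + 5) + 2) \<le> poly (p + p * (q' + 5) + 2) B"
      using mult_le_mono1[OF a(1), of "poly q' B + 5"] by simp
    moreover have "eval (Sum a b) \<rho> x \<le> n * poly q' B"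
      using sum_bounded_above[of "{..<n}" g "poly q' B"] b(1) by (simp add: n_def g_def)
    then have "eval (Sum a b) \<rho> x \<le> poly (p + p * (q' + 5) + 2) B"
      using mult_le_mono[OF a(1), of "poly q' B" "poly q' B + 5"] by simp
    ultimately show "eval (Sum a b) \<rho> x \<le> poly (p + p * (q' + 5) + 2) B \<and>
      execs (compile (Sum a b) vs r f) (conf N x R out) (poly (p + p * (q' + 5) + 2) B)
      (conf N x (R(r := R r + eval (Sum a b) \<rho> x)) out)"
      using execs_mono by blast
  qed
  then show ?case ..
qed


section \<open>Programs that write a string\<close>

datatype prog = Bit exp | PSeq prog prog | For exp prog

primrec outs :: "prog \<Rightarrow> (nat \<Rightarrow> nat) \<Rightarrow> bool list \<Rightarrow> bool list" where
  "outs (Bit e) \<rho> x = [eval e \<rho> x \<noteq> 0]"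
| "outs (PSeq P Q) \<rho> x = outs P \<rho> x @ outs Q \<rho> x"
| "outs (For e P) \<rho> x = concat (map (\<lambda>k. outs P (case_nat k \<rho>) x) [0..<eval e \<rho> x])"

primrec ptemps :: "prog \<Rightarrow> nat" where
  "ptemps (Bit e) = 1 + temps e"
| "ptemps (PSeq P Q) = max (ptemps P) (ptemps Q)"
| "ptemps (For e P) = 2 + max (temps e) (ptemps P)"

definition emit :: "nat \<Rightarrow> cmd" where
  "emit f = Do (\<lambda>w. map (\<lambda>r. if r = 0 then (if w ! f = 3 then 1 else 2, 1) else (w ! r, 0)) [0..<length w])"

primrec pcompile :: "prog \<Rightarrow> (nat \<Rightarrow> nat) \<Rightarrow> nat \<Rightarrow> cmd" where
  "pcompile (Bit e) vs f = compile e vs f (f + 1) ;; emit f ;; transfer f {}"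
| "pcompile (PSeq P Q) vs f = pcompile P vs f ;; pcompile Q vs f"
| "pcompile (For e P) vs f = compile e vs f (f + 1) ;;
     While (\<lambda>w. w ! f \<noteq> 3)
       (dec f ;; pcompile P (case_nat (f + 1) vs) (f + 2) ;; inc_if (\<lambda>_. True) (f + 1)) ;;
     transfer (f + 1) {}"

lemma nth_less: "set w \<subseteq> {..<n} \<Longrightarrow> r < length w \<Longrightarrow> w ! r < n"
  by (meson nth_mem lessThan_iff subsetD)

lemma wf_emit: "wf_cmd N (emit f)"
  by (auto simp: emit_def intro: nth_less)

lemma wf_pcompile: "wf_cmd N (pcompile P vs f)"
  by (induction P arbitrary: vs f) (simp_all add: wf_compile wf_emit wf_inc_if wf_dec wf_transfer)

lemma tape_of_snoc: "(tape_of xs)(int (length xs) := if b then 2 else 1) = tape_of (xs @ [b])"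
  by (auto simp: tape_of_def fun_eq_iff nth_append nat_less_iff)

lemma execs_emit:
  assumes "1 \<le> f" "f < N"
  shows "execs (emit f) (conf N x R out) 1 (conf N x R (out @ [R f \<noteq> 0]))"
proof -
  let ?w = "heads (conf N x R out)"
  let ?a = "\<lambda>r. if r = 0 then (if ?w ! f = 3 then 1 else 2, 1) else (?w ! r, 0)"
  have "map2 act (map ?a [0..<length ?w]) (conf N x R out) = conf N x R (out @ [R f \<noteq> 0])"
  proof (rule nth_equalityI)
    fix r assume "r < length (map2 act (map ?a [0..<length ?w]) (conf N x R out))"
    then have r: "r < N" by (simp add: conf_def heads_def)
    have nth_conf: "length ?w = N" "length (conf N x R out') = N" "conf N x R out' ! r = reg_tape x R out' r" for out'
      using r by (simp_all add: conf_def heads_def)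
    have "act (?a r) (reg_tape x R out r) = reg_tape x R (out @ [R f \<noteq> 0]) r"
    proof (cases "r = 0")
      case True
      have "(if i + 1 = 0 then if R f = 0 then 1 else 2 else tape_of out (i + 1 + int (length out))) =
        tape_of (out @ [R f \<noteq> 0]) (i + int (length (out @ [R f \<noteq> 0])))" for i
        unfolding tape_of_snoc[of out, symmetric] by (auto simp: algebra_simps)
      then show ?thesis
        using True heads_conf_zero[OF assms, of x R out] by (simp add: act_def reg_tape_def fun_eq_iff)
    next
      case False
      then show ?thesis
        using r by (auto simp: act_def reg_tape_def heads_def conf_def)
    qed
    then show "map2 act (map ?a [0..<length ?w]) (conf N x R out) ! r = conf N x R (out @ [R f \<noteq> 0]) ! r"
      using r by (auto simp: nth_conf split: if_splits)
  qed (simp add: conf_def heads_def)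
  then show ?thesis
    unfolding execs_def emit_def
    using exec.Do[of "\<lambda>w. map (\<lambda>r. if r = 0 then (if w ! f = 3 then 1 else 2, 1) else (w ! r, 0)) [0..<length w]" "conf N x R out"]
    by auto
qed

definition pcompile_correct :: "prog \<Rightarrow> nat poly \<Rightarrow> bool" where
  "pcompile_correct P p \<longleftrightarrow> (\<forall>N x R out vs f \<rho> B.
     f + ptemps P \<le> N \<and> 3 \<le> f \<and> (\<forall>i. 2 \<le> vs i \<and> vs i < f) \<and> R 1 = 0 \<and>
     R 2 = length x \<and> length x \<le> B \<and> (\<forall>k\<ge>f. R k = 0) \<and> (\<forall>i. R (vs i) = \<rho> i) \<and> (\<forall>i. \<rho> i \<le> B) \<longrightarrow>
     length (outs P \<rho> x) \<le> poly p B \<and>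
     execs (pcompile P vs f) (conf N x R out) (poly p B) (conf N x R (out @ outs P \<rho> x)))"

lemma pcompile_correct: "\<exists>p. pcompile_correct P p"
proof (induction P)
  case (Bit e)
  obtain p where p: "compile_correct e p"
    using compile_correct by blast
  have "pcompile_correct (Bit e) (3 * p + 2)"
    unfolding pcompile_correct_def
  proof (intro allI impI)
    fix N :: nat and x :: "bool list" and R out and vs \<rho> :: "nat \<Rightarrow> nat" and f B :: nat
    assume asm: "f + ptemps (Bit e) \<le> N \<and> 3 \<le> f \<and> (\<forall>i. 2 \<le> vs i \<and> vs i < f) \<and> R 1 = 0 \<and>
     R 2 = length x \<and> length x \<le> B \<and> (\<forall>k\<ge>f. R k = 0) \<and> (\<forall>i. R (vs i) = \<rho> i) \<and> (\<forall>i. \<rho> i \<le> B)"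
    define v where "v = eval e \<rho> x"
    have vs: "2 \<le> vs i \<and> vs i < f" for i using asm by auto
    have "v \<le> poly p B \<and> execs (compile e vs f (f + 1)) (conf N x R out) (poly p B) (conf N x (R(f := R f + v)) out)"
      unfolding v_def
    proof (rule compile_correctD[OF p])
      show "2 \<le> vs i \<and> vs i < f + 1 \<and> vs i \<noteq> f" for i using vs[of i] by auto
    qed (use asm in auto)
    then have a: "v \<le> poly p B" "execs (compile e vs f (f + 1)) (conf N x R out) (poly p B) (conf N x (R(f := v)) out)"
      using asm by auto
    have b: "execs (emit f) (conf N x (R(f := v)) out) 1 (conf N x (R(f := v)) (out @ outs (Bit e) \<rho> x))"
      using execs_emit[of f N x "R(f := v)" out] asm by (simp add: v_def)
    have "(R(f := v))(f := 0) = R"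
      using asm by auto
    then have c: "execs (transfer f {}) (conf N x (R(f := v)) (out @ outs (Bit e) \<rho> x)) (2 * v + 1) (conf N x R (out @ outs (Bit e) \<rho> x))"
      using execs_clear[of f N x "R(f := v)" "out @ outs (Bit e) \<rho> x"] asm by simp
    show "length (outs (Bit e) \<rho> x) \<le> poly (3 * p + 2) B \<and>
      execs (pcompile (Bit e) vs f) (conf N x R out) (poly (3 * p + 2) B) (conf N x R (out @ outs (Bit e) \<rho> x))"
      using execs_Seq[OF a(2) execs_Seq[OF b c]] a(1) by (auto elim!: execs_mono)
  qed
  then show ?case ..
next
  case (PSeq P Q)
  then obtain p q where p: "pcompile_correct P p" and q: "pcompile_correct Q q" by blast
  have "pcompile_correct (PSeq P Q) (p + q)"
    unfolding pcompile_correct_def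
  proof (intro allI impI)
    fix N :: nat and x :: "bool list" and R out and vs \<rho> :: "nat \<Rightarrow> nat" and f B :: nat
    assume asm: "f + ptemps (PSeq P Q) \<le> N \<and> 3 \<le> f \<and> (\<forall>i. 2 \<le> vs i \<and> vs i < f) \<and> R 1 = 0 \<and>
     R 2 = length x \<and> length x \<le> B \<and> (\<forall>k\<ge>f. R k = 0) \<and> (\<forall>i. R (vs i) = \<rho> i) \<and> (\<forall>i. \<rho> i \<le> B)"
    have le: "f + ptemps P \<le> N" "f + ptemps Q \<le> N"
      using asm by auto
    have 1: "length (outs P \<rho> x) \<le> poly p B \<and>
      execs (pcompile P vs f) (conf N x R out) (poly p B) (conf N x R (out @ outs P \<rho> x))"
      using p[unfolded pcompile_correct_def, rule_format, of f N vs R x B \<rho> out] le asm by simp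
    have 2: "length (outs Q \<rho> x) \<le> poly q B \<and>
      execs (pcompile Q vs f) (conf N x R (out @ outs P \<rho> x)) (poly q B) (conf N x R ((out @ outs P \<rho> x) @ outs Q \<rho> x))"
      using q[unfolded pcompile_correct_def, rule_format, of f N vs R x B \<rho> "out @ outs P \<rho> x"] le asm by simp
    show "length (outs (PSeq P Q) \<rho> x) \<le> poly (p + q) B \<and>
      execs (pcompile (PSeq P Q) vs f) (conf N x R out) (poly (p + q) B) (conf N x R (out @ outs (PSeq P Q) \<rho> x))"
      using execs_Seq[OF 1[THEN conjunct2] 2[THEN conjunct2]] 1 2 by simp
  qed
  then show ?case ..
next
  case (For e P)
  then obtain q where q: "pcompile_correct P q" by blast
  obtain p where p: "compile_correct e p"
    using compile_correct by blast
  define q' where "q' = pcompose q ([:0, 1:] + p)"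
  have q': "poly q' B = poly q (B + poly p B)" for B
    by (simp add: q'_def poly_pcompose)
  have "pcompile_correct (For e P) (p + p * (q' + 5) + 2)"
    unfolding pcompile_correct_def
  proof (intro allI impI)
    fix N :: nat and x :: "bool list" and R out and vs \<rho> :: "nat \<Rightarrow> nat" and f B :: nat
    assume asm: "f + ptemps (For e P) \<le> N \<and> 3 \<le> f \<and> (\<forall>i. 2 \<le> vs i \<and> vs i < f) \<and> R 1 = 0 \<and>
     R 2 = length x \<and> length x \<le> B \<and> (\<forall>k\<ge>f. R k = 0) \<and> (\<forall>i. R (vs i) = \<rho> i) \<and> (\<forall>i. \<rho> i \<le> B)"
    define n where "n = eval e \<rho> x"
    define g where "g k = outs P (case_nat k \<rho>) x" for k
    have vs: "2 \<le> vs i \<and> vs i < f" for i using asm by auto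
    have "n \<le> poly p B \<and> execs (compile e vs f (f + 1)) (conf N x R out) (poly p B) (conf N x (R(f := R f + n)) out)"
      unfolding n_def
    proof (rule compile_correctD[OF p])
      show "2 \<le> vs i \<and> vs i < f + 1 \<and> vs i \<noteq> f" for i using vs[of i] by auto
    qed (use asm in auto)
    then have a: "n \<le> poly p B" "execs (compile e vs f (f + 1)) (conf N x R out) (poly p B) (conf N x (R(f := n)) out)"
      using asm by auto
    define o' where "o' k = out @ concat (map g [0..<k])" for k
    have b: "length (g k) \<le> poly q' B \<and>
      execs (pcompile P (case_nat (f + 1) vs) (f + 2)) (conf N x ((R(f := n))(f := n - Suc k, f + 1 := k)) (o' k)) (poly q' B)
        (conf N x ((R(f := n))(f := n - Suc k, f + 1 := k)) (o' (Suc k)))" if k: "k < n" for k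
    proof -
      let ?R = "(R(f := n))(f := n - Suc k, f + 1 := k)"
      have "2 \<le> case_nat (f + 1) vs i \<and> case_nat (f + 1) vs i < f + 2" for i
        using vs asm by (auto split: nat.splits simp: less_SucI)
      moreover have "?R (case_nat (f + 1) vs i) = case_nat k \<rho> i" for i
      proof (cases i)
        case (Suc j)
        have *: "vs j < f" "R (vs j) = \<rho> j"
          using asm by blast+
        then have "vs j \<noteq> f" "vs j \<noteq> Suc f" by linarith+
        with * Suc show ?thesis
          by simp
      qed simp
      moreover have "case_nat k \<rho> i \<le> B + poly p B" for i
        using asm k a(1) by (auto split: nat.splits simp: trans_le_add1)
      moreover have "o' (Suc k) = o' k @ outs P (case_nat k \<rho>) x"
        by (simp add: o'_def g_def)
      moreover have "f + 2 + ptemps P \<le> N" "?R 1 = 0" "\<forall>i\<ge>f + 2. ?R i = 0" "3 \<le> f + 2"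
        "?R 2 = length x" "length x \<le> B + poly p B"
        using asm by auto
      ultimately show ?thesis
        unfolding q' g_def using q[unfolded pcompile_correct_def, rule_format,
          of "f + 2" N "case_nat (f + 1) vs" ?R x "B + poly p B" "case_nat k \<rho>" "o' k"] by simp
    qed
    have "execs (While (\<lambda>w. w ! f \<noteq> 3)
       (dec f ;; pcompile P (case_nat (f + 1) vs) (f + 2) ;; inc_if (\<lambda>_. True) (f + 1)) ;; transfer (f + 1) {})
       (conf N x (R(f := n)) (o' 0)) (n * (poly q' B + 5) + 2) (conf N x ((R(f := n))(f := 0)) (o' n))"
      by (rule execs_count_loop[of f N "R(f := n)" n _ x "\<lambda>_. R(f := n)" o' "poly q' B"])
         (use asm b in auto)
    moreover have "(R(f := n))(f := 0) = R" "o' 0 = out" "o' n = out @ outs (For e P) \<rho> x"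
      using asm by (auto simp: o'_def g_def[abs_def] n_def)
    ultimately have c: "execs (While (\<lambda>w. w ! f \<noteq> 3)
       (dec f ;; pcompile P (case_nat (f + 1) vs) (f + 2) ;; inc_if (\<lambda>_. True) (f + 1)) ;; transfer (f + 1) {})
       (conf N x (R(f := n)) out) (n * (poly q' B + 5) + 2) (conf N x R (out @ outs (For e P) \<rho> x))"
      by metis
    have "execs (pcompile (For e P) vs f) (conf N x R out) (poly p B + (n * (poly q' B + 5) + 2))
      (conf N x R (out @ outs (For e P) \<rho> x))"
      using execs_Seq[OF a(2) c] by simp
    moreover have "poly p B + (n * (poly q' B + 5) + 2) \<le> poly (p + p * (q' + 5) + 2) B"
      using mult_le_mono1[OF a(1), of "poly q' B + 5"] by simp
    moreover have "length (outs (For e P) \<rho> x) \<le> n * poly q' B"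
    proof -
      have "length (outs (For e P) \<rho> x) = (\<Sum>k<n. length (g k))"
        by (simp add: length_concat n_def g_def comp_def interv_sum_list_conv_sum_set_nat atLeast0LessThan)
      then show ?thesis
        using sum_bounded_above[of "{..<n}" "\<lambda>k. length (g k)" "poly q' B"] b by simp
    qed
    then have "length (outs (For e P) \<rho> x) \<le> poly (p + p * (q' + 5) + 2) B"
      using mult_le_mono[OF a(1), of "poly q' B" "poly q' B + 5"] by simp
    ultimately show "length (outs (For e P) \<rho> x) \<le> poly (p + p * (q' + 5) + 2) B \<and>
      execs (pcompile (For e P) vs f) (conf N x R out) (poly (p + p * (q' + 5) + 2) B)
      (conf N x R (out @ outs (For e P) \<rho> x))"
      using execs_mono by blast
  qed
  then show ?case ..
qed

text \<open>
  Set up the registers, moving the input to tape 1 and storing its length in register 2; finally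
  return to the beginning of the output.
\<close>

definition start :: cmd where
  "start = Do (\<lambda>w. map (\<lambda>r. if r = 0 then (w ! r, 0) else if r = 1 then (3, 1) else (3, 0)) [0..<length w]) ;;
     While (\<lambda>w. w ! 0 \<noteq> 0)
       (Do (\<lambda>w. map (\<lambda>r. if r = 0 then (0, 1) else if r = 1 then (w ! 0, 1)
          else (w ! r, if r = 2 then 1 else 0)) [0..<length w])) ;;
     transfer 1 {}"

definition finish :: cmd where
  "finish = (let go = (\<lambda>d. Do (\<lambda>w. map (\<lambda>r. (w ! r, if r = 0 then d else 0)) [0..<length w])) in
     go (-1) ;; While (\<lambda>w. w ! 0 \<noteq> 0) (go (-1)) ;; go 1)"

lemma wf_start: "wf_cmd N start"
  by (auto simp: start_def wf_transfer intro: nth_less split: if_splits)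

lemma wf_finish: "wf_cmd N finish"
  by (auto simp: finish_def Let_def intro: nth_less split: if_splits)

lemma execs_Do:
  assumes "length ts = length ts'" "length (f (heads ts)) = length ts"
    "\<And>r. r < length ts \<Longrightarrow> act (f (heads ts) ! r) (ts ! r) = ts' ! r"
  shows "execs (Do f) ts 1 ts'"
proof -
  have "map2 act (f (heads ts)) ts = ts'"
    using assms by (intro nth_equalityI) auto
  then show ?thesis
    unfolding execs_def using exec.Do by (metis le_refl)
qed

lemma execs_start:
  assumes "3 \<le> N"
  shows "execs start (map tape_of (x # replicate (N - 1) [])) (4 * length x + 5)
    (conf N x (\<lambda>r. if r = 2 then length x else 0) [])"
proof -
  \<comment> \<open>The tapes after \<open>k\<close> rounds: \<open>k\<close> bits have been erased
    from tape 0 and copied behind the marker of tape 1, and register 2 has counted them.\<close>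
  define S where "S k = map (\<lambda>r. if r = 0 then (\<lambda>i. if i < 0 then 0 else tape_of x (i + int k))
     else if r = 1 then (\<lambda>i. if i + int k + 1 = 0 then 3 else if i < 0 then tape_of x (i + int k) else 0)
     else (\<lambda>i. if i + (if r = 2 then int k else 0) = 0 then 3 else 0)) [0..<N]" for k
  have nth: "S k ! r = (if r = 0 then (\<lambda>i. if i < 0 then 0 else tape_of x (i + int k))
     else if r = 1 then (\<lambda>i. if i + int k + 1 = 0 then 3 else if i < 0 then tape_of x (i + int k) else 0)
     else (\<lambda>i. if i + (if r = 2 then int k else 0) = 0 then 3 else 0))" if "r < N" for k r
    using that by (simp add: S_def)
  have len: "length (S k) = N" for k by (simp add: S_def)
  have hd: "heads (S k) ! r = (S k ! r) 0" if "r < N" for k r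
    using that by (simp add: heads_def len)
  have lenh: "length (heads ts) = length ts" for ts by (simp add: heads_def)
  have neg: "tape_of x i = 0" if "i < 0" for x i using that by (simp add: tape_of_def)
  have 1: "execs (Do (\<lambda>w. map (\<lambda>r. if r = 0 then (w ! r, 0) else if r = 1 then (3, 1) else (3, 0)) [0..<length w]))
     (map tape_of (x # replicate (N - 1) [])) 1 (S 0)"
  proof (rule execs_Do)
    fix r assume "r < length (map tape_of (x # replicate (N - 1) []))"
    then have r: "r < N" using assms by simp
    have "(x # replicate (N - 1) []) ! r = (if r = 0 then x else [])"
      using r by (cases r) auto
    then show "act (map (\<lambda>r. if r = 0 then (heads (map tape_of (x # replicate (N - 1) [])) ! r, 0)
       else if r = 1 then (3, 1) else (3, 0)) [0..<length (heads (map tape_of (x # replicate (N - 1) [])))] ! r)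
       (map tape_of (x # replicate (N - 1) []) ! r) = S 0 ! r"
      using r assms by (auto simp: nth lenh heads_def act_def fun_eq_iff neg tape_of_def)
  qed (use assms in \<open>auto simp: len heads_def\<close>)
  have 2: "execs (While (\<lambda>w. w ! 0 \<noteq> 0)
       (Do (\<lambda>w. map (\<lambda>r. if r = 0 then (0, 1) else if r = 1 then (w ! 0, 1)
          else (w ! r, if r = 2 then 1 else 0)) [0..<length w]))) (S 0) (length x * (1 + 1) + 1) (S (length x))"
  proof (rule execs_While)
    fix k assume k: "k < length x"
    show "heads (S k) ! 0 \<noteq> 0"
      using assms k by (simp add: hd nth tape_of_def)
    show "execs (Do (\<lambda>w. map (\<lambda>r. if r = 0 then (0, 1) else if r = 1 then (w ! 0, 1)
          else (w ! r, if r = 2 then 1 else 0)) [0..<length w])) (S k) 1 (S (Suc k))"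
    proof (rule execs_Do)
      fix r assume "r < length (S k)"
      then have r: "r < N" by (simp add: len)
      show "act (map (\<lambda>r. if r = 0 then (0, 1) else if r = 1 then (heads (S k) ! 0, 1)
          else (heads (S k) ! r, if r = 2 then 1 else 0)) [0..<length (heads (S k))] ! r) (S k ! r) = S (Suc k) ! r"
        using r assms
        by (auto simp: nth lenh len hd act_def fun_eq_iff algebra_simps intro!: arg_cong[where f = "tape_of x"])
    qed (auto simp: len lenh)
  next
    show "\<not> heads (S (length x)) ! 0 \<noteq> 0"
      using assms by (simp add: hd nth tape_of_def)
  qed
  have 3: "S (length x) = conf N x (\<lambda>r. if r = 1 then Suc (length x) else if r = 2 then length x else 0) []"
    by (rule nth_equalityI) (auto simp: len conf_def nth reg_tape_def fun_eq_iff tape_of_def)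
  have 4: "execs (transfer 1 {}) (S (length x)) (2 * Suc (length x) + 1)
    (conf N x (\<lambda>r. if r = 2 then length x else 0) [])"
  proof -
    let ?R = "\<lambda>r::nat. if r = 1 then Suc (length x) else if r = 2 then length x else 0"
    have "?R(1 := 0) = (\<lambda>r::nat. if r = 2 then length x else 0)" by auto
    then show ?thesis
      unfolding 3 using execs_clear[of 1 N x ?R "[]"] assms by simp
  qed
  show ?thesis
    using execs_Seq[OF 1 execs_Seq[OF 2 4]] unfolding start_def by (auto elim!: execs_mono)
qed

text \<open>The output leaves its head behind the last bit. The cell in front of the first bit is
  blank, so going left to the next blank and then one step right reaches the position where
  \<open>computes_within\<close> reads the result.\<close>

lemma execs_finish:
  assumes "1 \<le> N"
  shows "\<exists>ts. execs finish (conf N x R out) (2 * length out + 3) ts \<and> hd ts = tape_of out"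
proof -
  define S where "S d = map (\<lambda>r. if r = 0 then (\<lambda>i. tape_of out (i + d)) else reg_tape x R out r) [0..<N]" for d
  define go where "go d = Do (\<lambda>w. map (\<lambda>r. (w ! r, if r = 0 then d else 0)) [0..<length w])" for d :: int
  have len: "length (S d) = N" "length (heads (S d)) = N" for d by (auto simp: S_def heads_def)
  have hd0: "heads (S d) ! 0 = tape_of out d" for d
    using assms by (simp add: heads_def S_def)
  have go: "execs (go d) (S e) 1 (S (e + d))" for d e
    unfolding go_def
    by (rule execs_Do) (auto simp: len S_def act_def heads_def fun_eq_iff intro!: arg_cong[where f = "tape_of out"])
  have c: "conf N x R out = S (int (length out))"
    by (auto simp: conf_def S_def reg_tape_def)
  have 1: "execs (go (-1)) (conf N x R out) 1 (S (int (length out) - 1))"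
    unfolding c using go[of "-1" "int (length out)"] by simp
  define T where "T k = S (int (length out) - 1 - int k)" for k
  have "execs (While (\<lambda>w. w ! 0 \<noteq> 0) (go (-1))) (T 0) (length out * (1 + 1) + 1) (T (length out))"
  proof (rule execs_While)
    fix k assume "k < length out"
    then show "heads (T k) ! 0 \<noteq> 0"
      by (simp add: T_def hd0 tape_of_def)
    show "execs (go (- 1)) (T k) 1 (T (Suc k))"
      using go[of "-1" "int (length out) - 1 - int k"] by (simp add: T_def algebra_simps)
  qed (simp add: T_def hd0 tape_of_def)
  then have 2: "execs (While (\<lambda>w. w ! 0 \<noteq> 0) (go (-1))) (S (int (length out) - 1)) (length out * (1 + 1) + 1) (S (-1))"
    by (simp add: T_def)
  have 3: "execs (go 1) (S (-1)) 1 (S 0)"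
    using go[of 1 "-1"] by simp
  have "hd (S 0) = tape_of out"
    using assms by (simp add: S_def hd_map)
  moreover have "finish = go (-1) ;; While (\<lambda>w. w ! 0 \<noteq> 0) (go (-1)) ;; go 1"
    by (simp add: finish_def go_def)
  then have "execs finish (conf N x R out) (2 * length out + 3) (S 0)"
    using execs_Seq[OF 1 execs_Seq[OF 2 3]] by (auto elim!: execs_mono)
  ultimately show ?thesis by blast
qed

text \<open>At the top level every variable is assigned register 2, which holds the length of the
  input; this explains the constant environment.\<close>

theorem poly_time_computable_outs:
  "poly_time_computable 1 (\<lambda>xs. outs P (\<lambda>_. length (xs ! 0)) (xs ! 0))"
proof -
  obtain p where p: "pcompile_correct P p"
    using pcompile_correct by blast
  define N where "N = 3 + ptemps P"
  let ?c = "start ;; pcompile P (\<lambda>_. 2) 3 ;; finish"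
  have "\<exists>t\<le>poly ([:5, 4:] + p + 2 * p + 3) (length x). \<exists>ts. exec ?c (map tape_of (x # replicate (N - 1) [])) t ts \<and>
      (\<forall>i\<in>{0..int (length (outs P (\<lambda>_. length x) x))}. hd ts i = tape_of (outs P (\<lambda>_. length x) x) i)" for x
  proof -
    let ?R = "\<lambda>r. if r = 2 then length x else 0" and ?o = "outs P (\<lambda>_. length x) x"
    have 1: "execs start (map tape_of (x # replicate (N - 1) [])) (4 * length x + 5) (conf N x ?R [])"
      by (rule execs_start) (simp add: N_def)
    have 2: "length ?o \<le> poly p (length x) \<and>
      execs (pcompile P (\<lambda>_. 2) 3) (conf N x ?R []) (poly p (length x)) (conf N x ?R ([] @ ?o))"
      using p[unfolded pcompile_correct_def, rule_format, of 3 N "\<lambda>_. 2" ?R x "length x" "\<lambda>_. length x" "[]"]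
      by (simp add: N_def)
    obtain ts where 3: "execs finish (conf N x ?R ([] @ ?o)) (2 * length ?o + 3) ts" and ts: "hd ts = tape_of ?o"
      using execs_finish[of N x ?R "[] @ ?o"] by (auto simp: N_def)
    have "4 * length x + 5 + (poly p (length x) + (2 * length ?o + 3)) \<le> poly ([:5, 4:] + p + 2 * p + 3) (length x)"
      using 2 by simp
    from execs_mono[OF execs_Seq[OF 1 execs_Seq[OF 2[THEN conjunct2] 3]] this]
    obtain t where t: "t \<le> poly ([:5, 4:] + p + 2 * p + 3) (length x)"
      "exec ?c (map tape_of (x # replicate (N - 1) [])) t ts"
      unfolding execs_def by blast
    show ?thesis
      by (intro exI[of _ t] exI[of _ ts] conjI t) (simp add: ts)
  qed
  then show ?thesis
    by (intro poly_time_computable_cmd[of N ?c "[:5, 4:] + p + 2 * p + 3"])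
      (auto simp: wf_start wf_pcompile wf_finish N_def)
qed

section \<open>Expressible functions\<close>

type_synonym fn = "(nat \<Rightarrow> nat) \<Rightarrow> bool list \<Rightarrow> nat"

text \<open>The notion is semantic: closure properties become introduction rules on functions, and
  expressions for the labels of the graph need never be written down.\<close>

definition expressible :: "fn \<Rightarrow> bool" where
  "expressible F \<longleftrightarrow> (\<exists>e. \<forall>\<rho> x. eval e \<rho> x = F \<rho> x)"

abbreviation decidable :: "((nat \<Rightarrow> nat) \<Rightarrow> bool list \<Rightarrow> bool) \<Rightarrow> bool" where
  "decidable P \<equiv> expressible (\<lambda>\<rho> x. of_bool (P \<rho> x))"

primrec rename :: "(nat \<Rightarrow> nat) \<Rightarrow> exp \<Rightarrow> exp" where
  "rename s One = One"
| "rename s Len = Len"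
| "rename s (Var i) = Var (s i)"
| "rename s (Inp a) = Inp (rename s a)"
| "rename s (Add a b) = Add (rename s a) (rename s b)"
| "rename s (Sub a b) = Sub (rename s a) (rename s b)"
| "rename s (Sum a b) = Sum (rename s a) (rename (case_nat 0 (\<lambda>i. Suc (s i))) b)"

lemma eval_rename: "eval (rename s e) \<rho> x = eval e (\<lambda>i. \<rho> (s i)) x"
proof (induction e arbitrary: s \<rho>)
  case (Sum a b)
  have "(\<lambda>i. case_nat k \<rho> (case_nat 0 (\<lambda>i. Suc (s i)) i)) = case_nat k (\<lambda>i. \<rho> (s i))" for k
    by (auto split: nat.splits)
  then show ?case
    using Sum by simp
qed auto

named_theorems expr_intros

lemma expressible_var [expr_intros]: "expressible (\<lambda>\<rho> x. \<rho> i)"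
  unfolding expressible_def by (rule exI[of _ "Var i"]) simp

lemma expressible_length [expr_intros]: "expressible (\<lambda>\<rho> x. length x)"
  unfolding expressible_def by (rule exI[of _ Len]) simp

lemma expressible_add [expr_intros]:
  "expressible F \<Longrightarrow> expressible G \<Longrightarrow> expressible (\<lambda>\<rho> x. F \<rho> x + G \<rho> x)"
  unfolding expressible_def by (metis eval.simps(5))

lemma expressible_diff [expr_intros]:
  "expressible F \<Longrightarrow> expressible G \<Longrightarrow> expressible (\<lambda>\<rho> x. F \<rho> x - G \<rho> x)"
  unfolding expressible_def by (metis eval.simps(6))

lemma expressible_input [expr_intros]:
  "expressible F \<Longrightarrow> expressible (\<lambda>\<rho> x. tape_of x (int (F \<rho> x)))"
  unfolding expressible_def by (metis eval.simps(4))

lemma expressible_const [expr_intros]: "expressible (\<lambda>\<rho> x. c)"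
proof (induction c)
  case 0
  have "eval (Sub One One) \<rho> x = 0" for \<rho> x by simp
  then show ?case unfolding expressible_def by blast
next
  case (Suc c)
  have "expressible (\<lambda>\<rho> x. 1)"
    unfolding expressible_def by (rule exI[of _ One]) simp
  from expressible_add[OF Suc this] show ?case by simp
qed

lemma expressible_sum:
  assumes "expressible F" "expressible (\<lambda>\<rho> x. G (\<rho> 0) (\<lambda>i. \<rho> (Suc i)) x)"
  shows "expressible (\<lambda>\<rho> x. \<Sum>k<F \<rho> x. G k \<rho> x)"
proof -
  obtain e where e: "\<And>\<rho> x. eval e \<rho> x = F \<rho> x"
    using assms(1) unfolding expressible_def by blast
  obtain e' where e': "\<And>\<rho> x. eval e' \<rho> x = G (\<rho> 0) (\<lambda>i. \<rho> (Suc i)) x"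
    using assms(2) unfolding expressible_def by blast
  have "eval (Sum e e') \<rho> x = (\<Sum>k<F \<rho> x. G k \<rho> x)" for \<rho> x
    by (simp add: e e')
  then show ?thesis
    unfolding expressible_def by blast
qed

text \<open>Weakening: inside a sum the outer variables have indices larger by one.\<close>

lemma expressible_shift: "expressible F \<Longrightarrow> expressible (\<lambda>\<rho> x. F (\<lambda>i. \<rho> (Suc i)) x)"
  unfolding expressible_def by (metis eval_rename)

lemma expressible_mult [expr_intros]:
  assumes "expressible F" "expressible G"
  shows "expressible (\<lambda>\<rho> x. F \<rho> x * G \<rho> x)"
proof -
  have "expressible (\<lambda>\<rho> x. \<Sum>k<F \<rho> x. G \<rho> x)"
    by (rule expressible_sum[OF assms(1) expressible_shift[OF assms(2)]])
  then show ?thesis by simp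
qed

lemma decidable_not [expr_intros]:
  assumes "decidable P"
  shows "decidable (\<lambda>\<rho> x. \<not> P \<rho> x)"
proof -
  have "of_bool (\<not> P \<rho> x) = 1 - (of_bool (P \<rho> x) :: nat)" for \<rho> x
    by simp
  then show ?thesis
    using expressible_diff[OF expressible_const[of 1] assms] by (simp only:)
qed

lemma decidable_conj [expr_intros]:
  "decidable P \<Longrightarrow> decidable Q \<Longrightarrow> decidable (\<lambda>\<rho> x. P \<rho> x \<and> Q \<rho> x)"
  using expressible_mult[of "\<lambda>\<rho> x. of_bool (P \<rho> x)" "\<lambda>\<rho> x. of_bool (Q \<rho> x)"] by (simp add: of_bool_conj)

lemma decidable_disj [expr_intros]:
  "decidable P \<Longrightarrow> decidable Q \<Longrightarrow> decidable (\<lambda>\<rho> x. P \<rho> x \<or> Q \<rho> x)"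
  using decidable_not[OF decidable_conj[OF decidable_not decidable_not], of P Q] by simp

lemma decidable_le [expr_intros]:
  assumes "expressible F" "expressible G"
  shows "decidable (\<lambda>\<rho> x. F \<rho> x \<le> G \<rho> x)"
proof -
  have "of_bool (F \<rho> x \<le> G \<rho> x) = 1 - (F \<rho> x - G \<rho> x)" for \<rho> x
    by auto
  then show ?thesis
    by (simp only:) (intro expr_intros assms)
qed

lemma decidable_less [expr_intros]:
  "expressible F \<Longrightarrow> expressible G \<Longrightarrow> decidable (\<lambda>\<rho> x. F \<rho> x < G \<rho> x)"
  using decidable_not[OF decidable_le, of G F] by (simp add: not_le)

lemma decidable_eq [expr_intros]:
  "expressible F \<Longrightarrow> expressible G \<Longrightarrow> decidable (\<lambda>\<rho> x. F \<rho> x = G \<rho> x)"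
  using decidable_conj[OF decidable_le decidable_le, of F G G F] by (simp add: order_eq_iff)

lemma expressible_if [expr_intros]:
  assumes "decidable P" "expressible F" "expressible G"
  shows "expressible (\<lambda>\<rho> x. if P \<rho> x then F \<rho> x else G \<rho> x)"
proof -
  have "(if P \<rho> x then F \<rho> x else G \<rho> x) = of_bool (P \<rho> x) * F \<rho> x + of_bool (\<not> P \<rho> x) * G \<rho> x" for \<rho> x
    by simp
  then show ?thesis
    by (simp only:) (intro expr_intros assms)
qed

lemma decidable_ball_less:
  assumes "expressible F" "decidable (\<lambda>\<rho> x. P (\<rho> 0) (\<lambda>i. \<rho> (Suc i)) x)"
  shows "decidable (\<lambda>\<rho> x. \<forall>k<F \<rho> x. P k \<rho> x)"
proof -
  have "(\<forall>k<F \<rho> x. P k \<rho> x) \<longleftrightarrow> (\<Sum>k<F \<rho> x. of_bool (\<not> P k \<rho> x)) = (0::nat)" for \<rho> x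
    by auto
  then show ?thesis
    by (simp only:) (intro expr_intros expressible_sum assms)
qed

text \<open>The quotient is the number of \<open>k\<close> with \<open>(k + 1) * b\<close> at most
  \<open>a\<close>. The condition \<open>0 < b\<close> yields the convention that division by zero
  is zero.\<close>

lemma div_eq_sum: "a div b = (\<Sum>k<a. of_bool (0 < b \<and> (k + 1) * b \<le> a))" for a b :: nat
proof (cases "b = 0")
  case False
  then have "{k. k < a \<and> (k + 1) * b \<le> a} = {..<a div b}"
 
  proof (intro set_eqI)
    fix k
    have "(k + 1) * b \<le> a \<longleftrightarrow> k < a div b"
      using False less_eq_div_iff_mult_less_eq[of b "k + 1" a] by auto
    moreover have "k < a" if "k < a div b"
      using that div_le_dividend[of a b] by linarith
    ultimately show "k \<in> {k. k < a \<and> (k + 1) * b \<le> a} \<longleftrightarrow> k \<in> {..<a div b}"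
      by auto
  qed
  moreover have "(\<Sum>k<a. of_bool (0 < b \<and> (k + 1) * b \<le> a)) = card {k. k < a \<and> (k + 1) * b \<le> a}"
    using False by (simp add: sum.If_cases of_bool_def lessThan_def Int_def)
  ultimately show ?thesis by simp
qed simp

lemma expressible_div [expr_intros]:
  assumes "expressible F" "expressible G"
  shows "expressible (\<lambda>\<rho> x. F \<rho> x div G \<rho> x)"
  unfolding div_eq_sum by (intro expr_intros expressible_sum expressible_shift[OF assms(1)] expressible_shift[OF assms(2)] assms)

lemma expressible_mod [expr_intros]:
  assumes "expressible F" "expressible G"
  shows "expressible (\<lambda>\<rho> x. F \<rho> x mod G \<rho> x)"
  unfolding modulo_nat_def by (intro expr_intros assms)

lemma decidable_dvd [expr_intros]:
  "expressible F \<Longrightarrow> expressible G \<Longrightarrow> decidable (\<lambda>\<rho> x. F \<rho> x dvd G \<rho> x)"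
  unfolding dvd_eq_mod_eq_0 by (intro expr_intros)

lemma expressible_poly [expr_intros]: "expressible F \<Longrightarrow> expressible (\<lambda>\<rho> x. poly p (F \<rho> x))"
proof (induction p)
  case (pCons a p)
  show ?case
    unfolding poly_pCons by (intro expr_intros pCons)
qed (simp add: expressible_const)

section \<open>Writing bit strings\<close>

definition writable :: "((nat \<Rightarrow> nat) \<Rightarrow> bool list \<Rightarrow> bool list) \<Rightarrow> bool" where
  "writable F \<longleftrightarrow> (\<exists>P. \<forall>\<rho> x. outs P \<rho> x = F \<rho> x)"

lemma writable_bit:
  assumes "decidable P"
  shows "writable (\<lambda>\<rho> x. [P \<rho> x])"
proof -
  obtain e where "\<And>\<rho> x. eval e \<rho> x = of_bool (P \<rho> x)"
    using assms unfolding expressible_def by blast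
  then have "outs (Bit e) \<rho> x = [P \<rho> x]" for \<rho> x
    by simp
  then show ?thesis
    unfolding writable_def by blast
qed

lemma writable_append: "writable F \<Longrightarrow> writable G \<Longrightarrow> writable (\<lambda>\<rho> x. F \<rho> x @ G \<rho> x)"
  unfolding writable_def by (metis outs.simps(2))

lemma writable_for:
  assumes "expressible F" "writable (\<lambda>\<rho> x. G (\<rho> 0) (\<lambda>i. \<rho> (Suc i)) x)"
  shows "writable (\<lambda>\<rho> x. concat (map (\<lambda>k. G k \<rho> x) [0..<F \<rho> x]))"
proof -
  obtain e where e: "\<And>\<rho> x. eval e \<rho> x = F \<rho> x"
    using assms(1) unfolding expressible_def by blast
  obtain P where P: "\<And>\<rho> x. outs P \<rho> x = G (\<rho> 0) (\<lambda>i. \<rho> (Suc i)) x"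
    using assms(2) unfolding writable_def by blast
  have "outs (For e P) \<rho> x = concat (map (\<lambda>k. G k \<rho> x) [0..<F \<rho> x])" for \<rho> x
    by (simp add: e P)
  then show ?thesis
    unfolding writable_def by blast
qed

lemma poly_time_computable_writable:
  assumes "writable (\<lambda>\<rho> x. f x)"
  shows "poly_time_computable 1 (\<lambda>xs. f (xs ! 0))"
proof -
  obtain P where P: "\<And>\<rho> x. outs P \<rho> x = f x"
    using assms unfolding writable_def by blast
  then show ?thesis
    using poly_time_computable_outs[of P] by (simp add: P)
qed

text \<open>The powers of two are the numbers all of whose divisors other than 1 are even.\<close>

definition is_pow2 :: "nat \<Rightarrow> bool" where
  "is_pow2 y \<longleftrightarrow> 0 < y \<and> (\<forall>d<Suc y. \<not> d dvd y \<or> d = 1 \<or> even d)"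

lemma is_pow2_double: "is_pow2 (2 * y) \<longleftrightarrow> is_pow2 y"
proof
  assume *: "is_pow2 (2 * y)"
  have "even d" if "d dvd y" "d \<noteq> 1" for d
  proof -
    have "d dvd 2 * y" using that by simp
    then show ?thesis
      using * that unfolding is_pow2_def by (metis dvd_imp_le less_Suc_eq_le)
  qed
  then show "is_pow2 y"
    using * unfolding is_pow2_def by auto
next
  assume *: "is_pow2 y"
  have "even d" if "d dvd 2 * y" "d \<noteq> 1" for d
  proof (rule ccontr)
    assume "odd d"
    then have "d dvd y"
      using that(1) by (simp add: coprime_dvd_mult_right_iff)
    then show False
      using * that \<open>odd d\<close> unfolding is_pow2_def by (metis dvd_imp_le less_Suc_eq_le)
  qed
  then show "is_pow2 (2 * y)"
    using * unfolding is_pow2_def by auto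
qed

lemma is_pow2_odd: "odd y \<Longrightarrow> is_pow2 y \<longleftrightarrow> y = 1"
  unfolding is_pow2_def by (auto dest: spec[of _ y] odd_pos)

text \<open>This is the recursion of \<open>binary\<close> for the list of place values: after 1,
  the powers of two up to \<open>k\<close> are the doubles of those up to
  \<open>k div 2\<close>.\<close>

lemma filter_is_pow2: "0 < k \<Longrightarrow> filter is_pow2 [0..<Suc k] = 1 # map ((*) 2) (filter is_pow2 [0..<Suc (k div 2)])"
proof (induction k rule: less_induct)
  case (less k)
  show ?case
  proof (cases "k = 1")
    case True
    have "filter is_pow2 [0..<Suc (Suc 0)] = [1]" "filter is_pow2 [0..<Suc 0] = []"
      by (auto simp: is_pow2_def)
    then show ?thesis using True by simp
  next
    case False
    then obtain l where l: "k = Suc l" "0 < l"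
      using less.prems by (cases k) auto
    have IH: "filter is_pow2 [0..<Suc l] = 1 # map ((*) 2) (filter is_pow2 [0..<Suc (l div 2)])"
      using less.IH[of l] l by simp
    have step: "filter is_pow2 [0..<Suc k] = filter is_pow2 [0..<Suc l] @ (if is_pow2 k then [k] else [])"
      using l by simp
    show ?thesis
    proof (cases "even k")
      case True
      then obtain h where h: "k = 2 * h" by blast
      then have "l div 2 = h - 1" "k div 2 = h" "0 < h"
        using l by auto
      then have "filter is_pow2 [0..<Suc (k div 2)] = filter is_pow2 [0..<Suc (l div 2)] @ (if is_pow2 h then [h] else [])"
        by (cases h) auto
      then show ?thesis
        unfolding step IH using h is_pow2_double[of h] by auto
    next
      case odd: False
      then have "l div 2 = k div 2"
        using l by simp
      moreover have "\<not> is_pow2 k"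
        using is_pow2_odd[OF odd] False by simp
      ultimately show ?thesis
        unfolding step IH by simp
    qed
  qed
qed

text \<open>The place values are found by a search through all numbers up to \<open>k\<close>,
  without exponentiation. The search is affordable because values of expressions are polynomially
  bounded.\<close>

lemma binary_eq: "binary k = map (\<lambda>y. odd (k div y)) (filter is_pow2 [0..<Suc k])"
proof (induction k rule: less_induct)
  case (less k)
  show ?case
  proof (cases "k = 0")
    case True
    then show ?thesis
      by (simp add: binary.simps is_pow2_def)
  next
    case False
    have "binary k = odd k # binary (k div 2)"
      using False by (subst binary.simps) simp
    also have "binary (k div 2) = map (\<lambda>y. odd (k div 2 div y)) (filter is_pow2 [0..<Suc (k div 2)])"
      using False by (intro less.IH) simp
    also have "odd k # \<dots> = map (\<lambda>y. odd (k div y)) (1 # map ((*) 2) (filter is_pow2 [0..<Suc (k div 2)]))"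
      by (simp add: div_mult2_eq del: upt_Suc)
    finally show ?thesis
      using filter_is_pow2[of k] False by simp
  qed
qed

lemma writable_binary:
  assumes "expressible F"
  shows "writable (\<lambda>\<rho> x. binary (F \<rho> x))"
proof -
  \<comment> \<open>A filter becomes an inner loop that runs once or not at all.\<close>
  have "map f (filter P xs) = concat (map (\<lambda>y. concat (map (\<lambda>_. [f y]) [0..<of_bool (P y)])) xs)" for P and f :: "nat \<Rightarrow> bool" and xs
    by (induction xs) auto
  then have "binary (F \<rho> x) = concat (map (\<lambda>y. concat (map (\<lambda>_. [odd (F \<rho> x div y)]) [0..<of_bool (is_pow2 y)])) [0..<Suc (F \<rho> x)])" for \<rho> x
    by (simp only: binary_eq)
  moreover have "expressible (\<lambda>\<rho> x. Suc (F \<rho> x))"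
    using expressible_add[OF assms expressible_const[of 1]] by simp
  moreover have "expressible (\<lambda>\<rho> x. Suc (\<rho> i))" for i
    using expressible_add[OF expressible_var expressible_const[of 1]] by simp
  ultimately show ?thesis
    unfolding is_pow2_def
    by (simp only:) (intro writable_for writable_bit decidable_ball_less expr_intros assms
      expressible_shift[OF expressible_shift[OF assms]])
qed

section \<open>Graphs given by two labellings\<close>

text \<open>The cliques are the fibres of the labellings, so both subgraphs are cluster graphs by
  construction, and adjacency is decided by comparing labels.\<close>

definition label_graph :: "'v set \<Rightarrow> ('v \<Rightarrow> 'b) \<Rightarrow> ('v \<Rightarrow> 'c) \<Rightarrow> 'v bgraph" where
  "label_graph V \<beta> \<tau> = \<lparr>verts = V,
     blue = {{v, w} | v w. v \<in> V \<and> w \<in> V \<and> v \<noteq> w \<and> \<beta> v = \<beta> w},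
     red = {{v, w} | v w. v \<in> V \<and> w \<in> V \<and> v \<noteq> w \<and> \<tau> v = \<tau> w}\<rparr>"

text \<open>
  The predicate \<open>on\<close> selects the blue cliques that a solution of minimum size keeps; the vertices of the
  other blue cliques survive in red triangles with exactly one vertex in a kept blue clique.
\<close>

definition kept_cliques :: "'v set \<Rightarrow> ('v \<Rightarrow> 'b) \<Rightarrow> ('v \<Rightarrow> 'c) \<Rightarrow> ('v \<Rightarrow> bool) \<Rightarrow> bool" where
  "kept_cliques V \<beta> \<tau> on \<longleftrightarrow>
     (\<forall>v\<in>V. \<forall>w\<in>V. \<beta> v = \<beta> w \<longrightarrow> on v = on w) \<and>
     (\<forall>v\<in>V. on v \<longrightarrow> card {w \<in> V. \<beta> w = \<beta> v} = 4) \<and>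
     (\<forall>v\<in>V. \<not> on v \<longrightarrow>
        (\<exists>m w. {u \<in> V. \<tau> u = \<tau> v} = {v, m, w} \<and> v \<noteq> m \<and> v \<noteq> w \<and> m \<noteq> w \<and> on m \<and> \<not> on w)) \<and>
     (\<forall>v\<in>V. \<forall>v'\<in>V. on v \<and> \<beta> v = \<beta> v' \<and> (\<exists>w\<in>V. \<tau> w = \<tau> v \<and> \<not> on w) \<and>
        (\<exists>w\<in>V. \<tau> w = \<tau> v' \<and> \<not> on w) \<longrightarrow> v = v')"

lemma card_eq_sum_of_bool: "finite A \<Longrightarrow> card {x \<in> A. P x} = (\<Sum>x\<in>A. of_bool (P x))"
  by (simp add: Collect_conj_eq)

text \<open>By \<open>linear\<close>, a blue and a red clique share at most one vertex; in
  particular no edge has both colors. Together with \<open>no_C4\<close> this makes the ends of a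
  path of three edges with alternating colors nonadjacent.\<close>

locale labelled =
  fixes V :: "'v set" and \<beta> :: "'v \<Rightarrow> 'b" and \<tau> :: "'v \<Rightarrow> 'c"
  assumes fin: "finite V"
    and blue_card: "v \<in> V \<Longrightarrow> card {w \<in> V. \<beta> w = \<beta> v} \<in> {1, 4}"
    and red_card: "v \<in> V \<Longrightarrow> card {w \<in> V. \<tau> w = \<tau> v} \<in> {1, 3}"
    and linear: "v \<in> V \<Longrightarrow> w \<in> V \<Longrightarrow> \<beta> v = \<beta> w \<Longrightarrow> \<tau> v = \<tau> w \<Longrightarrow> v = w"
    and no_C4: "a \<in> V \<Longrightarrow> b \<in> V \<Longrightarrow> c \<in> V \<Longrightarrow> d \<in> V \<Longrightarrow> \<beta> a = \<beta> b \<Longrightarrow> \<tau> b = \<tau> c \<Longrightarrow> \<beta> c = \<beta> d \<Longrightarrow>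
      \<tau> d = \<tau> a \<Longrightarrow> a = b \<or> b = c"
begin

abbreviation G :: "'v bgraph" where "G \<equiv> label_graph V \<beta> \<tau>"

lemma blue_G: "{v, w} \<in> blue G \<longleftrightarrow> v \<in> V \<and> w \<in> V \<and> v \<noteq> w \<and> \<beta> v = \<beta> w"
  by (auto simp: label_graph_def doubleton_eq_iff)

lemma red_G: "{v, w} \<in> red G \<longleftrightarrow> v \<in> V \<and> w \<in> V \<and> v \<noteq> w \<and> \<tau> v = \<tau> w"
  by (auto simp: label_graph_def doubleton_eq_iff)

lemma edges_G: "e \<in> edges G \<Longrightarrow> e \<subseteq> V \<and> card e = 2"
  by (auto simp: label_graph_def edges_def)

lemma finite_edges: "finite (edges G)"
  by (rule finite_subset[of _ "Pow V"]) (use fin edges_G in auto)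

definition blue_nbs :: "'v set set \<Rightarrow> 'v \<Rightarrow> 'v set" where
  "blue_nbs S v = {w \<in> V. w \<noteq> v \<and> \<beta> w = \<beta> v \<and> {v, w} \<notin> S}"

definition red_nbs :: "'v set set \<Rightarrow> 'v \<Rightarrow> 'v set" where
  "red_nbs S v = {w \<in> V. w \<noteq> v \<and> \<tau> w = \<tau> v \<and> {v, w} \<notin> S}"

lemma blue_nbs_sym: "w \<in> blue_nbs S v \<Longrightarrow> v \<in> V \<Longrightarrow> v \<in> blue_nbs S w"
  by (auto simp: blue_nbs_def insert_commute)

lemma red_nbs_sym: "w \<in> red_nbs S v \<Longrightarrow> v \<in> V \<Longrightarrow> v \<in> red_nbs S w"
  by (auto simp: red_nbs_def insert_commute)

lemma finite_nbs: "finite (blue_nbs S v)" "finite (red_nbs S v)"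
  using fin by (auto simp: blue_nbs_def red_nbs_def)

lemma nbs_disjoint: "v \<in> V \<Longrightarrow> blue_nbs S v \<inter> red_nbs S v = {}"
  using linear by (auto simp: blue_nbs_def red_nbs_def)

lemma card_incident:
  assumes "v \<in> V"
  shows "card {e \<in> edges G - S. v \<in> e} = card (blue_nbs S v) + card (red_nbs S v)"
proof -
  have "{e \<in> edges G - S. v \<in> e} = (\<lambda>w. {v, w}) ` (blue_nbs S v \<union> red_nbs S v)"
  proof (intro set_eqI iffI)
    fix e assume e: "e \<in> {e \<in> edges G - S. v \<in> e}"
    then obtain w where "e = {v, w}" "w \<noteq> v"
      using edges_G[of e] by (auto simp: card_2_iff)
    then show "e \<in> (\<lambda>w. {v, w}) ` (blue_nbs S v \<union> red_nbs S v)"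
      using e by (auto simp: edges_def blue_G red_G blue_nbs_def red_nbs_def)
  qed (use assms in \<open>auto simp: edges_def blue_G red_G blue_nbs_def red_nbs_def\<close>)
  moreover have "inj_on (\<lambda>w. {v, w}) (blue_nbs S v \<union> red_nbs S v)"
    by (auto simp: inj_on_def doubleton_eq_iff)
  ultimately show ?thesis
    using card_Un_disjoint[OF finite_nbs[of S v] nbs_disjoint[OF assms]] by (simp add: card_image)
qed

lemma handshake: "(\<Sum>v\<in>V. card (blue_nbs S v) + card (red_nbs S v)) = 2 * card (edges G - S)"
proof -
  have fE: "finite (edges G - S)" using finite_edges by simp
  have "(\<Sum>v\<in>V. card (blue_nbs S v) + card (red_nbs S v)) = (\<Sum>v\<in>V. card {e \<in> edges G - S. v \<in> e})"
    by (intro sum.cong refl card_incident[symmetric])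
  also have "\<dots> = (\<Sum>v\<in>V. \<Sum>e\<in>edges G - S. of_bool (v \<in> e))"
    by (simp only: card_eq_sum_of_bool[OF fE])
  also have "\<dots> = (\<Sum>e\<in>edges G - S. \<Sum>v\<in>V. of_bool (v \<in> e))"
    by (rule sum.swap)
  also have "\<dots> = (\<Sum>e\<in>edges G - S. 2)"
  proof (rule sum.cong[OF refl])
    fix e assume "e \<in> edges G - S"
    then have "{v \<in> V. v \<in> e} = e" "card e = 2"
      using edges_G[of e] by auto
    moreover have "(\<Sum>v\<in>V. of_bool (v \<in> e)) = card {v \<in> V. v \<in> e}"
      by (simp only: card_eq_sum_of_bool[OF fin])
    ultimately show "(\<Sum>v\<in>V. of_bool (v \<in> e)) = (2::nat)" by simp
  qed
  finally show ?thesis by simp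
qed

lemma induced_P4I:
  assumes "a \<in> V" "b \<in> V" "c \<in> V" "d \<in> V" "distinct [a, b, c, d]"
    and "{a, b} \<in> edges G - S" "{b, c} \<in> edges G - S" "{c, d} \<in> edges G - S"
    and "{a, c} \<notin> edges G - S" "{a, d} \<notin> edges G - S" "{b, d} \<notin> edges G - S"
    and "{{a, b}, {b, c}, {c, d}} \<inter> blue G \<noteq> {}" "{{a, b}, {b, c}, {c, d}} \<inter> red G \<noteq> {}"
  shows "has_induced_bicolored_P4 (delete_edges G S)"
proof -
  have E: "edges (delete_edges G S) = edges G - S" and V: "verts (delete_edges G S) = V"
    and B: "blue (delete_edges G S) = blue G - S" and R: "red (delete_edges G S) = red G - S"
    by (auto simp: edges_def delete_edges_def label_graph_def)
  have nS: "X \<inter> (C - S) = X \<inter> C" if "X \<inter> S = {}" for X C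
    using that by blast
  have "{{a, b}, {b, c}, {c, d}} \<inter> S = {}"
    using assms(6-8) by simp
  then have col: "{{a, b}, {b, c}, {c, d}} \<inter> (blue G - S) \<noteq> {}" "{{a, b}, {b, c}, {c, d}} \<inter> (red G - S) \<noteq> {}"
    using assms(12,13) nS by metis+
  show ?thesis
    unfolding has_induced_bicolored_P4_def E V B R
    by (rule exI[of _ a], rule exI[of _ b], rule exI[of _ c], rule exI[of _ d], intro conjI assms(5-11) col)
      (simp add: assms(1-4))
qed

lemma blue_edge: "w \<in> blue_nbs S v \<Longrightarrow> v \<in> V \<Longrightarrow> {v, w} \<in> edges G - S \<and> {v, w} \<in> blue G"
  by (auto simp: blue_nbs_def edges_def blue_G)

lemma red_edge: "w \<in> red_nbs S v \<Longrightarrow> v \<in> V \<Longrightarrow> {v, w} \<in> edges G - S \<and> {v, w} \<in> red G"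
  by (auto simp: red_nbs_def edges_def red_G)

lemma no_edge: "\<beta> v \<noteq> \<beta> w \<Longrightarrow> \<tau> v \<noteq> \<tau> w \<or> {v, w} \<in> S \<Longrightarrow> {v, w} \<notin> edges G - S"
  by (auto simp: edges_def blue_G red_G)

section \<open>Structure of the graph left by a solution\<close>

context
  fixes S assumes no_P4: "\<not> has_induced_bicolored_P4 (delete_edges G S)"
begin

text \<open>The path \<open>a\<close>, \<open>b\<close>, \<open>c\<close>, \<open>d\<close> would be
  induced: \<open>linear\<close> excludes the chords of length two and a blue edge between the ends,
  \<open>no_C4\<close> a red one.\<close>

lemma no_blue_red_blue:
  assumes a: "a \<in> blue_nbs S b" and b: "b \<in> red_nbs S c" and d: "d \<in> blue_nbs S c" and c: "c \<in> V"
  shows False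
proof -
  have V: "a \<in> V" "b \<in> V" "d \<in> V" and lab: "\<beta> a = \<beta> b" "\<tau> b = \<tau> c" "\<beta> d = \<beta> c"
    and ne: "a \<noteq> b" "b \<noteq> c" "d \<noteq> c"
    using assms by (auto simp: blue_nbs_def red_nbs_def)
  have 1: "\<beta> a \<noteq> \<beta> c" "\<tau> a \<noteq> \<tau> c" "\<beta> b \<noteq> \<beta> d" "\<tau> b \<noteq> \<tau> d" "\<beta> a \<noteq> \<beta> d"
    using linear[of b c] linear[of a b] linear[of c d] V c lab ne by auto
  have 2: "\<tau> a \<noteq> \<tau> d"
    using no_C4[of a b c d] V c lab ne by auto
  have "has_induced_bicolored_P4 (delete_edges G S)"
    by (rule induced_P4I[of a b c d])
      (use V c ne 1 2 lab blue_edge[OF blue_nbs_sym[OF a V(2)] V(1)] red_edge[OF red_nbs_sym[OF b c] V(2)]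
         blue_edge[OF d c] no_edge[of a c S] no_edge[of a d S] no_edge[of b d S] in auto)
  then show False using no_P4 by blast
qed

lemma no_red_blue_red:
  assumes a: "a \<in> red_nbs S b" and b: "b \<in> blue_nbs S c" and d: "d \<in> red_nbs S c" and c: "c \<in> V"
  shows False
proof -
  have V: "a \<in> V" "b \<in> V" "d \<in> V" and lab: "\<tau> a = \<tau> b" "\<beta> b = \<beta> c" "\<tau> d = \<tau> c"
    and ne: "a \<noteq> b" "b \<noteq> c" "d \<noteq> c"
    using assms by (auto simp: blue_nbs_def red_nbs_def)
  have 1: "\<beta> a \<noteq> \<beta> c" "\<tau> a \<noteq> \<tau> c" "\<beta> b \<noteq> \<beta> d" "\<tau> b \<noteq> \<tau> d" "\<tau> a \<noteq> \<tau> d"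
    using linear[of b c] linear[of a b] linear[of c d] V c lab ne by auto
  have 2: "\<beta> a \<noteq> \<beta> d"
    using no_C4[of b c d a] V c lab ne by auto
  have "has_induced_bicolored_P4 (delete_edges G S)"
    by (rule induced_P4I[of a b c d])
      (use V c ne 1 2 lab red_edge[OF red_nbs_sym[OF a V(2)] V(1)] blue_edge[OF blue_nbs_sym[OF b c] V(2)]
         red_edge[OF d c] no_edge[of a c S] no_edge[of a d S] no_edge[of b d S] in auto)
  then show False using no_P4 by blast
qed

text \<open>The last three vertices lie in one red clique, so the only possible chord joins
  \<open>b\<close> and \<open>d\<close>; the last assumption says that it has been deleted.\<close>

lemma no_blue_red_red:
  assumes a: "a \<in> blue_nbs S b" and b: "b \<in> red_nbs S c" and d: "d \<in> red_nbs S c" and c: "c \<in> V"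
    and bd: "b \<noteq> d" "d \<notin> red_nbs S b"
  shows False
proof -
  have V: "a \<in> V" "b \<in> V" "d \<in> V" and lab: "\<beta> a = \<beta> b" "\<tau> b = \<tau> c" "\<tau> d = \<tau> c"
    and ne: "a \<noteq> b" "b \<noteq> c" "d \<noteq> c"
    using assms by (auto simp: blue_nbs_def red_nbs_def)
  have S: "{b, d} \<in> S"
    using bd V lab by (auto simp: red_nbs_def)
  have 1: "\<beta> a \<noteq> \<beta> c" "\<tau> a \<noteq> \<tau> c" "\<beta> b \<noteq> \<beta> d" "\<beta> a \<noteq> \<beta> d" "\<tau> a \<noteq> \<tau> d" "a \<noteq> d"
    using linear[of b c] linear[of a b] linear[of b d] V c lab ne bd by auto
  have "has_induced_bicolored_P4 (delete_edges G S)"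
    by (rule induced_P4I[of a b c d])
      (use V c ne bd 1 S lab blue_edge[OF blue_nbs_sym[OF a V(2)] V(1)] red_edge[OF red_nbs_sym[OF b c] V(2)]
         red_edge[OF d c] no_edge[of a c S] no_edge[of a d S] no_edge[of b d S] in auto)
  then show False using no_P4 by blast
qed

text \<open>
  A vertex with \<open>d\<close> remaining edges has excess \<open>d - 3\<close>. Only vertices with remaining edges of both
  colors have positive excess. It is at most the number of their red neighbors, and these have no blue
  edges, hence negative excess, and no other red neighbor of this kind.
\<close>

definition mixed :: "'v set" where
  "mixed = {v \<in> V. blue_nbs S v \<noteq> {} \<and> red_nbs S v \<noteq> {}}"

definition no_blue :: "'v set" where
  "no_blue = {v \<in> V. blue_nbs S v = {}}"

lemma red_nbs_mixed: "v \<in> mixed \<Longrightarrow> red_nbs S v \<subseteq> no_blue"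
  using no_blue_red_blue by (fastforce simp: mixed_def no_blue_def red_nbs_def)

text \<open>The three vertices lie in one red clique. If the edge between \<open>v\<close> and
  \<open>w\<close> remains, it extends to a blue-red-blue path; if it is deleted, the path through
  \<open>u\<close> is of the form blue-red-red.\<close>

lemma mixed_unique:
  assumes "v \<in> mixed" "w \<in> mixed" "u \<in> red_nbs S v" "u \<in> red_nbs S w"
  shows "v = w"
proof (rule ccontr)
  assume ne: "v \<noteq> w"
  obtain a b where ab: "a \<in> blue_nbs S v" "b \<in> blue_nbs S w" and V: "v \<in> V" "w \<in> V"
    using assms unfolding mixed_def by blast
  have u: "u \<in> V" using assms(3) by (simp add: red_nbs_def)
  show False
  proof (cases "w \<in> red_nbs S v")
    case True
    then show False
      using no_blue_red_blue[OF ab(2) _ ab(1) V(1)] by blast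
  next
    case False
    then show False
      using no_blue_red_red[OF ab(1) red_nbs_sym[OF assms(3) V(1)] red_nbs_sym[OF assms(4) V(2)] u ne] by blast
  qed
qed

lemma card_blue_nbs: "v \<in> V \<Longrightarrow> card (blue_nbs S v) \<le> card {w \<in> V. \<beta> w = \<beta> v} - 1"
proof -
  assume v: "v \<in> V"
  have "blue_nbs S v \<subseteq> {w \<in> V. \<beta> w = \<beta> v} - {v}"
    by (auto simp: blue_nbs_def)
  then have "card (blue_nbs S v) \<le> card ({w \<in> V. \<beta> w = \<beta> v} - {v})"
    using fin by (intro card_mono) auto
  then show ?thesis using v by simp
qed

lemma card_red_nbs: "v \<in> V \<Longrightarrow> card (red_nbs S v) \<le> card {w \<in> V. \<tau> w = \<tau> v} - 1"
proof -
  assume v: "v \<in> V"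
  have "red_nbs S v \<subseteq> {w \<in> V. \<tau> w = \<tau> v} - {v}"
    by (auto simp: red_nbs_def)
  then have "card (red_nbs S v) \<le> card ({w \<in> V. \<tau> w = \<tau> v} - {v})"
    using fin by (intro card_mono) auto
  then show ?thesis using v by simp
qed

text \<open>Without blue edges a vertex has at most two edges, which leaves one unit to receive
  charge. Otherwise it has at most three blue edges, and any red edges make it mixed. Equality means
  that the vertex keeps the largest possible number of edges of its decisive color.\<close>

lemma excess:
  assumes "v \<in> V"
  shows "card (blue_nbs S v) + card (red_nbs S v) + of_bool (v \<in> no_blue) \<le>
    3 + of_bool (v \<in> mixed) * card (red_nbs S v)"
    and "card (blue_nbs S v) + card (red_nbs S v) + of_bool (v \<in> no_blue) =
    3 + of_bool (v \<in> mixed) * card (red_nbs S v) \<Longrightarrow>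
    (if v \<in> no_blue then card (red_nbs S v) = 2 else card (blue_nbs S v) = 3)"
proof -
  have le: "card (blue_nbs S v) \<le> 3" "card (red_nbs S v) \<le> 2"
    using card_blue_nbs[OF assms] card_red_nbs[OF assms] blue_card[OF assms] red_card[OF assms] by auto
  show "card (blue_nbs S v) + card (red_nbs S v) + of_bool (v \<in> no_blue) \<le>
    3 + of_bool (v \<in> mixed) * card (red_nbs S v)"
    using le assms by (cases "blue_nbs S v = {}"; cases "red_nbs S v = {}") (simp_all add: mixed_def no_blue_def)
  show "card (blue_nbs S v) + card (red_nbs S v) + of_bool (v \<in> no_blue) =
    3 + of_bool (v \<in> mixed) * card (red_nbs S v) \<Longrightarrow>
    (if v \<in> no_blue then card (red_nbs S v) = 2 else card (blue_nbs S v) = 3)"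
    using le assms by (cases "blue_nbs S v = {}"; cases "red_nbs S v = {}") (simp_all add: mixed_def no_blue_def)
qed

text \<open>By \<open>mixed_unique\<close> the red neighborhoods of mixed vertices are disjoint, so
  the total charge is the number of vertices that receive it.\<close>

lemma sum_mixed: "(\<Sum>v\<in>V. of_bool (v \<in> mixed) * card (red_nbs S v)) = card (\<Union>v\<in>mixed. red_nbs S v)"
proof -
  have "finite mixed" using fin by (simp add: mixed_def)
  then have "card (\<Union>v\<in>mixed. red_nbs S v) = (\<Sum>v\<in>mixed. card (red_nbs S v))"
    using finite_nbs mixed_unique by (intro card_UN_disjoint) blast+
  also have "\<dots> = (\<Sum>v\<in>V. of_bool (v \<in> mixed) * card (red_nbs S v))"
    using fin by (intro sum.mono_neutral_cong_left) (auto simp: mixed_def)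
  finally show ?thesis by simp
qed

text \<open>Summing \<open>excess\<close> over all vertices yields
  \<open>2 * card (edges G - S) + card no_blue\<close> \<le> \<open>3 * card V\<close> plus the
  number of red neighbors of mixed vertices, and these belong to \<open>no_blue\<close>. Tightness
  turns every estimate into an equality: each vertex of \<open>no_blue\<close> has a mixed red
  neighbor, and every vertex is saturated.\<close>

lemma tight_kept_cliques:
  assumes tight: "3 * card V \<le> 2 * card (edges G - S)"
  shows "kept_cliques V \<beta> \<tau> (\<lambda>v. blue_nbs S v \<noteq> {})"
proof -
  let ?l = "\<lambda>v. card (blue_nbs S v) + card (red_nbs S v) + of_bool (v \<in> no_blue)"
  let ?r = "\<lambda>v. 3 + of_bool (v \<in> mixed) * card (red_nbs S v)"
  have U: "(\<Union>v\<in>mixed. red_nbs S v) \<subseteq> no_blue"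
    using red_nbs_mixed by blast
  have fP: "finite no_blue" using fin by (simp add: no_blue_def)
  have "(\<Sum>v\<in>V. of_bool (v \<in> no_blue)) = card {v \<in> V. v \<in> no_blue}"
    by (simp only: card_eq_sum_of_bool[OF fin])
  also have "{v \<in> V. v \<in> no_blue} = no_blue" by (auto simp: no_blue_def)
  finally have l: "(\<Sum>v\<in>V. ?l v) = 2 * card (edges G - S) + card no_blue"
    by (simp add: sum.distrib flip: handshake)
  have r: "(\<Sum>v\<in>V. ?r v) = 3 * card V + card (\<Union>v\<in>mixed. red_nbs S v)"
    by (simp only: sum.distrib sum_mixed) simp
  have le: "(\<Sum>v\<in>V. ?l v) \<le> (\<Sum>v\<in>V. ?r v)"
    by (intro sum_mono excess(1))
  then have "(\<Union>v\<in>mixed. red_nbs S v) = no_blue"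
    using tight l r card_mono[OF fP U] by (intro card_subset_eq[OF fP U]) linarith
  moreover from this have "(\<Sum>v\<in>V. ?l v) = (\<Sum>v\<in>V. ?r v)"
    using le l r tight by simp
  then have eq: "?l v = ?r v" if "v \<in> V" for v
    using sum_mono_inv[of ?l V ?r v] excess(1) that fin by blast
  ultimately have dominated: "\<exists>m\<in>mixed. v \<in> red_nbs S m" if "v \<in> no_blue" for v
    using that by blast
  have red2: "card (red_nbs S v) = 2" if "v \<in> no_blue" for v
    using excess(2)[OF _ eq, of v] that by (auto simp: no_blue_def)
  have blue3: "card (blue_nbs S v) = 3" if "v \<in> V" "blue_nbs S v \<noteq> {}" for v
    using excess(2)[OF _ eq, of v] that by (auto simp: no_blue_def)
  have full_blue: "card {w \<in> V. \<beta> w = \<beta> v} = 4 \<and> blue_nbs S v = {w \<in> V. \<beta> w = \<beta> v} - {v}"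
    if v: "v \<in> V" "blue_nbs S v \<noteq> {}" for v
  proof -
    have c: "card {w \<in> V. \<beta> w = \<beta> v} = 4"
      using blue_card[OF v(1)] card_blue_nbs[OF v(1)] blue3[OF v] by auto
    moreover have "blue_nbs S v = {w \<in> V. \<beta> w = \<beta> v} - {v}"
      by (rule card_subset_eq) (use fin v c blue3[OF v] in \<open>auto simp: blue_nbs_def\<close>)
    ultimately show ?thesis by blast
  qed
  have full_red: "card {w \<in> V. \<tau> w = \<tau> v} = 3 \<and> red_nbs S v = {w \<in> V. \<tau> w = \<tau> v} - {v}"
    if v: "v \<in> no_blue" for v
  proof -
    have vV: "v \<in> V" using v by (simp add: no_blue_def)
    have c: "card {w \<in> V. \<tau> w = \<tau> v} = 3"
      using red_card[OF vV] card_red_nbs[OF vV] red2[OF v] by auto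
    moreover have "red_nbs S v = {w \<in> V. \<tau> w = \<tau> v} - {v}"
      by (rule card_subset_eq) (use fin vV c red2[OF v] in \<open>auto simp: red_nbs_def\<close>)
    ultimately show ?thesis by blast
  qed
  show ?thesis
    unfolding kept_cliques_def
  proof (intro conjI ballI impI)
    fix v w assume vw: "v \<in> V" "w \<in> V" "\<beta> v = \<beta> w"
    have "blue_nbs S w \<noteq> {}" if "v \<in> V" "w \<in> V" "\<beta> v = \<beta> w" "blue_nbs S v \<noteq> {}" for v w
    proof (cases "v = w")
      case False
      then have "w \<in> blue_nbs S v"
        using full_blue[of v] that by auto
      then show ?thesis
        using blue_nbs_sym that by blast
    qed (use that in simp)
    then show "(blue_nbs S v \<noteq> {}) = (blue_nbs S w \<noteq> {})"
      using vw by metis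
  next
    fix v assume "v \<in> V" "blue_nbs S v \<noteq> {}"
    then show "card {w \<in> V. \<beta> w = \<beta> v} = 4"
      using full_blue by blast
  next
    fix v assume v: "v \<in> V" "\<not> blue_nbs S v \<noteq> {}"
    then have nb: "v \<in> no_blue" by (simp add: no_blue_def)
    then obtain m where m: "m \<in> mixed" "v \<in> red_nbs S m"
      using dominated by blast
    have mV: "m \<in> V" using m by (simp add: mixed_def)
    have mv: "m \<in> red_nbs S v"
      using red_nbs_sym[OF m(2) mV] .
    obtain y z where yz: "red_nbs S v = {y, z}" "y \<noteq> z"
      using red2[OF nb] by (auto simp: card_2_iff)
    have "\<exists>w. red_nbs S v = {m, w} \<and> w \<noteq> m"
    proof (cases "m = y")
      case True
      then show ?thesis using yz by auto
    next
      case False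
      then have "m = z" using mv yz by simp
      then show ?thesis using yz by (auto simp: insert_commute)
    qed
    then obtain w where w: "red_nbs S v = {m, w}" "w \<noteq> m" by blast
    have "w \<in> red_nbs S v" using w by simp
    have "v \<in> {u \<in> V. \<tau> u = \<tau> v}" using v by simp
    then have cl: "{u \<in> V. \<tau> u = \<tau> v} = {v, m, w}"
      using full_red[OF nb] w by auto
    \<comment> \<open>If the third vertex of the triangle had blue edges, it would be a second mixed
      vertex with red neighbor \<open>v\<close>.\<close>
    have "blue_nbs S w = {}"
    proof (rule ccontr)
      assume "blue_nbs S w \<noteq> {}"
      moreover have "v \<in> red_nbs S w"
        using red_nbs_sym[OF \<open>w \<in> red_nbs S v\<close> v(1)] .
      ultimately have "w \<in> mixed"
        using \<open>w \<in> red_nbs S v\<close> by (auto simp: mixed_def red_nbs_def)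
      then show False
        using mixed_unique[OF m(1) _ m(2) \<open>v \<in> red_nbs S w\<close>] w(2) by blast
    qed
    moreover have "m \<noteq> v" "w \<noteq> v"
      using w unfolding red_nbs_def by auto
    ultimately show "\<exists>m w. {u \<in> V. \<tau> u = \<tau> v} = {v, m, w} \<and> v \<noteq> m \<and> v \<noteq> w \<and> m \<noteq> w \<and>
       blue_nbs S m \<noteq> {} \<and> \<not> blue_nbs S w \<noteq> {}"
      using cl w(2) m(1) by (intro exI[of _ m] exI[of _ w]) (auto simp: mixed_def)
  next
    fix v v' assume v: "v \<in> V" "v' \<in> V" and
      *: "blue_nbs S v \<noteq> {} \<and> \<beta> v = \<beta> v' \<and> (\<exists>w\<in>V. \<tau> w = \<tau> v \<and> \<not> blue_nbs S w \<noteq> {}) \<and>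
        (\<exists>w\<in>V. \<tau> w = \<tau> v' \<and> \<not> blue_nbs S w \<noteq> {})"
    then obtain w w' where w: "w \<in> V" "\<tau> w = \<tau> v" "blue_nbs S w = {}"
      and w': "w' \<in> V" "\<tau> w' = \<tau> v'" "blue_nbs S w' = {}"
      by blast
    \<comment> \<open>Otherwise both vertices would be extended by red edges and joined by a blue
      one, a path red-blue-red.\<close>
    show "v = v'"
    proof (rule ccontr)
      assume ne: "v \<noteq> v'"
      then have b: "v' \<in> blue_nbs S v" "v \<in> blue_nbs S v'"
        using full_blue[OF v(1)] * v blue_nbs_sym by auto
      have "v \<noteq> w" "v' \<noteq> w'"
        using b w(3) w'(3) by auto
      then have "v \<in> red_nbs S w" "v' \<in> red_nbs S w'"
        using full_red[of w] full_red[of w'] v w w' by (auto simp: no_blue_def)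
      then show False
        using no_red_blue_red[OF red_nbs_sym b(2) red_nbs_sym v(2)] w(1) w'(1) by blast
    qed
  qed
qed

end

text \<open>Delete the blue cliques that are off and the red cliques without an off vertex;
  \<open>D\<close> marks the red triangles that stay. Such a triangle has exactly one on vertex, and
  a kept blue clique meets at most one of them, so the components are the extremal ones and contain
  no induced bicolored path.\<close>

lemma kept_cliques_solution:
  assumes on: "kept_cliques V \<beta> \<tau> on"
  shows "\<exists>S\<subseteq>edges G. 3 * card V \<le> 2 * card (edges G - S) \<and> \<not> has_induced_bicolored_P4 (delete_edges G S)"
proof -
  define D where "D v \<longleftrightarrow> (\<exists>u\<in>V. \<tau> u = \<tau> v \<and> \<not> on u)" for v
  define S where "S = {{v, w} | v w. v \<in> V \<and> w \<in> V \<and> v \<noteq> w \<and> (\<beta> v = \<beta> w \<and> \<not> on v \<or> \<tau> v = \<tau> w \<and> \<not> D v)}"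
  note k = on[unfolded kept_cliques_def]
  have on_eq: "on v = on w" if "v \<in> V" "w \<in> V" "\<beta> v = \<beta> w" for v w
    using conjunct1[OF k] that by blast
  have on4: "card {w \<in> V. \<beta> w = \<beta> v} = 4" if "v \<in> V" "on v" for v
    using conjunct1[OF conjunct2[OF k]] that by blast
  have off: "\<exists>m w. {u \<in> V. \<tau> u = \<tau> v} = {v, m, w} \<and> v \<noteq> m \<and> v \<noteq> w \<and> m \<noteq> w \<and> on m \<and> \<not> on w"
    if "v \<in> V" "\<not> on v" for v
    using conjunct1[OF conjunct2[OF conjunct2[OF k]]] that by blast
  have uniq: "v = w" if "v \<in> V" "w \<in> V" "on v" "\<beta> v = \<beta> w" "D v" "D w" for v w
    using conjunct2[OF conjunct2[OF conjunct2[OF k]]] that unfolding D_def by blast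
  have D_eq: "D v = D w" if "\<tau> v = \<tau> w" for v w
    using that by (simp add: D_def)
  have S_sub: "S \<subseteq> edges G"
    by (auto simp: S_def edges_def blue_G red_G)
  have S_iff: "{v, w} \<in> S \<longleftrightarrow> (\<beta> v = \<beta> w \<and> \<not> on v \<or> \<tau> v = \<tau> w \<and> \<not> D v)" if "v \<in> V" "w \<in> V" "v \<noteq> w" for v w
  proof
    assume "{v, w} \<in> S"
    then obtain a b where "{v, w} = {a, b}" "\<beta> a = \<beta> b \<and> \<not> on a \<or> \<tau> a = \<tau> b \<and> \<not> D a"
      unfolding S_def by blast
    then show "\<beta> v = \<beta> w \<and> \<not> on v \<or> \<tau> v = \<tau> w \<and> \<not> D v"
      using on_eq[of v w] D_eq[of v w] that by (auto simp: doubleton_eq_iff)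
  qed (use that in \<open>auto simp: S_def\<close>)
  have bnb: "blue_nbs S v = (if on v then {w \<in> V. \<beta> w = \<beta> v} - {v} else {})" if "v \<in> V" for v
  proof -
    have "w \<in> blue_nbs S v \<longleftrightarrow> w \<in> V \<and> w \<noteq> v \<and> \<beta> w = \<beta> v \<and> on v" for w
      using that S_iff[of v w] linear[of v w] by (auto simp: blue_nbs_def)
    then show ?thesis by auto
  qed
  have rnb: "red_nbs S v = (if D v then {w \<in> V. \<tau> w = \<tau> v} - {v} else {})" if "v \<in> V" for v
  proof -
    have "w \<in> red_nbs S v \<longleftrightarrow> w \<in> V \<and> w \<noteq> v \<and> \<tau> w = \<tau> v \<and> D v" for w
      using that S_iff[of v w] linear[of v w] by (auto simp: red_nbs_def)
    then show ?thesis by auto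
  qed
  have red3: "card {w \<in> V. \<tau> w = \<tau> v} = 3" if "v \<in> V" "D v" for v
  proof -
    obtain u where u: "u \<in> V" "\<tau> u = \<tau> v" "\<not> on u"
      using \<open>D v\<close> unfolding D_def by blast
    obtain m w where "{y \<in> V. \<tau> y = \<tau> v} = {u, m, w}" "u \<noteq> m" "u \<noteq> w" "m \<noteq> w"
      using off[OF u(1,3)] u(2) by auto
    then show ?thesis by simp
  qed
  define Sel where "Sel = {v \<in> V. on v \<and> D v}"
  define Off where "Off = {v \<in> V. \<not> on v}"
  \<comment> \<open>An on vertex has three blue edges and two more if it lies in a remaining
    triangle; an off vertex has two red ones.\<close>
  have deg: "card (blue_nbs S v) + card (red_nbs S v) + of_bool (v \<in> Off) = 3 + 2 * of_bool (v \<in> Sel)" if v: "v \<in> V" for v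
  proof (cases "on v")
    case True
    then show ?thesis
      using v on4[OF v True] red3[OF v] by (simp add: bnb rnb Sel_def Off_def)
  next
    case False
    then have "D v" using v by (auto simp: D_def)
    then show ?thesis
      using v False red3[OF v] by (simp add: bnb rnb Sel_def Off_def)
  qed
  \<comment> \<open>Each off vertex is a red neighbor of the on vertex in its triangle, and a
    selected vertex has two red neighbors. Hence the surplus of the selected vertices makes up for
    the deficit of the off vertices.\<close>
  have "Off \<subseteq> (\<Union>v\<in>Sel. red_nbs S v)"
  proof
    fix v assume "v \<in> Off"
    then have v: "v \<in> V" "\<not> on v" by (auto simp: Off_def)
    then obtain m w where m: "{u \<in> V. \<tau> u = \<tau> v} = {v, m, w}" "v \<noteq> m" "on m"
      using off by blast
    then have "m \<in> V" "\<tau> m = \<tau> v" by blast+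
    moreover from this have "D m" using v unfolding D_def by metis
    ultimately have "m \<in> Sel" "v \<in> red_nbs S m"
      using v(1) m(2,3) by (simp_all add: Sel_def rnb)
    then show "v \<in> (\<Union>v\<in>Sel. red_nbs S v)" by blast
  qed
  then have "card Off \<le> card (\<Union>v\<in>Sel. red_nbs S v)"
    using fin finite_nbs by (intro card_mono) (auto simp: Sel_def)
  also have "\<dots> \<le> (\<Sum>v\<in>Sel. card (red_nbs S v))"
    using fin by (intro card_UN_le) (simp add: Sel_def)
  also have "\<dots> = (\<Sum>v\<in>Sel. 2)"
    using red3 by (intro sum.cong) (auto simp: Sel_def rnb)
  finally have OffSel: "card Off \<le> 2 * card Sel" by simp
  have cnt: "(\<Sum>v\<in>V. of_bool (v \<in> A)) = card A" if "A \<subseteq> V" for A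
    using card_eq_sum_of_bool[OF fin, of "\<lambda>v. v \<in> A"] that by (simp add: Int_absorb1 Collect_conj_eq)
  have "(\<Sum>v\<in>V. card (blue_nbs S v) + card (red_nbs S v) + of_bool (v \<in> Off)) = (\<Sum>v\<in>V. 3 + 2 * of_bool (v \<in> Sel))"
    using deg by (intro sum.cong) auto
  then have "2 * card (edges G - S) + card Off = 3 * card V + 2 * card Sel"
    using cnt[of Off] cnt[of Sel] handshake[of S]
    by (simp add: sum.distrib sum_distrib_left[symmetric] Off_def Sel_def)
  then have tight: "3 * card V \<le> 2 * card (edges G - S)"
    using OffSel by linarith
  have B: "\<beta> v = \<beta> w \<and> on v \<and> on w" if "{v, w} \<in> blue G - S" for v w
    using that S_iff[of v w] on_eq[of v w] by (auto simp: blue_G)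
  have R: "\<tau> v = \<tau> w \<and> D v \<and> D w" if "{v, w} \<in> red G - S" for v w
    using that S_iff[of v w] D_eq[of v w] by (auto simp: red_G)
  have Bm: "{v, w} \<in> edges G - S" if "v \<in> V" "w \<in> V" "v \<noteq> w" "\<beta> v = \<beta> w" "on v" for v w
    using that S_iff[of v w] linear[of v w] by (auto simp: edges_def blue_G)
  have Rm: "{v, w} \<in> edges G - S" if "v \<in> V" "w \<in> V" "v \<noteq> w" "\<tau> v = \<tau> w" "D v" for v w
    using that S_iff[of v w] linear[of v w] by (auto simp: edges_def red_G)
  have one_on: "v = w" if "v \<in> V" "w \<in> V" "\<tau> v = \<tau> w" "D v" "on v" "on w" for v w
  proof -
    obtain u where u: "u \<in> V" "\<tau> u = \<tau> v" "\<not> on u"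
      using \<open>D v\<close> unfolding D_def by blast
    obtain m z where "{y \<in> V. \<tau> y = \<tau> u} = {u, m, z}" "\<not> on z"
      using off[OF u(1,3)] by auto
    then have "v \<in> {u, m, z}" "w \<in> {u, m, z}" using that u by auto
    then show ?thesis using that u \<open>\<not> on z\<close> by auto
  qed
  \<comment> \<open>Every bicolored path has two consecutive edges \<open>x y\<close> and
    \<open>y z\<close> of different colors; \<open>w\<close> is its fourth vertex, attached to
    \<open>x\<close> or \<open>z\<close>. In each case \<open>w\<close> would be adjacent to
    \<open>y\<close>, or \<open>z\<close> would be on, or \<open>x\<close> would be a second
    extended vertex of the blue clique.\<close>
  have key: False if h: "x \<in> V" "y \<in> V" "z \<in> V" "w \<in> V" "distinct [x, y, z, w]" "{x, y} \<in> blue G - S" "{y, z} \<in> red G - S"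
     "w' \<in> {x, z}" "{w, w'} \<in> edges G - S" "{w, y} \<notin> edges G - S" for x y z w w'
  proof -
    have y: "on x" "on y" "\<beta> x = \<beta> y" "\<tau> y = \<tau> z" "D y" "D z"
      using B[OF h(6)] R[OF h(7)] by auto
    have z: "\<not> on z"
      using one_on[of y z] y h by auto
    have E: "{w, w'} \<in> blue G - S \<or> {w, w'} \<in> red G - S"
      using h by (auto simp: edges_def)
    consider "w' = x" | "w' = z" using h by auto
    then show False
    proof cases
      case 1
      show False
        using E
      proof
        assume "{w, w'} \<in> blue G - S"
        then have "\<beta> w = \<beta> y" "on w" using B[of w x] 1 y by auto
        then show False using Bm[of w y] h by auto
      next
        assume "{w, w'} \<in> red G - S"
        then have "D x" using R[of w x] 1 by auto
        then show False using uniq[of x y] y h by auto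
      qed
    next
      case 2
      show False
        using E
      proof
        assume "{w, w'} \<in> blue G - S"
        then show False using B[of w z] 2 z by auto
      next
        assume "{w, w'} \<in> red G - S"
        then have "\<tau> w = \<tau> y" "D w" using R[of w z] 2 y by auto
        then show False using Rm[of w y] h by auto
      qed
    qed
  qed
  have "\<not> has_induced_bicolored_P4 (delete_edges G S)"
  proof
    assume P: "has_induced_bicolored_P4 (delete_edges G S)"
    have eqs: "edges (delete_edges G S) = edges G - S" "verts (delete_edges G S) = V"
      "blue (delete_edges G S) = blue G - S" "red (delete_edges G S) = red G - S"
      by (auto simp: edges_def delete_edges_def label_graph_def)
    obtain a b c d where *: "{a, b, c, d} \<subseteq> V \<and> distinct [a, b, c, d] \<and>
        {a, b} \<in> edges G - S \<and> {b, c} \<in> edges G - S \<and> {c, d} \<in> edges G - S \<and>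
        {a, c} \<notin> edges G - S \<and> {a, d} \<notin> edges G - S \<and> {b, d} \<notin> edges G - S \<and>
        {{a, b}, {b, c}, {c, d}} \<inter> (blue G - S) \<noteq> {} \<and> {{a, b}, {b, c}, {c, d}} \<inter> (red G - S) \<noteq> {}"
      using P unfolding has_induced_bicolored_P4_def eqs by (elim exE) (rule that)
    then have V: "a \<in> V" "b \<in> V" "c \<in> V" "d \<in> V" by auto
    from * have dist: "distinct [a, b, c, d]" by (elim conjE)
    from * have E: "{a, b} \<in> edges G - S" "{b, c} \<in> edges G - S" "{c, d} \<in> edges G - S"
      by argo+
    from * have N: "{a, c} \<notin> edges G - S" "{a, d} \<notin> edges G - S" "{b, d} \<notin> edges G - S"
      by argo+
    from * have "{{a, b}, {b, c}, {c, d}} \<inter> (blue G - S) \<noteq> {}" "{{a, b}, {b, c}, {c, d}} \<inter> (red G - S) \<noteq> {}"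
      by argo+
    then have col: "{a, b} \<in> blue G - S \<or> {b, c} \<in> blue G - S \<or> {c, d} \<in> blue G - S"
      "{a, b} \<in> red G - S \<or> {b, c} \<in> red G - S \<or> {c, d} \<in> red G - S"
      unfolding Int_insert_left by (auto split: if_splits)
    have E': "e \<in> blue G - S \<or> e \<in> red G - S" if "e \<in> edges G - S" for e
      using that by (auto simp: edges_def)
    have bicol: "{a, b} \<in> blue G - S \<and> {b, c} \<in> red G - S \<or> {a, b} \<in> red G - S \<and> {b, c} \<in> blue G - S \<or>
      {b, c} \<in> blue G - S \<and> {c, d} \<in> red G - S \<or> {b, c} \<in> red G - S \<and> {c, d} \<in> blue G - S"
      using col E'[OF E(1)] E'[OF E(2)] E'[OF E(3)] by argo
    note comm = insert_commute[of b a "{}"] insert_commute[of c b "{}"] insert_commute[of d c "{}"]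
      insert_commute[of c a "{}"] insert_commute[of d a "{}"] insert_commute[of d b "{}"]
    from bicol show False
    proof (elim disjE conjE)
      assume "{a, b} \<in> blue G - S" "{b, c} \<in> red G - S"
      then show False
        using key[of a b c d c] V dist E N by (auto simp: comm)
    next
      assume "{a, b} \<in> red G - S" "{b, c} \<in> blue G - S"
      then show False
        using key[of c b a d c] V dist E N by (auto simp: comm)
    next
      assume "{b, c} \<in> blue G - S" "{c, d} \<in> red G - S"
      then show False
        using key[of b c d a b] V dist E N by (auto simp: comm)
    next
      assume "{b, c} \<in> red G - S" "{c, d} \<in> blue G - S"
      then show False
        using key[of d c b a b] V dist E N by (auto simp: comm)
    qed
  qed
  with tight S_sub show ?thesis by (intro exI[of _ S] conjI)
qed

text \<open>The budget is what remains after keeping \<open>3 * card V div 2\<close> edges. The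
  assumptions make the division exact and prevent the subtraction from being truncated.\<close>

theorem deletion_iff_kept_cliques:
  assumes "even (card V)" "3 * card V \<le> 2 * card (edges G)"
  shows "two_colored_P4_deletion G (card (edges G) - 3 * card V div 2) \<longleftrightarrow> (\<exists>on. kept_cliques V \<beta> \<tau> on)"
proof -
  obtain h where h: "card V = 2 * h"
    using assms(1) by blast
  show ?thesis
  proof
  assume "two_colored_P4_deletion G (card (edges G) - 3 * card V div 2)"
  then obtain S where S: "S \<subseteq> edges G" "card S \<le> card (edges G) - 3 * card V div 2"
    "\<not> has_induced_bicolored_P4 (delete_edges G S)"
    unfolding two_colored_P4_deletion_def by (elim exE conjE) (rule that)
  have "card (edges G - S) = card (edges G) - card S"
    using S(1) finite_edges by (simp add: card_Diff_subset finite_subset)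
  then have "3 * card V \<le> 2 * card (edges G - S)"
    using S(2) assms(2) h by simp
  then have "kept_cliques V \<beta> \<tau> (\<lambda>v. blue_nbs S v \<noteq> {})"
    by (rule tight_kept_cliques[OF S(3)])
  then show "\<exists>on. kept_cliques V \<beta> \<tau> on"
    by (rule exI[of _ "\<lambda>v. blue_nbs S v \<noteq> {}"])
next
  assume "\<exists>on. kept_cliques V \<beta> \<tau> on"
  then obtain on where "kept_cliques V \<beta> \<tau> on" ..
  from kept_cliques_solution[OF this] obtain S where S: "S \<subseteq> edges G" "3 * card V \<le> 2 * card (edges G - S)"
    "\<not> has_induced_bicolored_P4 (delete_edges G S)"
    by (elim exE conjE) (rule that)
  have "card (edges G - S) = card (edges G) - card S"
    using S(1) finite_edges by (simp add: card_Diff_subset finite_subset)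
  moreover have "card S \<le> card (edges G)"
    using S(1) finite_edges by (simp add: card_mono)
  ultimately have "card S \<le> card (edges G) - 3 * card V div 2"
    using S(2) assms(2) h by simp
  then show "two_colored_P4_deletion G (card (edges G) - 3 * card V div 2)"
    unfolding two_colored_P4_deletion_def by (intro exI[of _ S] conjI S)
  qed
qed

section \<open>Degrees and cluster structure\<close>

lemma vertex_degree_G:
  "v \<in> V \<Longrightarrow> vertex_degree G v = (card {w \<in> V. \<beta> w = \<beta> v} - 1) + (card {w \<in> V. \<tau> w = \<tau> v} - 1)"
proof -
  assume v: "v \<in> V"
  have "blue_nbs {} v = {w \<in> V. \<beta> w = \<beta> v} - {v}" "red_nbs {} v = {w \<in> V. \<tau> w = \<tau> v} - {v}"
    by (auto simp: blue_nbs_def red_nbs_def)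
  then show ?thesis
    using card_incident[OF v, of "{}"] v by (simp add: vertex_degree_def)
qed

lemma sum_degrees: "(\<Sum>v\<in>V. vertex_degree G v) = 2 * card (edges G)"
  using handshake[of "{}"] card_incident[of _ "{}"] by (simp add: vertex_degree_def)

lemma cluster_graph_blue: "cluster_graph V (blue G)"
  unfolding cluster_graph_def
proof (intro exI conjI)
  let ?P = "(\<lambda>v. {w \<in> V. \<beta> w = \<beta> v}) ` V"
  show "partition_on V ?P"
    by (auto simp: partition_on_def disjoint_def)
  show "blue G = {e. card e = 2 \<and> (\<exists>C\<in>?P. e \<subseteq> C)}"
  proof (intro set_eqI iffI)
    fix e assume "e \<in> blue G"
    then obtain v w where "e = {v, w}" "v \<in> V" "w \<in> V" "v \<noteq> w" "\<beta> v = \<beta> w"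
      by (auto simp: label_graph_def)
    then show "e \<in> {e. card e = 2 \<and> (\<exists>C\<in>?P. e \<subseteq> C)}" by auto
  qed (auto simp: card_2_iff blue_G)
qed

lemma cluster_graph_red: "cluster_graph V (red G)"
  unfolding cluster_graph_def
proof (intro exI conjI)
  let ?P = "(\<lambda>v. {w \<in> V. \<tau> w = \<tau> v}) ` V"
  show "partition_on V ?P"
    by (auto simp: partition_on_def disjoint_def)
  show "red G = {e. card e = 2 \<and> (\<exists>C\<in>?P. e \<subseteq> C)}"
  proof (intro set_eqI iffI)
    fix e assume "e \<in> red G"
    then obtain v w where "e = {v, w}" "v \<in> V" "w \<in> V" "v \<noteq> w" "\<tau> v = \<tau> w"
      by (auto simp: label_graph_def)
    then show "e \<in> {e. card e = 2 \<and> (\<exists>C\<in>?P. e \<subseteq> C)}" by auto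
  qed (auto simp: card_2_iff red_G)
qed

end

section \<open>The gadget graph\<close>

type_synonym vertex = "nat \<times> nat \<times> nat \<times> nat"

text \<open>
  A vertex \<open>(u, j, k, s)\<close> is slot \<open>s\<close> of a blue clique of kind \<open>k\<close> at position \<open>j\<close> of the ring of the
  variable \<open>u\<close>: kind 0 carries the value of \<open>u\<close>, the kinds 1 and 2 link the positions \<open>j, j + 1\<close> and
  \<open>j, j + 2\<close>. Position \<open>j\<close> hosts a constraint: a disjunction of \<open>a j\<close> and \<open>b j\<close> (\<open>ty j = 1\<close>), an odd
  parity constraint on \<open>a j, b j, c j\<close> (\<open>ty j = 2\<close>), or \<open>a j \<noteq> b j\<close> (\<open>ty j = 3\<close>, repeated at \<open>j + 2\<close> with
  \<open>ty (j + 2) = 4\<close>).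
\<close>

definition one_of_three :: "bool \<Rightarrow> bool \<Rightarrow> bool \<Rightarrow> bool" where
  "one_of_three x y z \<longleftrightarrow> x \<and> \<not> y \<and> \<not> z \<or> \<not> x \<and> y \<and> \<not> z \<or> \<not> x \<and> \<not> y \<and> z"

text \<open>The number of on vertices in a red triangle is odd: an off vertex has exactly one on and
  one off companion there.\<close>

lemma kept_cliques_triple:
  assumes kept: "kept_cliques V \<beta> \<tau> on" and cl: "{u \<in> V. \<tau> u = l} = {x, y, z}" and dist: "distinct [x, y, z]"
  shows "on x \<and> on y \<and> on z \<or> one_of_three (on x) (on y) (on z)"
proof (cases "on x \<and> on y \<and> on z")
  case False
  then obtain p where p: "p \<in> {x, y, z}" "\<not> on p" by blast
  then have "p \<in> V" "\<tau> p = l" using cl by blast+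
  have "\<forall>v\<in>V. \<not> on v \<longrightarrow>
      (\<exists>m w. {u \<in> V. \<tau> u = \<tau> v} = {v, m, w} \<and> v \<noteq> m \<and> v \<noteq> w \<and> m \<noteq> w \<and> on m \<and> \<not> on w)"
    using kept unfolding kept_cliques_def by argo
  then obtain m w where "{u \<in> V. \<tau> u = \<tau> p} = {p, m, w}" and mw: "p \<noteq> m" "p \<noteq> w" "m \<noteq> w" "on m" "\<not> on w"
    using p \<open>p \<in> V\<close> by metis
  then have "m \<in> {x, y, z}" "w \<in> {x, y, z}"
    using cl \<open>\<tau> p = l\<close> by blast+
  then show ?thesis
    using p mw dist unfolding one_of_three_def by auto
qed simp

text \<open>An off vertex needs a red triangle. A slot without red edges thus forces its whole blue
  clique to be kept.\<close>

lemma kept_cliques_single: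
  assumes kept: "kept_cliques V \<beta> \<tau> on" and cl: "{u \<in> V. \<tau> u = \<tau> v} = {v}" and v: "v \<in> V"
  shows "on v"
proof (rule ccontr)
  assume "\<not> on v"
  moreover have "\<forall>v\<in>V. \<not> on v \<longrightarrow>
      (\<exists>m w. {u \<in> V. \<tau> u = \<tau> v} = {v, m, w} \<and> v \<noteq> m \<and> v \<noteq> w \<and> m \<noteq> w \<and> on m \<and> \<not> on w)"
    using kept unfolding kept_cliques_def by argo
  ultimately obtain m w where "{v} = {v, m, w}" "v \<noteq> m"
    using cl v by metis
  then show False by blast
qed

lemma triple_off:
  assumes "C = {x, y, z}" "distinct [x, y, z]" "v \<in> {x, y, z}" "\<not> on v" "one_of_three (on x) (on y) (on z)"
  shows "\<exists>m w. C = {v, m, w} \<and> v \<noteq> m \<and> v \<noteq> w \<and> m \<noteq> w \<and> on m \<and> \<not> on w"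
proof -
  consider "on x" "\<not> on y" "\<not> on z" | "on y" "\<not> on x" "\<not> on z" | "on z" "\<not> on x" "\<not> on y"
    using assms(5) unfolding one_of_three_def by blast
  then show ?thesis
  proof cases
    case 1
    then have "v = y \<or> v = z" using assms(3,4) by auto
    then show ?thesis
      using assms(1,2) 1 by (metis insert_commute distinct_length_2_or_more)
  next
    case 2
    then have "v = x \<or> v = z" using assms(3,4) by auto
    then show ?thesis
      using assms(1,2) 2 by (metis insert_commute distinct_length_2_or_more)
  next
    case 3
    then have "v = x \<or> v = y" using assms(3,4) by auto
    then show ?thesis
      using assms(1,2) 3 by (metis insert_commute distinct_length_2_or_more)
  qed
qed

text \<open>No two constraints are adjacent on the ring, and steps of length two reach all of it
  because \<open>n\<close> is odd; \<open>5 \<le> n\<close> excludes short cycles. Type 4 is the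
  second half of an inequality: its four blue singletons lie in four red triangles, two at
  \<open>j\<close> and two at \<open>j + 2\<close>.\<close>

locale gadget =
  fixes nu n :: nat and ty a b c :: "nat \<Rightarrow> nat"
  assumes n: "5 \<le> n" "odd n"
    and ty_pos: "j < n \<Longrightarrow> ty j \<noteq> 0 \<Longrightarrow> even j \<and> Suc j < n \<and> a j < nu \<and> b j < nu \<and> a j \<noteq> b j"
    and ty_le: "ty j \<le> 4"
    and ty_odd: "j < n \<Longrightarrow> ty j = 2 \<Longrightarrow> c j < nu \<and> c j \<noteq> a j \<and> c j \<noteq> b j"
    and ty_neq: "j < n \<Longrightarrow> ty j = 3 \<Longrightarrow> j + 2 < n \<and> ty (j + 2) = 4 \<and> a (j + 2) = a j \<and> b (j + 2) = b j"
    and ty_neq': "j < n \<Longrightarrow> ty j = 4 \<Longrightarrow> 2 \<le> j \<and> ty (j - 2) = 3 \<and> a (j - 2) = a j \<and> b (j - 2) = b j"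
begin

definition verts4 :: "vertex set" where
  "verts4 = {..<nu} \<times> {..<n} \<times> {..<3} \<times> {..<4}"

definition sc :: "nat \<Rightarrow> nat" where "sc j = (if Suc j = n then 0 else Suc j)"
definition pr :: "nat \<Rightarrow> nat" where "pr j = (if j = 0 then n - 1 else j - 1)"

text \<open>\<open>xr u j\<close>: the link of \<open>u\<close> between \<open>j\<close> and \<open>j + 1\<close> is replaced by a parity constraint.\<close>

definition xr :: "nat \<Rightarrow> nat \<Rightarrow> bool" where
  "xr u j \<longleftrightarrow> 2 \<le> ty j \<and> (u = a j \<or> u = b j \<or> ty j = 2 \<and> u = c j)"

abbreviation off_clique :: "nat \<Rightarrow> nat \<Rightarrow> bool" where
  "off_clique u j \<equiv> ty j = 3 \<and> u = a j"

fun bet :: "vertex \<Rightarrow> nat \<times> nat \<times> nat" where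
  "bet (u, j, k, s) = (u, j, if k = 1 \<and> off_clique u j then 4 + s else k)"

text \<open>The label \<open>(u, j, 0)\<close> is the link of \<open>u\<close> from \<open>j\<close>
  to \<open>j + 1\<close>, and \<open>(u, j, 2)\<close> the link from \<open>j\<close> to
  \<open>j + 2\<close>. If a constraint replaces the former link, the labels
  \<open>(a j, j, 0)\<close> and \<open>(a j, j, 1)\<close> collect the slots at its two ends.
  Labels with last component at least 4 occur only once.\<close>

fun tau :: "vertex \<Rightarrow> nat \<times> nat \<times> nat" where
  "tau (u, j, k, s) =
    (if k = 0 then
       (if s = 0 then (if xr u j then a j else u, j, 0)
        else if s = 1 then (if xr u (pr j) then (a (pr j), pr j, 1) else (u, pr j, 0))
        else if s = 2 then (u, j, 2) else (u, pr (pr j), 2))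
     else if k = 1 then
       (if off_clique u j then (u, if s < 2 then j else j + 2, s mod 2)
        else if s = 0 \<and> \<not> xr u j \<and> \<not> (ty j = 1 \<and> u = b j) then (u, j, 0)
        else if s = 1 \<and> ty j = 1 \<and> u = a j then (b j, j, 0)
        else (u, j, 4 + s))
     else (if s = 0 then (u, j, 2) else (u, j, 8 + s)))"

lemma less_4: "k < 4 \<longleftrightarrow> k = 0 \<or> k = 1 \<or> k = 2 \<or> k = 3" for k :: nat by auto

lemma mem_verts4 [simp]: "(u, j, k, s) \<in> verts4 \<longleftrightarrow> u < nu \<and> j < n \<and> k < 3 \<and> s < 4"
  by (simp add: verts4_def)

lemma sc_less [simp]: "j < n \<Longrightarrow> sc j < n" by (auto simp: sc_def)
lemma pr_less [simp]: "j < n \<Longrightarrow> pr j < n" by (auto simp: pr_def)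
lemma pr_sc [simp]: "j < n \<Longrightarrow> pr (sc j) = j" by (auto simp: pr_def sc_def)
lemma sc_pr [simp]: "j < n \<Longrightarrow> sc (pr j) = j" by (auto simp: pr_def sc_def)
lemma sc_neq: "j < n \<Longrightarrow> sc j \<noteq> j" "j < n \<Longrightarrow> sc (sc j) \<noteq> j" "j < n \<Longrightarrow> sc (sc (sc j)) \<noteq> j"
  "j < n \<Longrightarrow> sc (sc (sc (sc j))) \<noteq> j"
  using n by (auto simp: sc_def)

text \<open>Constraints sit at even positions, and the even position \<open>n - 1\<close>, the
  predecessor of 0, is excluded by \<open>Suc j < n\<close>. So slots 0 and 1 of a value clique are
  never both in parity constraints.\<close>

lemma xr_pr:
  assumes "j < n" "xr u j" "xr w (pr j)"
  shows False
proof -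
  have "ty j \<noteq> 0" "ty (pr j) \<noteq> 0"
    using assms by (auto simp: xr_def)
  then have "even j" "even (pr j)" "Suc (pr j) < n"
    using ty_pos[of j] ty_pos[of "pr j"] assms(1) by simp_all
  then show False
    using assms(1) by (auto simp: pr_def split: if_splits)
qed

lemma xr_a: "2 \<le> ty j \<Longrightarrow> xr (a j) j"
  by (simp add: xr_def)

lemma xr_first: "xr u j \<Longrightarrow> xr (a j) j"
  by (auto simp: xr_def)

lemma xr_b: "2 \<le> ty j \<Longrightarrow> xr (b j) j"
  by (simp add: xr_def)

section \<open>Red cliques of the gadget graph\<close>

definition members :: "nat \<times> nat \<times> nat \<Rightarrow> vertex set" where
  "members l = {v \<in> verts4. tau v = l}"

text \<open>In all cases \<open>j\<close> is the position in the red label rather than that of the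
  vertex; this is why slots 1 and 3 are placed at \<open>sc j\<close> and \<open>sc (sc j)\<close>.
  The cases named q are slots in links, those named x slots in parity constraints.\<close>

lemma vertex_cases:
  assumes "v \<in> verts4"
  obtains (q0) u j where "u < nu" "j < n" "\<not> xr u j" "v = (u, j, 0, 0)" "tau v = (u, j, 0)"
  | (x0) u j where "u < nu" "j < n" "xr u j" "v = (u, j, 0, 0)" "tau v = (a j, j, 0)"
  | (q1) u j where "u < nu" "j < n" "\<not> xr u j" "v = (u, sc j, 0, 1)" "tau v = (u, j, 0)"
  | (x1) u j where "u < nu" "j < n" "xr u j" "v = (u, sc j, 0, 1)" "tau v = (a j, j, 1)"
  | (q2) u j where "u < nu" "j < n" "v = (u, j, 0, 2)" "tau v = (u, j, 2)"
  | (q3) u j where "u < nu" "j < n" "v = (u, sc (sc j), 0, 3)" "tau v = (u, j, 2)"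
  | (off0) j s where "j < n" "ty j = 3" "s < 2" "v = (a j, j, 1, s)" "tau v = (a j, j, s)"
  | (off1) j s where "j < n" "ty j = 4" "s < 2" "v = (a j, j - 2, 1, 2 + s)" "tau v = (a j, j, s)"
  | (l0) u j where "u < nu" "j < n" "\<not> xr u j" "\<not> (ty j = 1 \<and> u = b j)" "v = (u, j, 1, 0)" "tau v = (u, j, 0)"
  | (l1) j where "j < n" "ty j = 1" "v = (a j, j, 1, 1)" "tau v = (b j, j, 0)"
  | (free1) u j s where "u < nu" "j < n" "\<not> off_clique u j" "s < 4" "v = (u, j, 1, s)" "tau v = (u, j, 4 + s)"
  | (m0) u j where "u < nu" "j < n" "v = (u, j, 2, 0)" "tau v = (u, j, 2)"
  | (free2) u j s where "u < nu" "j < n" "0 < s" "s < 4" "v = (u, j, 2, s)" "tau v = (u, j, 8 + s)"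
proof -
  obtain u j k s where v: "v = (u, j, k, s)" "u < nu" "j < n" "k < 3" "s < 4"
    using assms by (cases v) auto
  have ks: "k = 0 \<or> k = 1 \<or> k = 2" "s = 0 \<or> s = 1 \<or> s = 2 \<or> s = 3" "s < 2 \<or> 2 \<le> s" "s = 0 \<or> 0 < s"
    using v(4,5) by auto
  consider (0) "k = 0" "s = 0" | (1) "k = 0" "s = 1" | (2) "k = 0" "s = 2" | (3) "k = 0" "s = 3"
    | (off0) "k = 1" "off_clique u j" "s < 2" | (off1) "k = 1" "off_clique u j" "2 \<le> s"
    | (l) "k = 1" "\<not> off_clique u j" | (m0) "k = 2" "s = 0" | (m) "k = 2" "0 < s"
    using ks by blast
  then show thesis
  proof cases
    case 0
    then show thesis using v q0[of u j] x0[of u j] by (cases "xr u j") simp_all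
  next
    case 1
    then show thesis using v q1[of u "pr j"] x1[of u "pr j"] by (cases "xr u (pr j)") simp_all
  next
    case 2
    then show thesis using v q2[of u j] by simp
  next
    case 3
    then show thesis using v q3[of u "pr (pr j)"] by simp
  next
    case off0
    then show thesis using v that(7)[of j s] by simp
  next
    case off1
    then have "s = 2 + (s - 2)" "s mod 2 = s - 2" using v(5) by (auto simp: less_4)
    then show thesis using v off1 that(8)[of "j + 2" "s - 2"] ty_neq[of j] by simp
  next
    case l
    show thesis
    proof (cases "s = 0 \<and> \<not> xr u j \<and> \<not> (ty j = 1 \<and> u = b j)")
      case True
      then show thesis using v l l0[of u j] by simp
    next
      case *: False
      show thesis
      proof (cases "s = 1 \<and> ty j = 1 \<and> u = a j")
        case True
        then show thesis using v l l1[of j] by simp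
      next
        case False
        have "tau v = (u, j, 4 + s)"
          unfolding v(1) tau.simps l(1)
          by (simp only: one_neq_zero if_False refl if_True if_not_P[OF l(2)] if_not_P[OF *] if_not_P[OF False])
        then show thesis using v l free1[of u j s] by simp
      qed
    qed
  next
    case m0
    then show thesis using v that(12)[of u j] by simp
  next
    case m
    then show thesis using v free2[of u j s] by simp
  qed
qed

declare tau.simps [simp del]

lemma in_members: "v \<in> verts4 \<Longrightarrow> tau v = l \<Longrightarrow> v \<in> members l"
  by (simp add: members_def)

lemma members_T2:
  assumes "u < nu" "j < n"
  shows "members (u, j, 2) = {(u, j, 0, 2), (u, sc (sc j), 0, 3), (u, j, 2, 0)}"
proof (rule set_eqI, rule iffI)
  fix v assume "v \<in> members (u, j, 2)"
  then have v: "v \<in> verts4" "tau v = (u, j, 2)" by (auto simp: members_def)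
  from v(1) show "v \<in> {(u, j, 0, 2), (u, sc (sc j), 0, 3), (u, j, 2, 0)}"
    by (cases v rule: vertex_cases) (use v(2) in auto)
qed (use assms in \<open>auto simp: tau.simps intro!: in_members\<close>)

text \<open>The forced vertex of a link triangle. For the second variable of a disjunction it
  belongs to the link clique of the first variable, which thereby serves both links.\<close>

definition linker :: "nat \<Rightarrow> nat \<Rightarrow> vertex" where
  "linker u j = (if ty j = 1 \<and> u = b j then (a j, j, 1, 1) else (u, j, 1, 0))"

lemma members_T1:
  assumes "u < nu" "j < n" "\<not> xr u j"
  shows "members (u, j, 0) = {(u, j, 0, 0), (u, sc j, 0, 1), linker u j}"
proof (rule set_eqI, rule iffI)
  fix v assume "v \<in> members (u, j, 0)"
  then have v: "v \<in> verts4" "tau v = (u, j, 0)" by (auto simp: members_def)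
  from v(1) show "v \<in> {(u, j, 0, 0), (u, sc j, 0, 1), linker u j}"
    by (cases v rule: vertex_cases) (use v(2) assms(3) xr_a xr_first in \<open>auto simp: linker_def\<close>)
next
  fix v assume "v \<in> {(u, j, 0, 0), (u, sc j, 0, 1), linker u j}"
  moreover have "\<not> off_clique u j"
    using assms(3) by (auto simp: xr_def)
  ultimately show "v \<in> members (u, j, 0)"
    using assms ty_pos[of j] by (auto simp: tau.simps linker_def intro!: in_members)
qed

text \<open>The third vertex of a parity triangle is a value vertex of \<open>c j\<close> or a blue
  singleton. The singleton is off, so exactly one of the other two vertices is on.\<close>

definition third :: "nat \<Rightarrow> nat \<Rightarrow> vertex" where
  "third j s = (if ty j = 2 then (c j, if s = 0 then j else sc j, 0, s)
     else if ty j = 3 then (a j, j, 1, s) else (a j, j - 2, 1, 2 + s))"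

lemma third_in_members:
  assumes "j < n" "2 \<le> ty j" "s < 2"
  shows "third j s \<in> members (a j, j, s)"
proof -
  consider "ty j = 2" | "ty j = 3" | "ty j = 4"
    using assms(2) ty_le[of j] by linarith
  then show ?thesis
  proof cases
    case 1
    then show ?thesis
      using assms ty_odd[of j] by (auto simp: tau.simps third_def xr_def less_2_cases_iff intro!: in_members)
  next
    case 2
    then show ?thesis
      using assms ty_pos[of j] by (auto simp: tau.simps third_def less_2_cases_iff intro!: in_members)
  next
    case 3
    then show ?thesis
      using assms ty_pos[of j] ty_neq'[of j] by (auto simp: tau.simps third_def less_2_cases_iff intro!: in_members)
  qed
qed

lemma members_X0:
  assumes "j < n" "2 \<le> ty j"
  shows "members (a j, j, 0) = {(a j, j, 0, 0), (b j, j, 0, 0), third j 0}"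
proof (rule set_eqI, rule iffI)
  fix v assume "v \<in> members (a j, j, 0)"
  then have v: "v \<in> verts4" "tau v = (a j, j, 0)" by (auto simp: members_def)
  from v(1) show "v \<in> {(a j, j, 0, 0), (b j, j, 0, 0), third j 0}"
    by (cases v rule: vertex_cases) (use v(2) assms xr_a[of j] in \<open>auto simp: third_def xr_def\<close>)
next
  fix v assume "v \<in> {(a j, j, 0, 0), (b j, j, 0, 0), third j 0}"
  then show "v \<in> members (a j, j, 0)"
    using assms ty_pos[of j] xr_a[of j] xr_b[of j] third_in_members[of j 0] by (auto simp: tau.simps members_def)
qed

lemma members_X1:
  assumes "j < n" "2 \<le> ty j"
  shows "members (a j, j, 1) = {(a j, sc j, 0, 1), (b j, sc j, 0, 1), third j 1}"
proof (rule set_eqI, rule iffI)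
  fix v assume "v \<in> members (a j, j, 1)"
  then have v: "v \<in> verts4" "tau v = (a j, j, 1)" by (auto simp: members_def)
  from v(1) show "v \<in> {(a j, sc j, 0, 1), (b j, sc j, 0, 1), third j 1}"
    by (cases v rule: vertex_cases) (use v(2) assms in \<open>auto simp: third_def xr_def\<close>)
next
  fix v assume "v \<in> {(a j, sc j, 0, 1), (b j, sc j, 0, 1), third j 1}"
  then show "v \<in> members (a j, j, 1)"
    using assms ty_pos[of j] xr_a[of j] xr_b[of j] third_in_members[of j 1] by (auto simp: tau.simps members_def)
qed

lemma members_single:
  assumes "v \<in> verts4" "tau v = (u, j, 4 + i)"
  shows "members (u, j, 4 + i) = {v}"
proof -
  have "w = v" if w: "w \<in> verts4" "tau w = (u, j, 4 + i)" for w
    using assms(1)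
  proof (cases v rule: vertex_cases)
    case (free1 u' j' s)
    from w(1) show ?thesis
      by (cases w rule: vertex_cases) (use w(2) assms(2) free1 in auto)
  next
    case (free2 u' j' s)
    from w(1) show ?thesis
      by (cases w rule: vertex_cases) (use w(2) assms(2) free2 in auto)
  qed (use assms(2) in auto)
  then show ?thesis
    using assms unfolding members_def by blast
qed

lemma tau_cases:
  assumes "v \<in> verts4"
  obtains (T2) u j where "u < nu" "j < n" "tau v = (u, j, 2)"
  | (T1) u j where "u < nu" "j < n" "\<not> xr u j" "tau v = (u, j, 0)"
  | (X0) j where "j < n" "2 \<le> ty j" "tau v = (a j, j, 0)"
  | (X1) j where "j < n" "2 \<le> ty j" "tau v = (a j, j, 1)"
  | (single) u j i where "tau v = (u, j, 4 + i)"
  using assms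
proof (cases v rule: vertex_cases)
  case (off0 j s)
  then show thesis using X0[of j] X1[of j] by (auto simp: less_2_cases_iff)
next
  case (off1 j s)
  then show thesis using X0[of j] X1[of j] by (auto simp: less_2_cases_iff)
next
  case (l1 j)
  then have "\<not> xr (b j) j" "b j < nu" using ty_pos[of j] by (auto simp: xr_def)
  then show thesis using l1 T1[of "b j" j] by simp
next
  case (x0 u j)
  then show thesis using X0[of j] by (auto simp: xr_def)
next
  case (x1 u j)
  then show thesis using X1[of j] by (auto simp: xr_def)
next
  case (free1 u j s)
  then show thesis using single[of u j s] by simp
next
  case (free2 u j s)
  then show thesis using single[of u j "4 + s"] by simp
next
  case (q0 u j)
  then show thesis using T1[of u j] by simp
next
  case (q1 u j)
  then show thesis using T1[of u j] by simp
next
  case (l0 u j)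
  then show thesis using T1[of u j] by simp
next
  case (q2 u j)
  then show thesis using T2[of u j] by simp
next
  case (q3 u j)
  then show thesis using T2[of u j] by simp
next
  case (m0 u j)
  then show thesis using T2[of u j] by simp
qed

section \<open>Blue cliques and the exclusion of short cycles\<close>

lemma bet_eq_iff:
  assumes "k < 3" "k' < 3"
  shows "bet (u, j, k, s) = bet (u', j', k', s') \<longleftrightarrow>
    u = u' \<and> j = j' \<and> k = k' \<and> (k = 1 \<and> off_clique u j \<longrightarrow> s = s')"
  using assms by (cases "k = 1 \<and> off_clique u j"; cases "k' = 1 \<and> off_clique u' j'") auto

declare bet.simps [simp del]

lemma blue_class:
  assumes "(u, j, k, s) \<in> verts4"
  shows "{w \<in> verts4. bet w = bet (u, j, k, s)} = (if k = 1 \<and> off_clique u j then {(u, j, k, s)}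
    else {(u, j, k, 0), (u, j, k, 1), (u, j, k, 2), (u, j, k, 3)})"
proof (rule set_eqI)
  fix w :: vertex
  obtain u' j' k' s' where w: "w = (u', j', k', s')" by (cases w)
  show "w \<in> {w \<in> verts4. bet w = bet (u, j, k, s)} \<longleftrightarrow> w \<in> (if k = 1 \<and> off_clique u j then {(u, j, k, s)}
    else {(u, j, k, 0), (u, j, k, 1), (u, j, k, 2), (u, j, k, 3)})"
  proof (cases "k' < 3 \<and> s' < 4")
    case True
    then have "bet w = bet (u, j, k, s) \<longleftrightarrow> u' = u \<and> j' = j \<and> k' = k \<and> (k' = 1 \<and> off_clique u' j' \<longrightarrow> s' = s)"
      using assms unfolding w by (intro bet_eq_iff) simp_all
    moreover have "s' = 0 \<or> s' = 1 \<or> s' = 2 \<or> s' = 3"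
      using True by (simp add: less_4)
    ultimately show ?thesis
      using assms True by (cases "k = 1 \<and> off_clique u j") (auto simp: w)
  next
    case False
    then show ?thesis
      using assms by (auto simp: w)
  qed
qed

lemma card_blue: "(u, j, k, s) \<in> verts4 \<Longrightarrow>
  card {w \<in> verts4. bet w = bet (u, j, k, s)} = (if k = 1 \<and> off_clique u j then 1 else 4)"
  by (simp add: blue_class)

lemma red_class: "{w \<in> verts4. tau w = tau v} = members (tau v)"
  by (simp add: members_def)

lemma distinct_third:
  assumes "j < n" "2 \<le> ty j"
  shows "third j 0 \<notin> {(a j, j, 0, 0), (b j, j, 0, 0)}" "third j 1 \<notin> {(a j, sc j, 0, 1), (b j, sc j, 0, 1)}"
  using assms ty_pos[of j] ty_odd[of j] by (auto simp: third_def)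

lemma card_red:
  assumes "v \<in> verts4"
  shows "card (members (tau v)) \<in> {1, 3}"
  using assms
proof (cases v rule: tau_cases)
  case (X0 j)
  then show ?thesis
    using members_X0[of j] distinct_third[of j] ty_pos[of j] by auto
next
  case (X1 j)
  then show ?thesis
    using members_X1[of j] distinct_third[of j] ty_pos[of j] by auto
next
  case (single u j i)
  then show ?thesis
    using members_single[OF assms] by simp
qed (auto simp: members_T2 members_T1 linker_def)

lemma linear4:
  assumes v: "v \<in> verts4" and w: "w \<in> verts4" and eq: "bet v = bet w" "tau v = tau w"
  shows "v = w"
proof -
  obtain u j k s where v': "v = (u, j, k, s)" by (cases v)
  obtain u' j' k' s' where w': "w = (u', j', k', s')" by (cases w)
  have 1: "u' = u" "j' = j" "k' = k" and off: "k = 1 \<and> off_clique u j \<longrightarrow> s = s'"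
    using bet_eq_iff[of k k' u j s u' j' s'] eq(1) v w unfolding v' w' by auto
  note w'' = w'[unfolded 1]
  from v show ?thesis
  proof (cases v rule: vertex_cases)
    case (l0 u1 j1)
    from w show ?thesis
      by (cases w rule: vertex_cases) (use l0 eq(2) v' w'' ty_pos[of j] ty_neq'[of j] in auto)
  next
    case (l1 j1)
    from w show ?thesis
      by (cases w rule: vertex_cases) (use l1 eq(2) v' w'' ty_pos[of j] in auto)
  next
    case (q0 u1 j1)
    from w show ?thesis
      by (cases w rule: vertex_cases) (use q0 eq(2) v' w'' sc_neq[of j] in auto)
  next
    case (x0 u1 j1)
    from w show ?thesis
      by (cases w rule: vertex_cases) (use x0 eq(2) v' w'' sc_neq[of j] in auto)
  next
    case (q1 u1 j1)
    from w show ?thesis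
      by (cases w rule: vertex_cases) (use q1 eq(2) v' w'' sc_neq[of j1] in auto)
  next
    case (x1 u1 j1)
    from w show ?thesis
      by (cases w rule: vertex_cases) (use x1 eq(2) v' w'' sc_neq[of j1] in auto)
  next
    case (q2 u1 j1)
    from w show ?thesis
      by (cases w rule: vertex_cases) (use q2 eq(2) v' w'' sc_neq[of j1] in auto)
  next
    case (q3 u1 j1)
    from w show ?thesis
      by (cases w rule: vertex_cases) (use q3 eq(2) v' w'' sc_neq[of j1] in auto)
  next
    case (off0 j1 s1)
    then show ?thesis using off v' w'' by auto
  next
    case (off1 j1 s1)
    then show ?thesis using off v' w'' ty_neq'[of j1] by auto
  next
    case (m0 u1 j1)
    from w show ?thesis
      by (cases w rule: vertex_cases) (use m0 eq(2) v' w'' in auto)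
  next
    case (free1 u1 j1 s1)
    from w show ?thesis
      by (cases w rule: vertex_cases) (use free1 eq(2) v' w'' in auto)
  next
    case (free2 u1 j1 s1)
    from w show ?thesis
      by (cases w rule: vertex_cases) (use free2 eq(2) v' w'' in auto)
  qed
qed

lemma share_values:
  assumes "(u, j, 0, s) \<in> verts4" "(u', j', 0, s') \<in> verts4" "(u, j, 0, s) \<noteq> (u', j', 0, s')"
    "tau (u, j, 0, s) = tau (u', j', 0, s')"
  shows "s = 0 \<and> s' = 0 \<and> j = j' \<and> xr u j \<and> u \<noteq> u' \<or> s = 1 \<and> s' = 1 \<and> j = j' \<and> xr u (pr j) \<and> u \<noteq> u' \<or>
    u = u' \<and> (s = 0 \<and> s' = 1 \<and> j' = sc j \<or> s = 1 \<and> s' = 0 \<and> j = sc j' \<or>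
      s = 2 \<and> s' = 3 \<and> j' = sc (sc j) \<or> s = 3 \<and> s' = 2 \<and> j = sc (sc j'))"
  using assms(1)
proof (cases rule: vertex_cases)
  case (q0 u1 j1)
  from assms(2) show ?thesis
    by (cases rule: vertex_cases) (use q0 assms(3,4) xr_first[of u' j'] in auto)
next
  case (x0 u1 j1)
  from assms(2) show ?thesis
    by (cases rule: vertex_cases) (use x0 assms(3,4) xr_first[of u j] in auto)
next
  case (q1 u1 j1)
  from assms(2) show ?thesis
    by (cases rule: vertex_cases) (use q1 assms(3,4) xr_first[of u' j'] in auto)
next
  case (x1 u1 j1)
  from assms(2) show ?thesis
    by (cases rule: vertex_cases) (use x1 assms(3,4) in auto)
next
  case (q2 u1 j1)
  from assms(2) show ?thesis
    by (cases rule: vertex_cases) (use q2 assms(3,4) in auto)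
next
  case (q3 u1 j1)
  from assms(2) show ?thesis
    by (cases rule: vertex_cases) (use q3 assms(3,4) in auto)
qed auto

lemma members_self: "v \<in> verts4 \<Longrightarrow> v \<in> members (tau v)"
  by (simp add: members_def)

text \<open>A clique of kind 2 has only one slot with red edges. A clique of kind 1 has two such
  slots only in a disjunction, and these lead to cliques of the different variables
  \<open>a j\<close> and \<open>b j\<close>.\<close>

lemma two_shared_slots:
  assumes v: "(u, j, k, s) \<in> verts4" "(u, j, k, s') \<in> verts4" "s \<noteq> s'" "\<not> (k = 1 \<and> off_clique u j)"
    and p: "x \<in> verts4" "x \<noteq> (u, j, k, s)" "tau x = tau (u, j, k, s)"
    and p': "y \<in> verts4" "y \<noteq> (u, j, k, s')" "tau y = tau (u, j, k, s')" and xy: "bet x = bet y"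
  shows "k = 0"
proof -
  have single: "\<not> (\<exists>u' j' i. tau (u, j, k, s) = (u', j', 4 + i))" "\<not> (\<exists>u' j' i. tau (u, j, k, s') = (u', j', 4 + i))"
    using members_single[OF v(1)] members_single[OF v(2)] p p' members_self[of x] members_self[of y] by auto
  have slots: "k = 0 \<or> k = 1 \<and> t = 0 \<or> k = 1 \<and> t = 1 \<and> ty j = 1 \<and> u = a j \<or> k = 2 \<and> t = 0"
    if t: "(u, j, k, t) \<in> verts4" "\<not> (\<exists>u' j' i. tau (u, j, k, t) = (u', j', 4 + i))" for t
    using t(1)
  proof (cases rule: vertex_cases)
    case (free2 u1 j1 s1)
    then have "tau (u, j, k, t) = (u1, j1, 4 + (4 + s1))" by simp
    then show ?thesis using t(2) by blast
  next
    case (free1 u1 j1 s1)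
    then show ?thesis using t(2) by blast
  next
    case (off0 j1 s1)
    then show ?thesis using v(4) by auto
  next
    case (off1 j1 s1)
    then show ?thesis using v(4) ty_neq'[of j1] by auto
  qed auto
  have False if k: "k = 1" "ty j = 1" "u = a j" and st: "s = 0 \<and> s' = 1 \<or> s = 1 \<and> s' = 0"
  proof -
    have ab: "a j < nu" "b j < nu" "j < n" "a j \<noteq> b j"
      using ty_pos[of j] v k by auto
    have nx: "\<not> xr (a j) j" "\<not> xr (b j) j"
      using k by (auto simp: xr_def)
    have t0: "tau (u, j, k, 0) = (a j, j, 0)" "tau (u, j, k, 1) = (b j, j, 0)"
      using k ab nx by (auto simp: tau.simps)
    have fst: "fst z = fst z'" if "bet z = bet z'" for z z'
      using that by (cases z; cases z') (simp add: bet.simps)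
    have fa: "fst z = a j" if "z \<in> verts4" "tau z = (a j, j, 0)" "z \<noteq> (u, j, k, 0)" for z
    proof -
      have "z \<in> {(a j, j, 0, 0), (a j, sc j, 0, 1), linker (a j) j}"
        using in_members[OF that(1,2)] unfolding members_T1[OF ab(1,3) nx(1)] .
      moreover have "linker (a j) j = (u, j, k, 0)"
        using k ab by (simp add: linker_def)
      ultimately show ?thesis using that(3) by auto
    qed
    have fb: "fst z = b j" if "z \<in> verts4" "tau z = (b j, j, 0)" "z \<noteq> (u, j, k, 1)" for z
    proof -
      have "z \<in> {(b j, j, 0, 0), (b j, sc j, 0, 1), linker (b j) j}"
        using in_members[OF that(1,2)] unfolding members_T1[OF ab(2,3) nx(2)] .
      moreover have "linker (b j) j = (u, j, k, 1)"
        using k by (simp add: linker_def)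
      ultimately show ?thesis using that(3) by auto
    qed
    from st show False
    proof
      assume "s = 0 \<and> s' = 1"
      then have "fst x = a j" "fst y = b j"
        using fa[OF p(1)] fb[OF p'(1)] p p' t0 by simp_all
      then show False using fst[OF xy] ab(4) by simp
    next
      assume "s = 1 \<and> s' = 0"
      then have "fst x = b j" "fst y = a j"
        using fb[OF p(1)] fa[OF p'(1)] p p' t0 by simp_all
      then show False using fst[OF xy] ab(4) by simp
    qed
  qed
  then show ?thesis
    using slots[OF v(1) single(1)] slots[OF v(2) single(2)] v(3) by auto
qed

text \<open>By \<open>two_shared_slots\<close> both blue cliques carry values. The two red edges
  change the position by at most two or switch the variable at a constraint. Two different moves
  between the same cliques would close a walk of length at most four on the ring, confuse steps of
  length one and two, or require adjacent constraints.\<close>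

lemma no_C4_4:
  assumes V: "v \<in> verts4" "w \<in> verts4" "x \<in> verts4" "y \<in> verts4"
    and eq: "bet v = bet w" "tau w = tau x" "bet x = bet y" "tau y = tau v"
  shows "v = w \<or> w = x"
proof (rule ccontr)
  assume "\<not> (v = w \<or> w = x)"
  then have ne: "v \<noteq> w" "w \<noteq> x" by auto
  then have ne': "x \<noteq> y" "y \<noteq> v"
    using linear4[of v w] linear4[of w x] V eq by auto
  obtain u j k s where v: "v = (u, j, k, s)" by (cases v)
  obtain u1 j1 k1 s' where w1: "w = (u1, j1, k1, s')" by (cases w)
  have *: "u1 = u" "j1 = j" "k1 = k" "\<not> (k = 1 \<and> off_clique u j)" "s \<noteq> s'"
    using bet_eq_iff[of k k1 u j s u1 j1 s'] eq(1) V ne(1) unfolding v w1 by auto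
  note w = w1[unfolded *(1-3)]
  obtain u' j' k' t where x: "x = (u', j', k', t)" by (cases x)
  obtain u2 j2 k2 t' where y1: "y = (u2, j2, k2, t')" by (cases y)
  have **: "u2 = u'" "j2 = j'" "k2 = k'" "\<not> (k' = 1 \<and> off_clique u' j')" "t \<noteq> t'"
    using bet_eq_iff[of k' k2 u' j' t u2 j2 t'] eq(3) V ne'(1) unfolding x y1 by auto
  note y = y1[unfolded **(1-3)]
  have "k = 0"
    using two_shared_slots[of u j k s s' y x] V eq ne ne' * v w by auto
  have "k' = 0"
    using two_shared_slots[of u' j' k' t t' w v] V eq ne ne' ** x y by auto
  have j: "j < n" "j' < n" using V v x by auto
  have 1: "s = 0 \<and> t' = 0 \<and> j = j' \<and> xr u j \<and> u \<noteq> u' \<or> s = 1 \<and> t' = 1 \<and> j = j' \<and> xr u (pr j) \<and> u \<noteq> u' \<or>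
    u = u' \<and> (s = 0 \<and> t' = 1 \<and> j' = sc j \<or> s = 1 \<and> t' = 0 \<and> j = sc j' \<or>
      s = 2 \<and> t' = 3 \<and> j' = sc (sc j) \<or> s = 3 \<and> t' = 2 \<and> j = sc (sc j'))"
    by (rule share_values) (use V eq(4) ne'(2) v y \<open>k = 0\<close> \<open>k' = 0\<close> in auto)
  have 2: "s' = 0 \<and> t = 0 \<and> j = j' \<and> xr u j \<and> u \<noteq> u' \<or> s' = 1 \<and> t = 1 \<and> j = j' \<and> xr u (pr j) \<and> u \<noteq> u' \<or>
    u = u' \<and> (s' = 0 \<and> t = 1 \<and> j' = sc j \<or> s' = 1 \<and> t = 0 \<and> j = sc j' \<or>
      s' = 2 \<and> t = 3 \<and> j' = sc (sc j) \<or> s' = 3 \<and> t = 2 \<and> j = sc (sc j'))"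
    by (rule share_values) (use V eq(2) ne(2) w x \<open>k = 0\<close> \<open>k' = 0\<close> in auto)
  have d: "sc j \<noteq> sc (sc j)" "sc j' \<noteq> sc (sc j')"
    using sc_neq(1)[of "sc j"] sc_neq(1)[of "sc j'"] j by auto
  have N: "\<not> (j' = sc j \<and> j = sc j')" "\<not> (j' = sc j \<and> j' = sc (sc j))" "\<not> (j' = sc j \<and> j = sc (sc j'))"
    "\<not> (j = sc j' \<and> j' = sc (sc j))" "\<not> (j = sc j' \<and> j = sc (sc j'))" "\<not> (j' = sc (sc j) \<and> j = sc (sc j'))"
    "\<not> (xr u j \<and> xr u (pr j))"
    using xr_pr[OF j(1)] sc_neq(2-4)[OF j(1)] d by metis+
  moreover have "\<not> (s = 0 \<and> s' = 0)" "\<not> (s = 1 \<and> s' = 1)" "\<not> (s = 2 \<and> s' = 2)" "\<not> (s = 3 \<and> s' = 3)"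
    using *(5) by auto
  ultimately show False
    using 1 2 by satx
qed

lemma labelled_gadget: "labelled verts4 bet tau"
proof
  show "finite verts4" by (simp add: verts4_def)
  show "card {w \<in> verts4. bet w = bet v} \<in> {1, 4}" if "v \<in> verts4" for v
    using that by (cases v) (auto simp: card_blue)
  show "card {w \<in> verts4. tau w = tau v} \<in> {1, 3}" if "v \<in> verts4" for v
    unfolding red_class by (rule card_red[OF that])
qed (use linear4 no_C4_4 in blast)+

section \<open>Kept cliques and satisfying assignments\<close>

definition sat :: "(nat \<Rightarrow> bool) \<Rightarrow> bool" where
  "sat val \<longleftrightarrow> (\<forall>j<n. (ty j = 1 \<longrightarrow> val (a j) \<or> val (b j)) \<and>
     (ty j = 2 \<longrightarrow> val (a j) \<and> val (b j) \<and> val (c j) \<or> one_of_three (val (a j)) (val (b j)) (val (c j))) \<and>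
     (ty j = 3 \<longrightarrow> val (a j) \<noteq> val (b j)))"

lemma distinct_T1: "j < n \<Longrightarrow> distinct [(u, j, 0, 0) :: vertex, (u, sc j, 0, 1), linker u j]"
  by (simp add: linker_def)

lemma distinct_T2: "distinct [(u, j, 0, 2) :: vertex, (u, sc (sc j), 0, 3), (u, j, 2, 0)]"
  by simp

lemma distinct_X:
  assumes "j < n" "2 \<le> ty j"
  shows "distinct [(a j, j, 0, 0), (b j, j, 0, 0), third j 0]"
    "distinct [(a j, sc j, 0, 1), (b j, sc j, 0, 1), third j 1]"
  using assms distinct_third[OF assms] ty_pos[of j] by auto

text \<open>All copies of a variable agree by the links of length two, so position 0 determines the
  assignment and every constraint can be read off at its own position.\<close>

lemma sat_of_kept:
  assumes kept: "kept_cliques verts4 bet tau on"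
  shows "sat (\<lambda>u. on (u, 0, 0, 0))"
proof -
  have cell: "on v = on w" if "v \<in> verts4" "w \<in> verts4" "bet v = bet w" for v w
    using kept that unfolding kept_cliques_def by meson
  have slot: "on (u, j, k, s) = on (u, j, k, 0)" if "(u, j, k, s) \<in> verts4" "\<not> (k = 1 \<and> off_clique u j)" for u j k s
    using that by (intro cell) (auto simp: bet_eq_iff)
  have sole: "v = v'" if "v \<in> verts4" "v' \<in> verts4" "on v" "bet v = bet v'"
     "\<exists>w\<in>verts4. tau w = tau v \<and> \<not> on w" "\<exists>w\<in>verts4. tau w = tau v' \<and> \<not> on w" for v v'
    using kept that unfolding kept_cliques_def by meson
  note triple = kept_cliques_triple[OF kept, folded members_def]
  have single: "on v" if "v \<in> verts4" "tau v = (u, j, 4 + i)" for v u j i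
    using members_single[OF that] that by (intro kept_cliques_single[OF kept]) (auto simp: members_def)
  have m_on: "on (u, j, 2, 0)" if "u < nu" "j < n" for u j
    using single[of "(u, j, 2, 1)" u j 5] slot[of u j 2 1] that by (simp add: tau.simps)
  \<comment> \<open>The link vertex is on, so by parity the two copies are both on or both
    off.\<close>
  have step: "on (u, j, 0, 0) = on (u, sc (sc j), 0, 0)" if "u < nu" "j < n" for u j
    using triple[OF members_T2[OF that] distinct_T2] m_on[OF that] slot[of u j 0 2] slot[of u "sc (sc j)" 0 3] that
    by (auto simp: one_of_three_def)
  have "on (u, (2 * i) mod n, 0, 0) = on (u, 0, 0, 0)" if "u < nu" for u i
  proof (induction i)
    case (Suc i)
    have "sc j = Suc j mod n" if "j < n" for j
      using that by (auto simp: sc_def)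
    then have "sc (sc (2 * i mod n)) = (2 * Suc i) mod n"
      using n by (simp add: mod_Suc_eq)
    moreover have "2 * i mod n < n" using n by simp
    ultimately show ?case
      using step[OF that, of "2 * i mod n"] Suc by simp
  qed simp
  then have val: "on (u, j, 0, 0) = on (u, 0, 0, 0)" if "u < nu" "j < n" for u j
  proof (cases "even j")
    case True
    then have "(2 * (j div 2)) mod n = j" using that by simp
    then show ?thesis
      using \<open>\<And>u i. u < nu \<Longrightarrow> on (u, (2 * i) mod n, 0, 0) = on (u, 0, 0, 0)\<close>[OF that(1), of "j div 2"] by simp
  next
    case False
    \<comment> \<open>An odd position is reached by steps of length two after one turn around the
      ring.\<close>
    then have "even (j + n)" using n by simp
    then have "(2 * ((j + n) div 2)) mod n = j" using that by simp
    then show ?thesis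
      using \<open>\<And>u i. u < nu \<Longrightarrow> on (u, (2 * i) mod n, 0, 0) = on (u, 0, 0, 0)\<close>[OF that(1), of "(j + n) div 2"] by simp
  qed
  have val': "on (u, j, 0, s) = on (u, 0, 0, 0)" if "u < nu" "j < n" "s < 4" for u j s
    using slot[of u j 0 s] val[of u j] that by simp
  have "on (a j, 0, 0, 0) \<or> on (b j, 0, 0, 0)" if j: "j < n" "ty j = 1" for j
  proof (rule ccontr)
    assume off: "\<not> (on (a j, 0, 0, 0) \<or> on (b j, 0, 0, 0))"
    have ab: "a j < nu" "b j < nu" "a j \<noteq> b j" "\<not> xr (a j) j" "\<not> xr (b j) j"
      using ty_pos[of j] j by (auto simp: xr_def)
    have "on (a j, j, 1, 2)"
      using single[of "(a j, j, 1, 2)" "a j" j 2] j ab by (simp add: tau.simps)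
    then have on: "on (a j, j, 1, 0)"
      using slot[of "a j" j 1 2] j ab by simp
    have t: "tau (a j, j, 1, 0) = (a j, j, 0)" "tau (a j, j, 1, 1) = (b j, j, 0)"
      "tau (a j, j, 0, 0) = (a j, j, 0)" "tau (b j, j, 0, 0) = (b j, j, 0)"
      using j ab by (simp_all add: tau.simps)
    \<comment> \<open>If both variables were false, the shared link clique would be extended in its
      slots 0 and 1.\<close>
    have "(a j, j, 1, 0) = ((a j, j, 1, 1) :: vertex)"
    proof (rule sole)
      show "\<exists>w\<in>verts4. tau w = tau (a j, j, 1, 0) \<and> \<not> on w"
        using t off val[of "a j" j] ab j by (intro bexI[of _ "(a j, j, 0, 0)"]) auto
      show "\<exists>w\<in>verts4. tau w = tau (a j, j, 1, 1) \<and> \<not> on w"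
        using t off val[of "b j" j] ab j by (intro bexI[of _ "(b j, j, 0, 0)"]) auto
    qed (use on ab j in \<open>auto simp: bet_eq_iff\<close>)
    then show False by simp
  qed
  moreover have "on (a j, 0, 0, 0) \<and> on (b j, 0, 0, 0) \<and> on (c j, 0, 0, 0) \<or>
     one_of_three (on (a j, 0, 0, 0)) (on (b j, 0, 0, 0)) (on (c j, 0, 0, 0))" if j: "j < n" "ty j = 2" for j
  proof -
    have "2 \<le> ty j" "third j 0 = (c j, j, 0, 0)"
      using j by (simp_all add: third_def)
    then show ?thesis
      using triple[OF members_X0[of j] distinct_X(1)[of j]] val[of "a j" j] val[of "b j" j] val[of "c j" j]
        ty_pos[of j] ty_odd[of j] j by simp
  qed
  moreover have "on (a j, 0, 0, 0) \<noteq> on (b j, 0, 0, 0)" if j: "j < n" "ty j = 3" for j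
  proof -
    have V: "(a j, j, 1, 0) \<in> verts4"
      using ty_pos[of j] j by simp
    \<comment> \<open>A blue singleton is too small to be kept, and the parity of its triangle
      yields the inequality.\<close>
    then have "card {w \<in> verts4. bet w = bet (a j, j, 1, 0)} \<noteq> 4"
      using card_blue[OF V] j by simp
    then have "\<not> on (a j, j, 1, 0)"
      using kept V unfolding kept_cliques_def by meson
    moreover have "2 \<le> ty j" "third j 0 = (a j, j, 1, 0)"
      using j by (simp_all add: third_def)
    ultimately show ?thesis
      using triple[OF members_X0[of j] distinct_X(1)[of j]] val[of "a j" j] val[of "b j" j] ty_pos[of j] j
      by (auto simp: one_of_three_def)
  qed
  ultimately show ?thesis
    unfolding sat_def by blast
qed

context
  fixes val assumes sat: "sat val"
begin

definition on_val :: "vertex \<Rightarrow> bool" where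
  "on_val = (\<lambda>(u, j, k, s). if k = 0 then val u else \<not> (k = 1 \<and> off_clique u j))"

lemma on_val [simp]: "on_val (u, j, k, s) = (if k = 0 then val u else \<not> (k = 1 \<and> off_clique u j))"
  by (simp add: on_val_def)

lemma on_linker: "\<not> xr u j \<Longrightarrow> on_val (linker u j)"
  by (auto simp: linker_def xr_def)

lemma X_sat:
  assumes "j < n" "2 \<le> ty j"
  shows "val (a j) \<and> val (b j) \<and> on_val (third j s) \<or> one_of_three (val (a j)) (val (b j)) (on_val (third j s))"
proof -
  consider "ty j = 2" | "ty j = 3" | "ty j = 4"
    using assms(2) ty_le[of j] by linarith
  then show ?thesis
  proof cases
    case 1
    then show ?thesis
      using sat assms(1) by (auto simp: sat_def third_def)
  next
    case 2
    then have "val (a j) \<noteq> val (b j)"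
      using sat assms(1) by (auto simp: sat_def)
    then show ?thesis
      using 2 by (auto simp: third_def one_of_three_def)
  next
    case 3
    note * = ty_neq'[OF assms(1) 3]
    have "val (a (j - 2)) \<noteq> val (b (j - 2))"
      using sat assms(1) * unfolding sat_def by (meson less_imp_diff_less)
    then show ?thesis
      using 3 * by (auto simp: third_def one_of_three_def)
  qed
qed

lemma off_triple:
  assumes "v \<in> verts4" "\<not> on_val v"
  shows "\<exists>x y z. members (tau v) = {x, y, z} \<and> distinct [x, y, z] \<and> one_of_three (on_val x) (on_val y) (on_val z)"
proof -
  have triple: ?thesis if "members (tau v) = {x, y, z}" "distinct [x, y, z]"
    "on_val x \<and> on_val y \<and> on_val z \<or> one_of_three (on_val x) (on_val y) (on_val z)" for x y z
  proof -
    have "v \<in> {x, y, z}"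
      using members_self[OF assms(1)] that(1) by simp
    then have "\<not> (on_val x \<and> on_val y \<and> on_val z)"
      using assms(2) by auto
    then show ?thesis using that by blast
  qed
  from assms(1) show ?thesis
  proof (cases v rule: tau_cases)
    case (T2 u j)
    show ?thesis
      by (rule triple[of "(u, j, 0, 2)" "(u, sc (sc j), 0, 3)" "(u, j, 2, 0)"])
        (use T2 members_T2[of u j] in \<open>auto simp: one_of_three_def\<close>)
  next
    case (T1 u j)
    show ?thesis
      by (rule triple[of "(u, j, 0, 0)" "(u, sc j, 0, 1)" "linker u j"])
        (use T1 members_T1[of u j] distinct_T1[of j u] on_linker[of u j] in \<open>auto simp: one_of_three_def\<close>)
  next
    case (X0 j)
    show ?thesis
      by (rule triple[of "(a j, j, 0, 0)" "(b j, j, 0, 0)" "third j 0"])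
        (use X0 members_X0[of j] distinct_X[of j] X_sat[of j 0] in auto)
  next
    case (X1 j)
    show ?thesis
      by (rule triple[of "(a j, sc j, 0, 1)" "(b j, sc j, 0, 1)" "third j 1"])
        (use X1 members_X1[of j] distinct_X[of j] X_sat[of j 1] in auto)
  next
    case (single u j i)
    from assms(1) have False
      by (cases v rule: vertex_cases) (use single assms(2) in auto)
    then show ?thesis ..
  qed
qed

text \<open>The slots at which a kept clique can be extended. If a value clique is on, its own links
  contain no off vertex, so only constraints remain; a link clique is extended exactly at links of
  false variables.\<close>

lemma sole_slot:
  assumes v: "(u, j, k, s) \<in> verts4" "on_val (u, j, k, s)"
    and w: "w \<in> verts4" "tau w = tau (u, j, k, s)" "\<not> on_val w"
  shows "k = 0 \<and> s = 0 \<and> xr u j \<or> k = 0 \<and> s = 1 \<and> xr u (pr j) \<or> k = 1 \<and> s = 0 \<and> \<not> val u \<or>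
    k = 1 \<and> s = 1 \<and> ty j = 1 \<and> u = a j \<and> \<not> val (b j) \<or> k = 2 \<and> s = 0"
proof -
  have wm: "w \<in> members (tau (u, j, k, s))"
    using w by (simp add: members_def)
  have T1: "\<not> val u'" if "tau (u, j, k, s) = (u', j', 0)" "u' < nu" "j' < n" "\<not> xr u' j'" for u' j'
    using wm w(3) on_linker[OF that(4)] unfolding that(1) members_T1[OF that(2-4)] by auto
  have T2: "\<not> val u'" if "tau (u, j, k, s) = (u', j', 2)" "u' < nu" "j' < n" for u' j'
    using wm w(3) unfolding that(1) members_T2[OF that(2,3)] by auto
  have S: False if "tau (u, j, k, s) = (u', j', 4 + i)" for u' j' i
    using members_single[OF v(1) that] wm w(3) v(2) that by auto
  from v(1) show ?thesis
  proof (cases rule: vertex_cases)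
    case (q0 u1 j1)
    then show ?thesis using T1[of u1 j1] v(2) by auto
  next
    case (x0 u1 j1)
    then show ?thesis by auto
  next
    case (q1 u1 j1)
    then show ?thesis using T1[of u1 j1] v(2) by auto
  next
    case (x1 u1 j1)
    then show ?thesis by auto
  next
    case (q2 u1 j1)
    then show ?thesis using T2[of u1 j1] v(2) by auto
  next
    case (q3 u1 j1)
    then show ?thesis using T2[of u1 j1] v(2) by auto
  next
    case (off0 j1 s1)
    then show ?thesis using v(2) by auto
  next
    case (off1 j1 s1)
    then show ?thesis using v(2) ty_neq'[of j1] by auto
  next
    case (l0 u1 j1)
    then show ?thesis using T1[of u1 j1] by auto
  next
    case (l1 j1)
    moreover have "b j1 < nu" "\<not> xr (b j1) j1"
      using l1 ty_pos[of j1] by (auto simp: xr_def)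
    ultimately show ?thesis using T1[of "b j1" j1] by auto
  next
    case (free1 u1 j1 s1)
    then show ?thesis using S[of u1 j1 s1] by simp
  next
    case (m0 u1 j1)
    then show ?thesis by auto
  next
    case (free2 u1 j1 s1)
    then show ?thesis using S[of u1 j1 "4 + s1"] by simp
  qed
qed

lemma kept_of_sat: "kept_cliques verts4 bet tau on_val"
  unfolding kept_cliques_def
proof (intro conjI ballI impI)
  fix v w assume vw: "v \<in> verts4" "w \<in> verts4" "bet v = bet w"
  obtain u j k s where v: "v = (u, j, k, s)" by (cases v)
  obtain u' j' k' s' where w: "w = (u', j', k', s')" by (cases w)
  have "u' = u" "j' = j" "k' = k"
    using bet_eq_iff[of k k' u j s u' j' s'] vw unfolding v w by auto
  then show "on_val v = on_val w"
    unfolding v w by simp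
next
  fix v assume v: "v \<in> verts4" "on_val v"
  obtain u j k s where v': "v = (u, j, k, s)" by (cases v)
  show "card {w \<in> verts4. bet w = bet v} = 4"
    using v card_blue[of u j k s] unfolding v' by (auto split: if_splits)
next
  fix v assume v: "v \<in> verts4" "\<not> on_val v"
  obtain x y z where *: "members (tau v) = {x, y, z}" "distinct [x, y, z]" "one_of_three (on_val x) (on_val y) (on_val z)"
    using off_triple[OF v] by blast
  have "v \<in> {x, y, z}"
    using members_self[OF v(1)] *(1) by simp
  then show "\<exists>m w. {u \<in> verts4. tau u = tau v} = {v, m, w} \<and> v \<noteq> m \<and> v \<noteq> w \<and> m \<noteq> w \<and> on_val m \<and> \<not> on_val w"
    using triple_off[OF _ *(2) _ v(2) *(3)] *(1) unfolding members_def by blast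
next
  fix v v' assume vw: "v \<in> verts4" "v' \<in> verts4" and asm: "on_val v \<and> bet v = bet v' \<and>
    (\<exists>w\<in>verts4. tau w = tau v \<and> \<not> on_val w) \<and> (\<exists>w\<in>verts4. tau w = tau v' \<and> \<not> on_val w)"
  then obtain w w' where w: "w \<in> verts4" "tau w = tau v" "\<not> on_val w" and w': "w' \<in> verts4" "tau w' = tau v'" "\<not> on_val w'"
    by blast
  obtain u j k s where v: "v = (u, j, k, s)" by (cases v)
  obtain u1 j1 k1 s' where v1: "v' = (u1, j1, k1, s')" by (cases v')
  have *: "u1 = u" "j1 = j" "k1 = k"
    using bet_eq_iff[of k k1 u j s u1 j1 s'] vw asm unfolding v v1 by auto
  note v' = v1[unfolded *]
  have jn: "j < n" using vw v by simp
  have "on_val v'"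
    using conjunct1[OF asm] unfolding v v' by simp
  then have 2: "k = 0 \<and> s' = 0 \<and> xr u j \<or> k = 0 \<and> s' = 1 \<and> xr u (pr j) \<or> k = 1 \<and> s' = 0 \<and> \<not> val u \<or>
    k = 1 \<and> s' = 1 \<and> ty j = 1 \<and> u = a j \<and> \<not> val (b j) \<or> k = 2 \<and> s' = 0"
    using sole_slot[of u j k s' w'] vw(2) w' unfolding v' by satx
  have 1: "k = 0 \<and> s = 0 \<and> xr u j \<or> k = 0 \<and> s = 1 \<and> xr u (pr j) \<or> k = 1 \<and> s = 0 \<and> \<not> val u \<or>
    k = 1 \<and> s = 1 \<and> ty j = 1 \<and> u = a j \<and> \<not> val (b j) \<or> k = 2 \<and> s = 0"
    using sole_slot[of u j k s w] vw(1) conjunct1[OF asm] w unfolding v by satx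
  \<comment> \<open>Two different extended slots would mean adjacent constraints, for a value
    clique, or a violated disjunction, for a link clique.\<close>
  have "\<not> (xr u j \<and> xr u (pr j))"
    using xr_pr[OF jn] by blast
  moreover have "\<not> (\<not> val u \<and> ty j = 1 \<and> u = a j \<and> \<not> val (b j))"
    using sat jn unfolding sat_def by blast
  ultimately have "s = s'" using 1 2 by auto
  then show "v = v'" by (simp add: v v')
qed

end

theorem kept_iff_sat: "(\<exists>on. kept_cliques verts4 bet tau on) \<longleftrightarrow> (\<exists>val. sat val)"
  using sat_of_kept kept_of_sat by blast

lemma card_value_class: "u < nu \<Longrightarrow> j < n \<Longrightarrow> s < 4 \<Longrightarrow> card (members (tau (u, j, 0, s))) = 3"
proof -
  assume v: "u < nu" "j < n" "s < 4"
  then have V: "(u, j, 0, s) \<in> verts4" by simp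
  then show ?thesis
  proof (cases "(u, j, 0::nat, s)" rule: tau_cases)
    case (T2 u j)
    then show ?thesis by (simp add: members_T2)
  next
    case (T1 u j)
    then show ?thesis
      using distinct_T1[of j u] by (simp add: members_T1)
  next
    case (X0 j)
    then show ?thesis
      using distinct_X[of j] by (simp add: members_X0)
  next
    case (X1 j)
    then show ?thesis
      using distinct_X[of j] members_X1[of j] by simp
  next
    case (single u' j' i)
    from V have False
      by (cases rule: vertex_cases) (use single in auto)
    then show ?thesis ..
  qed
qed

lemma card_verts4: "card verts4 = 12 * (nu * n)"
  by (simp add: verts4_def)

text \<open>This justifies the subtraction in the budget. Each variable and position has 12
  vertices, so degree sum 36 is needed there; the value clique contributes at least 20, kind 1 at
  least 8 (a singleton still has two red edges) and kind 2 at least 12.\<close>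

lemma many_edges: "3 * card verts4 \<le> 2 * card (edges (label_graph verts4 bet tau))"
proof -
  interpret labelled verts4 bet tau by (rule labelled_gadget)
  have "3 * card verts4 = (\<Sum>u<nu. \<Sum>j<n. 36)"
    by (simp add: card_verts4)
  also have "\<dots> \<le> (\<Sum>u<nu. \<Sum>j<n. \<Sum>k<3. \<Sum>s<4. vertex_degree G (u, j, k, s))"
  proof (intro sum_mono)
    fix u j assume "u \<in> {..<nu}" "j \<in> {..<n}"
    then have uj: "u < nu" "j < n" by auto
    have "5 \<le> vertex_degree G (u, j, 0, s)" "2 \<le> vertex_degree G (u, j, 1, s)" "3 \<le> vertex_degree G (u, j, 2, s)"
      if s: "s < 4" for s
    proof -
      show "5 \<le> vertex_degree G (u, j, 0, s)"
        using uj s vertex_degree_G[of "(u, j, 0, s)"] card_blue[of u j 0 s] card_value_class[of u j s]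
        by (simp add: red_class)
      show "3 \<le> vertex_degree G (u, j, 2, s)"
        using uj s vertex_degree_G[of "(u, j, 2, s)"] card_blue[of u j 2 s] by simp
      have V: "(u, j, 1, s) \<in> verts4" using uj s by simp
      show "2 \<le> vertex_degree G (u, j, 1, s)"
      proof (cases "off_clique u j")
        case True
        have "card (members (tau (u, j, 1, s))) = 3"
          using V
        proof (cases "(u, j, 1::nat, s)" rule: tau_cases)
          case (T2 u1 j1)
          then show ?thesis by (simp add: members_T2)
        next
          case (T1 u1 j1)
          then show ?thesis using distinct_T1[of j1 u1] by (simp add: members_T1)
        next
          case (X0 j1)
          then show ?thesis using distinct_X[of j1] by (simp add: members_X0)
        next
          case (X1 j1)
          then show ?thesis using distinct_X[of j1] members_X1[of j1] by simp
        next
          case (single u' j' i)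
          from V have False
            by (cases rule: vertex_cases) (use single True in auto)
          then show ?thesis ..
        qed
        then show ?thesis
          using vertex_degree_G[OF V] by (simp add: red_class)
      next
        case False
        then have "card {w \<in> verts4. bet w = bet (u, j, 1, s)} = 4"
          using card_blue[OF V] by (simp only: refl simp_thms if_False)
        then show ?thesis
          using vertex_degree_G[OF V] by simp
      qed
    qed
    note this[of 0] this[of 1] this[of 2] this[of 3]
    moreover have "(\<Sum>k<3. f k) = f 0 + f 1 + f 2" "(\<Sum>s<4. f s) = f 0 + f 1 + f 2 + f 3" for f :: "nat \<Rightarrow> nat"
      by (simp_all add: eval_nat_numeral)
    ultimately show "36 \<le> (\<Sum>k<3. \<Sum>s<4. vertex_degree G (u, j, k, s))"
      by simp
  qed
  also have "\<dots> = (\<Sum>v\<in>verts4. vertex_degree G v)"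
    by (simp only: verts4_def sum.cartesian_product')
  finally show ?thesis
    by (simp add: sum_degrees)
qed

end

section \<open>Renaming of vertices\<close>

lemma bij_betw_Collect:
  assumes "bij_betw d V V'"
  shows "bij_betw d {w \<in> V. P (d w)} {w \<in> V'. P w}"
  using assms by (auto simp: bij_betw_def inj_on_def)

lemma labelled_vimage:
  assumes d: "bij_betw d V V'" and lab: "labelled V' \<beta> \<tau>"
  shows "labelled V (\<lambda>v. \<beta> (d v)) (\<lambda>v. \<tau> (d v))"
proof -
  interpret labelled V' \<beta> \<tau> by (rule lab)
  have dV: "d v \<in> V'" if "v \<in> V" for v using d that by (auto simp: bij_betw_def)
  have inj: "v = w" if "v \<in> V" "w \<in> V" "d v = d w" for v w
    using d that by (auto simp: bij_betw_def inj_on_def)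
  show ?thesis
  proof
    show "finite V" using d fin bij_betw_finite by blast
    show "card {w \<in> V. \<beta> (d w) = \<beta> (d v)} \<in> {1, 4}" if "v \<in> V" for v
      using bij_betw_same_card[OF bij_betw_Collect[OF d, of "\<lambda>w. \<beta> w = \<beta> (d v)"]] blue_card[OF dV[OF that]] by simp
    show "card {w \<in> V. \<tau> (d w) = \<tau> (d v)} \<in> {1, 3}" if "v \<in> V" for v
      using bij_betw_same_card[OF bij_betw_Collect[OF d, of "\<lambda>w. \<tau> w = \<tau> (d v)"]] red_card[OF dV[OF that]] by simp
    show "v = w" if "v \<in> V" "w \<in> V" "\<beta> (d v) = \<beta> (d w)" "\<tau> (d v) = \<tau> (d w)" for v w
      using linear[of "d v" "d w"] dV inj that by blast
    show "v = w \<or> w = x" if "v \<in> V" "w \<in> V" "x \<in> V" "y \<in> V" "\<beta> (d v) = \<beta> (d w)" "\<tau> (d w) = \<tau> (d x)"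
      "\<beta> (d x) = \<beta> (d y)" "\<tau> (d y) = \<tau> (d v)" for v w x y
      using no_C4[of "d v" "d w" "d x" "d y"] dV inj that by blast
  qed
qed

lemma kept_cliques_vimage:
  assumes d: "bij_betw d V V'"
  shows "kept_cliques V (\<lambda>v. \<beta> (d v)) (\<lambda>v. \<tau> (d v)) (\<lambda>v. on (d v)) \<longleftrightarrow> kept_cliques V' \<beta> \<tau> on"
proof -
  have V': "V' = d ` V" and inj: "inj_on d V" using d by (auto simp: bij_betw_def)
  have card: "card {w \<in> V. \<beta> (d w) = l} = card {w \<in> d ` V. \<beta> w = l}" for l
    using bij_betw_same_card[OF bij_betw_Collect[OF d, of "\<lambda>w. \<beta> w = l"]] V' by simp
  have tri: "(\<exists>m w. {u \<in> V. \<tau> (d u) = l} = {v, m, w} \<and> v \<noteq> m \<and> v \<noteq> w \<and> m \<noteq> w \<and> on (d m) \<and> \<not> on (d w)) \<longleftrightarrow>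
    (\<exists>m w. {u \<in> d ` V. \<tau> u = l} = {d v, m, w} \<and> d v \<noteq> m \<and> d v \<noteq> w \<and> m \<noteq> w \<and> on m \<and> \<not> on w)"
    (is "?L \<longleftrightarrow> ?R") if v: "v \<in> V" for l v
  proof -
    have im: "{u \<in> d ` V. \<tau> u = l} = d ` {u \<in> V. \<tau> (d u) = l}" by auto
    show ?thesis
    proof
      assume ?L
      then obtain m w where *: "{u \<in> V. \<tau> (d u) = l} = {v, m, w}" "v \<noteq> m" "v \<noteq> w" "m \<noteq> w" "on (d m)" "\<not> on (d w)"
        by blast
      then have "m \<in> V" "w \<in> V" by blast+
      then have "d v \<noteq> d m" "d v \<noteq> d w" "d m \<noteq> d w"
        using inj v * by (auto simp: inj_on_def)
      then show ?R
        unfolding im *(1) using * by (intro exI[of _ "d m"] exI[of _ "d w"]) simp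
    next
      assume ?R
      then obtain m' w' where *: "{u \<in> d ` V. \<tau> u = l} = {d v, m', w'}" "d v \<noteq> m'" "d v \<noteq> w'" "m' \<noteq> w'" "on m'" "\<not> on w'"
        by blast
      then have "m' \<in> d ` V" "w' \<in> d ` V" by blast+
      then obtain m w where mw: "m' = d m" "m \<in> V" "w' = d w" "w \<in> V" by blast
      have "d ` {u \<in> V. \<tau> (d u) = l} = d ` {v, m, w}"
        using *(1) mw unfolding im by simp
      then have "{u \<in> V. \<tau> (d u) = l} = {v, m, w}"
        using inj_on_image_eq_iff[OF inj, of "{u \<in> V. \<tau> (d u) = l}" "{v, m, w}"] v mw by auto
      then show ?L
        using * mw by (intro exI[of _ m] exI[of _ w]) auto
    qed
  qed
  have sole: "(\<forall>v\<in>V. \<forall>v'\<in>V. on (d v) \<and> \<beta> (d v) = \<beta> (d v') \<and> (\<exists>w\<in>V. \<tau> (d w) = \<tau> (d v) \<and> \<not> on (d w)) \<and>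
        (\<exists>w\<in>V. \<tau> (d w) = \<tau> (d v') \<and> \<not> on (d w)) \<longrightarrow> v = v') \<longleftrightarrow>
     (\<forall>v\<in>d ` V. \<forall>v'\<in>d ` V. on v \<and> \<beta> v = \<beta> v' \<and> (\<exists>w\<in>d ` V. \<tau> w = \<tau> v \<and> \<not> on w) \<and>
        (\<exists>w\<in>d ` V. \<tau> w = \<tau> v' \<and> \<not> on w) \<longrightarrow> v = v')"
    using inj by (simp add: inj_on_eq_iff)
  show ?thesis
    unfolding kept_cliques_def V' sole by (simp add: card tri cong: ball_cong)
qed

lemma kept_cliques_cong:
  assumes "\<And>v. v \<in> V \<Longrightarrow> on v = on' v"
  shows "kept_cliques V \<beta> \<tau> on \<Longrightarrow> kept_cliques V \<beta> \<tau> on'"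
proof -
  assume k: "kept_cliques V \<beta> \<tau> on"
  have tri: "\<exists>m w. {u \<in> V. \<tau> u = \<tau> v} = {v, m, w} \<and> v \<noteq> m \<and> v \<noteq> w \<and> m \<noteq> w \<and> on' m \<and> \<not> on' w"
    if v: "v \<in> V" "\<not> on' v" for v
  proof -
    have "\<forall>v\<in>V. \<not> on v \<longrightarrow>
      (\<exists>m w. {u \<in> V. \<tau> u = \<tau> v} = {v, m, w} \<and> v \<noteq> m \<and> v \<noteq> w \<and> m \<noteq> w \<and> on m \<and> \<not> on w)"
      using k unfolding kept_cliques_def by argo
    then obtain m w where *: "{u \<in> V. \<tau> u = \<tau> v} = {v, m, w}" "v \<noteq> m" "v \<noteq> w" "m \<noteq> w" "on m" "\<not> on w"
      using v assms by metis
    then have "m \<in> V" "w \<in> V" by blast+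
    then show ?thesis using * assms by metis
  qed
  show ?thesis
    unfolding kept_cliques_def
  proof (intro conjI ballI impI)
    fix v w assume "v \<in> V" "w \<in> V" "\<beta> v = \<beta> w"
    then show "on' v = on' w"
      using k assms unfolding kept_cliques_def by metis
  next
    fix v assume "v \<in> V" "on' v"
    then show "card {w \<in> V. \<beta> w = \<beta> v} = 4"
      using k assms unfolding kept_cliques_def by metis
  next
    fix v v' assume v: "v \<in> V" "v' \<in> V" and *: "on' v \<and> \<beta> v = \<beta> v' \<and> (\<exists>w\<in>V. \<tau> w = \<tau> v \<and> \<not> on' w) \<and>
        (\<exists>w\<in>V. \<tau> w = \<tau> v' \<and> \<not> on' w)"
    have "on v \<and> \<beta> v = \<beta> v' \<and> (\<exists>w\<in>V. \<tau> w = \<tau> v \<and> \<not> on w) \<and> (\<exists>w\<in>V. \<tau> w = \<tau> v' \<and> \<not> on w)"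
      using * v assms by metis
    then show "v = v'"
      using k v unfolding kept_cliques_def by meson
  qed (use tri in blast)
qed

lemma ex_kept_cliques_vimage:
  assumes d: "bij_betw d V V'"
  shows "(\<exists>on. kept_cliques V (\<lambda>v. \<beta> (d v)) (\<lambda>v. \<tau> (d v)) on) \<longleftrightarrow> (\<exists>on. kept_cliques V' \<beta> \<tau> on)"
proof
  assume "\<exists>on. kept_cliques V (\<lambda>v. \<beta> (d v)) (\<lambda>v. \<tau> (d v)) on"
  then obtain on where on: "kept_cliques V (\<lambda>v. \<beta> (d v)) (\<lambda>v. \<tau> (d v)) on" ..
  let ?on = "\<lambda>w. on (inv_into V d w)"
  have "kept_cliques V (\<lambda>v. \<beta> (d v)) (\<lambda>v. \<tau> (d v)) (\<lambda>v. ?on (d v))"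
    by (rule kept_cliques_cong[OF _ on]) (use d in \<open>simp add: bij_betw_def\<close>)
  then have "kept_cliques V' \<beta> \<tau> ?on"
    by (simp only: kept_cliques_vimage[OF d, of \<beta> \<tau> ?on])
  then show "\<exists>on. kept_cliques V' \<beta> \<tau> on"
    by (rule exI[of _ ?on])
next
  assume "\<exists>on. kept_cliques V' \<beta> \<tau> on"
  then obtain on where "kept_cliques V' \<beta> \<tau> on" ..
  then have "kept_cliques V (\<lambda>v. \<beta> (d v)) (\<lambda>v. \<tau> (d v)) (\<lambda>v. on (d v))"
    by (simp only: kept_cliques_vimage[OF d])
  then show "\<exists>on. kept_cliques V (\<lambda>v. \<beta> (d v)) (\<lambda>v. \<tau> (d v)) on"
    by (rule exI[of _ "\<lambda>v. on (d v)"])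
qed

text \<open>This form of the edge count can be evaluated by bounded sums. The double sum runs over
  ordered pairs and counts each vertex twice with itself, whence the term
  \<open>2 * card V\<close>.\<close>

lemma (in labelled) card_edges:
  "2 * card (edges G) = (\<Sum>v\<in>V. \<Sum>w\<in>V. of_bool (\<beta> w = \<beta> v) + of_bool (\<tau> w = \<tau> v)) - 2 * card V"
proof -
  let ?b = "\<lambda>v. card {w \<in> V. \<beta> w = \<beta> v}" and ?r = "\<lambda>v. card {w \<in> V. \<tau> w = \<tau> v}"
  have pos: "1 \<le> ?b v" "1 \<le> ?r v" if "v \<in> V" for v
    using blue_card[OF that] red_card[OF that] by auto
  have "2 * card (edges G) + 2 * card V = (\<Sum>v\<in>V. vertex_degree G v + 2)"
    by (simp only: sum.distrib sum_degrees sum_constant) simp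
  also have "\<dots> = (\<Sum>v\<in>V. ?b v + ?r v)"
  proof (rule sum.cong[OF refl])
    fix v assume "v \<in> V"
    then show "vertex_degree G v + 2 = ?b v + ?r v"
      using pos[of v] by (simp add: vertex_degree_G)
  qed
  also have "\<dots> = (\<Sum>v\<in>V. \<Sum>w\<in>V. of_bool (\<beta> w = \<beta> v) + of_bool (\<tau> w = \<tau> v))"
    by (simp only: card_eq_sum_of_bool[OF fin] sum.distrib)
  finally show ?thesis by simp
qed

section \<open>Satisfiability\<close>

text \<open>The literals \<open>2 * v\<close> and \<open>2 * v + 1\<close> are the variable \<open>v\<close> and its negation; clause \<open>i\<close> consists of the literals
  \<open>lit (3 * i)\<close>, \<open>lit (3 * i + 1)\<close>, \<open>lit (3 * i + 2)\<close>.\<close>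

definition holds :: "(nat \<Rightarrow> bool) \<Rightarrow> nat \<Rightarrow> bool" where
  "holds \<alpha> l \<longleftrightarrow> \<alpha> (l div 2) = even l"

definition cnf_sat :: "nat \<Rightarrow> (nat \<Rightarrow> nat) \<Rightarrow> bool" where
  "cnf_sat m lit \<longleftrightarrow> (\<exists>\<alpha>. \<forall>i<m. \<exists>e<3. holds \<alpha> (lit (3 * i + e)))"

text \<open>
  For every literal occurrence \<open>s\<close> a new variable \<open>nv + s\<close> states that the occurrence is chosen as a witness
  for its clause. Constraint \<open>i\<close> sits at position \<open>4 * i\<close>: complementarity of the literals of all variables,
  chosen occurrences are true, and an odd number of occurrences is chosen in each clause.
\<close>

context
  fixes nv m :: nat and lit :: "nat \<Rightarrow> nat"
begin

definition nvar :: nat where "nvar = nv + 3 * m"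
definition ncon :: nat where "ncon = nvar + 4 * m"
text \<open>Four positions per constraint make room for the second half of an inequality at offset 2
  and keep constraints apart. The additional position is free of constraints and makes the ring
  odd.\<close>

definition npos :: nat where "npos = 4 * ncon + 1"

definition nvert :: nat where "nvert = 12 * (2 * nvar * npos)"

definition con_ty :: "nat \<Rightarrow> nat" where
  "con_ty j = (if ncon \<le> j div 4 then 0
     else if j mod 4 = 0 then (if j div 4 < nvar then 3 else if j div 4 < nvar + 3 * m then 1 else 2)
     else if j mod 4 = 2 \<and> j div 4 < nvar then 4 else 0)"

definition con_a :: "nat \<Rightarrow> nat" where
  "con_a j = (let i = j div 4 in if i < nvar then 2 * i
     else if i < nvar + 3 * m then 2 * (nv + (i - nvar)) + 1 else 2 * (nv + 3 * (i - nvar - 3 * m)))"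

definition con_b :: "nat \<Rightarrow> nat" where
  "con_b j = (let i = j div 4 in if i < nvar then 2 * i + 1
     else if i < nvar + 3 * m then lit (i - nvar) else 2 * (nv + 3 * (i - nvar - 3 * m) + 1))"

definition con_c :: "nat \<Rightarrow> nat" where
  "con_c j = 2 * (nv + 3 * (j div 4 - nvar - 3 * m) + 2)"

lemma gadget_cnf:
  assumes m: "0 < m" and lit: "\<And>s. s < 3 * m \<Longrightarrow> lit s < 2 * nv"
  shows "gadget (2 * nvar) npos con_ty con_a con_b con_c"
proof
  show "5 \<le> npos" "odd npos" using m by (auto simp: npos_def ncon_def)
  show "con_ty j \<le> 4" for j by (auto simp: con_ty_def)
next
  fix j assume j: "j < npos" "con_ty j \<noteq> 0"
  then have i: "j div 4 < ncon" "j mod 4 = 0 \<or> j mod 4 = 2 \<and> j div 4 < nvar"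
    by (auto simp: con_ty_def split: if_splits)
  have j4: "j = 4 * (j div 4) + j mod 4" by simp
  have "even j"
    by (subst j4, subst even_add) (use i(2) in auto)
  moreover have "Suc j < npos"
    unfolding npos_def using i j4 by linarith
  moreover have "con_a j < 2 * nvar \<and> con_b j < 2 * nvar \<and> con_a j \<noteq> con_b j"
  proof -
    consider "j div 4 < nvar" | "nvar \<le> j div 4" "j div 4 - nvar < 3 * m" | "nvar + 3 * m \<le> j div 4" "j div 4 - nvar - 3 * m < m"
      using i(1) unfolding ncon_def by linarith
    then show ?thesis
    proof cases
      \<comment> \<open>The literal of the selection variable is larger than all literals of the
        formula, so the two sides differ.\<close>
      case 2
      then show ?thesis
        using lit[of "j div 4 - nvar"] by (auto simp: con_a_def con_b_def Let_def nvar_def)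
    qed (auto simp: con_a_def con_b_def Let_def nvar_def)
  qed
  ultimately show "even j \<and> Suc j < npos \<and> con_a j < 2 * nvar \<and> con_b j < 2 * nvar \<and> con_a j \<noteq> con_b j"
    by blast
next
  fix j assume j: "j < npos" "con_ty j = 2"
  then have "nvar + 3 * m \<le> j div 4" "j div 4 - nvar - 3 * m < m"
    by (auto simp: con_ty_def ncon_def split: if_splits)
  then show "con_c j < 2 * nvar \<and> con_c j \<noteq> con_a j \<and> con_c j \<noteq> con_b j"
    by (auto simp: con_a_def con_b_def con_c_def Let_def nvar_def)
next
  fix j assume j: "j < npos" "con_ty j = 3"
  then have "j mod 4 = 0" "j div 4 < nvar" "j div 4 < ncon"
    by (auto simp: con_ty_def split: if_splits)
  moreover from this obtain i where "j = 4 * i" by auto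
  moreover have "(4 * k + 2) mod 4 = 2" for k :: nat by presburger
  ultimately have "(j + 2) div 4 = j div 4" "(j + 2) mod 4 = 2" "j + 2 < npos"
    by (simp_all add: npos_def)
  moreover note \<open>j mod 4 = 0\<close> \<open>j div 4 < nvar\<close> \<open>j div 4 < ncon\<close>
  ultimately show "j + 2 < npos \<and> con_ty (j + 2) = 4 \<and> con_a (j + 2) = con_a j \<and> con_b (j + 2) = con_b j"
    by (simp add: con_ty_def con_a_def con_b_def)
next
  fix j assume j: "j < npos" "con_ty j = 4"
  then have "j mod 4 = 2" "j div 4 < nvar" "j div 4 < ncon"
    by (auto simp: con_ty_def split: if_splits)
  moreover have "j = 4 * (j div 4) + 2"
    using \<open>j mod 4 = 2\<close> mult_div_mod_eq[of 4 j] by simp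
  then obtain i where "j = 4 * i + 2" by blast
  then have "(j - 2) div 4 = j div 4" "(j - 2) mod 4 = 0" "2 \<le> j"
    by simp_all
  ultimately show "2 \<le> j \<and> con_ty (j - 2) = 3 \<and> con_a (j - 2) = con_a j \<and> con_b (j - 2) = con_b j"
    by (simp add: con_ty_def con_a_def con_b_def)
qed

lemma con_eqs:
  "v < nvar \<Longrightarrow> 4 * v < npos \<and> con_ty (4 * v) = 3 \<and> con_a (4 * v) = 2 * v \<and> con_b (4 * v) = 2 * v + 1"
  "s < 3 * m \<Longrightarrow> 4 * (nvar + s) < npos \<and> con_ty (4 * (nvar + s)) = 1 \<and>
     con_a (4 * (nvar + s)) = 2 * (nv + s) + 1 \<and> con_b (4 * (nvar + s)) = lit s"
  "i < m \<Longrightarrow> 4 * (nvar + 3 * m + i) < npos \<and> con_ty (4 * (nvar + 3 * m + i)) = 2 \<and>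
     con_a (4 * (nvar + 3 * m + i)) = 2 * (nv + 3 * i) \<and> con_b (4 * (nvar + 3 * m + i)) = 2 * (nv + 3 * i + 1) \<and>
     con_c (4 * (nvar + 3 * m + i)) = 2 * (nv + 3 * i + 2)"
  by (auto simp: con_ty_def con_a_def con_b_def con_c_def npos_def ncon_def Let_def)

text \<open>An odd number of chosen occurrences is at least one, which gives a true literal in each
  clause; conversely, choosing exactly one true occurrence per clause satisfies the parity.\<close>

lemma sat_cnf:
  assumes m: "0 < m" and lit: "\<And>s. s < 3 * m \<Longrightarrow> lit s < 2 * nv"
  shows "(\<exists>val. gadget.sat npos con_ty con_a con_b con_c val) \<longleftrightarrow> cnf_sat m lit"
proof -
  interpret gadget "2 * nvar" npos con_ty con_a con_b con_c
    by (rule gadget_cnf[OF m lit])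
  show ?thesis
  proof
    assume "\<exists>val. sat val"
    then obtain val where val: "sat val" by blast
    have neq: "val (2 * v) \<noteq> val (2 * v + 1)" if "v < nvar" for v
      using val con_eqs(1)[OF that] unfolding sat_def by metis
    have le: "val (2 * (nv + s) + 1) \<or> val (lit s)" if "s < 3 * m" for s
      using val con_eqs(2)[OF that] unfolding sat_def by metis
    have odd: "val (2 * (nv + 3 * i)) \<or> val (2 * (nv + 3 * i + 1)) \<or> val (2 * (nv + 3 * i + 2))" if "i < m" for i
      using val con_eqs(3)[OF that] unfolding sat_def one_of_three_def by metis
    have holds: "holds (\<lambda>v. val (2 * v)) l \<longleftrightarrow> val l" if "l < 2 * nv" for l
    proof (cases "even l")
      case True
      then show ?thesis by (simp add: holds_def)
    next
      case False
      then have "l = 2 * (l div 2) + 1" "l div 2 < nvar"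
        using that by (auto simp: nvar_def)
      then show ?thesis
        using neq[of "l div 2"] False by (simp add: holds_def)
    qed
    have "\<exists>e<3. holds (\<lambda>v. val (2 * v)) (lit (3 * i + e))" if i: "i < m" for i
    proof -
      from odd[OF i] have "\<exists>e<3. val (2 * (nv + (3 * i + e)))"
      proof (elim disjE)
        assume "val (2 * (nv + 3 * i))"
        then show ?thesis by (intro exI[of _ 0]) simp
      next
        assume "val (2 * (nv + 3 * i + 1))"
        then show ?thesis by (intro exI[of _ 1]) simp
      next
        assume "val (2 * (nv + 3 * i + 2))"
        then show ?thesis by (intro exI[of _ 2]) simp
      qed
      then obtain e where e: "e < 3" "val (2 * (nv + (3 * i + e)))" by blast
      have s: "3 * i + e < 3 * m" "nv + (3 * i + e) < nvar" using i e by (auto simp: nvar_def)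
      have "\<not> val (2 * (nv + (3 * i + e)) + 1)"
        using neq[OF s(2)] e by simp
      then have "val (lit (3 * i + e))"
        using le[OF s(1)] by blast
      then show ?thesis
        using holds[OF lit[OF s(1)]] e by blast
    qed
    then show "cnf_sat m lit"
      unfolding cnf_sat_def by blast
  next
    assume "cnf_sat m lit"
    then obtain \<alpha> where "\<forall>i<m. \<exists>e<3. holds \<alpha> (lit (3 * i + e))"
      unfolding cnf_sat_def by blast
    then obtain sel where sel: "\<And>i. i < m \<Longrightarrow> sel i < 3 \<and> holds \<alpha> (lit (3 * i + sel i))"
      by metis
    \<comment> \<open>The variable \<open>nv + s\<close> is true if occurrence \<open>s\<close> is
      the one selected in its clause \<open>s div 3\<close>.\<close>
    define val where "val l \<longleftrightarrow>
      holds (\<lambda>v. if v < nv then \<alpha> v else sel ((v - nv) div 3) = (v - nv) mod 3) l" for l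
    have "sat val"
      unfolding sat_def
    proof (intro allI impI conjI)
      fix j assume j: "j < npos"
      {
        assume "con_ty j = 3"
        then have "j div 4 < nvar" by (auto simp: con_ty_def split: if_splits)
        then show "val (con_a j) \<noteq> val (con_b j)"
          by (simp add: con_a_def con_b_def val_def holds_def)
      next
        assume "con_ty j = 1"
        then have i: "\<not> j div 4 < nvar" "j div 4 - nvar < 3 * m"
          by (auto simp: con_ty_def split: if_splits)
        define s where "s = j div 4 - nvar"
        have s: "s < 3 * m" "con_a j = 2 * (nv + s) + 1" "con_b j = lit s"
          using i by (auto simp: s_def con_a_def con_b_def Let_def)
        have "val (lit s)" if "\<not> val (2 * (nv + s) + 1)"
        proof -
          have "sel (s div 3) = s mod 3"
            using that by (simp add: val_def holds_def)
          moreover have "s div 3 < m" using s by auto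
          ultimately have "holds \<alpha> (lit s)"
            using sel[of "s div 3"] by simp
          moreover have "lit s div 2 < nv" using lit[OF s(1)] by auto
          ultimately show ?thesis
            by (simp add: val_def holds_def)
        qed
        then show "val (con_a j) \<or> val (con_b j)"
          using s by auto
      next
        assume "con_ty j = 2"
        then have i: "\<not> j div 4 < nvar + 3 * m" "j div 4 - nvar - 3 * m < m"
          by (auto simp: con_ty_def ncon_def split: if_splits)
        define i where "i = j div 4 - nvar - 3 * m"
        have abc: "con_a j = 2 * (nv + (3 * i + 0))" "con_b j = 2 * (nv + (3 * i + 1))" "con_c j = 2 * (nv + (3 * i + 2))"
          using i by (auto simp: i_def con_a_def con_b_def con_c_def Let_def)
        have val_e: "val (2 * (nv + (3 * i + e))) \<longleftrightarrow> sel i = e" if "e < 3" for e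
          using that by (simp add: val_def holds_def)
        have "val (con_a j) \<longleftrightarrow> sel i = 0" "val (con_b j) \<longleftrightarrow> sel i = 1" "val (con_c j) \<longleftrightarrow> sel i = 2"
          unfolding abc by (rule val_e, simp)+
        moreover have "sel i = 0 \<or> sel i = 1 \<or> sel i = 2"
          using sel[of i] i by (auto simp: i_def)
        ultimately have "one_of_three (val (con_a j)) (val (con_b j)) (val (con_c j))"
          by (auto simp: one_of_three_def)
        then show "val (con_a j) \<and> val (con_b j) \<and> val (con_c j) \<or>
          one_of_three (val (con_a j)) (val (con_b j)) (val (con_c j))" ..
      }
    qed
    then show "\<exists>val. sat val" by blast
  qed
qed

end

section \<open>The reduction is computable\<close>

definition decode :: "nat \<Rightarrow> nat \<Rightarrow> vertex" where
  "decode n x = (x div 12 div n, x div 12 mod n, x div 4 mod 3, x mod 4)"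

lemma bij_betw_decode:
  assumes "0 < n"
  shows "bij_betw (decode n) {..<12 * (nu * n)} ({..<nu} \<times> {..<n} \<times> {..<3} \<times> {..<4})"
proof (rule bij_betw_byWitness[where f' = "\<lambda>(u, j, k, s). 12 * (u * n + j) + (4 * k + s)"])
  show "\<forall>x\<in>{..<12 * (nu * n)}. (\<lambda>(u, j, k, s). 12 * (u * n + j) + (4 * k + s)) (decode n x) = x"
  proof
    fix x
    have "x div 12 div n * n + x div 12 mod n = x div 12" by simp
    moreover have "4 * (x div 4 mod 3) + x mod 4 = x mod 12"
      using mod_mult2_eq[of x 4 3] by simp
    ultimately show "(\<lambda>(u, j, k, s). 12 * (u * n + j) + (4 * k + s)) (decode n x) = x"
      by (simp only: decode_def prod.case mult_div_mod_eq)
  qed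
  show "\<forall>v\<in>{..<nu} \<times> {..<n} \<times> {..<3} \<times> {..<4}. decode n (case v of (u, j, k, s) \<Rightarrow> 12 * (u * n + j) + (4 * k + s)) = v"
  proof (rule ballI)
    fix v :: vertex assume "v \<in> {..<nu} \<times> {..<n} \<times> {..<3} \<times> {..<4}"
    then obtain u j k s where v: "v = (u, j, k, s)" and "u < nu" "j < n" and ks: "k < 3" "s < 4"
      by auto
    have "(12 * (u * n + j) + (4 * k + s)) div 12 = u * n + j" using ks by simp
    moreover have "(12 * (u * n + j) + (4 * k + s)) div 4 = 3 * (u * n + j) + k"
      using ks by simp
    moreover have "(12 * (u * n + j) + (4 * k + s)) mod 4 = s" using ks by presburger
    moreover have "(3 * (u * n + j) + k) mod 3 = k" using ks by (simp only: mod_mult_self4 mod_less)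
    ultimately have "decode n (12 * (u * n + j) + (4 * k + s)) = (u, j, k, s)"
      using \<open>j < n\<close> unfolding decode_def by simp
    then show "decode n (case v of (u, j, k, s) \<Rightarrow> 12 * (u * n + j) + (4 * k + s)) = v"
      by (simp only: v prod.case)
  qed
  show "decode n ` {..<12 * (nu * n)} \<subseteq> {..<nu} \<times> {..<n} \<times> {..<3} \<times> {..<4}"
    using assms by (auto simp: decode_def less_mult_imp_div_less mult.commute)
  show "(\<lambda>(u, j, k, s). 12 * (u * n + j) + (4 * k + s)) ` ({..<nu} \<times> {..<n} \<times> {..<3} \<times> {..<4}) \<subseteq> {..<12 * (nu * n)}"
  proof (rule subsetI)
    fix x assume "x \<in> (\<lambda>(u, j, k, s). 12 * (u * n + j) + (4 * k + s)) ` ({..<nu} \<times> {..<n} \<times> {..<3} \<times> {..<4})"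
    then obtain u j k s where x: "x = 12 * (u * n + j) + (4 * k + s)" and *: "u < nu" "j < n" "k < 3" "s < 4"
      by auto
    have "u * n + j < Suc u * n" using * by simp
    also have "\<dots> \<le> nu * n" using * by (intro mult_right_mono) auto
    finally show "x \<in> {..<12 * (nu * n)}"
      using * x by simp
  qed
qed

definition expressible3 :: "((nat \<Rightarrow> nat) \<Rightarrow> bool list \<Rightarrow> nat \<times> nat \<times> nat) \<Rightarrow> bool" where
  "expressible3 F \<longleftrightarrow> expressible (\<lambda>\<rho> x. fst (F \<rho> x)) \<and> expressible (\<lambda>\<rho> x. fst (snd (F \<rho> x))) \<and>
     expressible (\<lambda>\<rho> x. snd (snd (F \<rho> x)))"

lemma expressible3_tuple [expr_intros]:
  "expressible F \<Longrightarrow> expressible G \<Longrightarrow> expressible H \<Longrightarrow> expressible3 (\<lambda>\<rho> x. (F \<rho> x, G \<rho> x, H \<rho> x))"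
  by (simp add: expressible3_def)

lemma expressible3_if [expr_intros]:
  assumes "decidable P" "expressible3 F" "expressible3 G"
  shows "expressible3 (\<lambda>\<rho> x. if P \<rho> x then F \<rho> x else G \<rho> x)"
  using assms unfolding expressible3_def if_distrib[of fst] if_distrib[of snd]
  by (intro conjI expr_intros) auto

lemma decidable_eq3 [expr_intros]:
  assumes "expressible3 F" "expressible3 G"
  shows "decidable (\<lambda>\<rho> x. F \<rho> x = G \<rho> x)"
  using assms unfolding expressible3_def prod_eq_iff by (intro expr_intros) auto

lemma concat_map_product:
  "concat (map h (List.product xs ys)) = concat (map (\<lambda>i. concat (map (\<lambda>j. h (i, j)) ys)) xs)"
  by (induction xs) (auto simp: comp_def)

lemma replicate_eq_concat: "replicate n b = concat (map (\<lambda>_. [b]) [0..<n])"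
  by (simp add: map_replicate_const)

section \<open>The instance on natural numbers\<close>

definition wf_cnf :: "nat \<Rightarrow> nat \<Rightarrow> (nat \<Rightarrow> nat) \<Rightarrow> bool" where
  "wf_cnf nv m lit \<longleftrightarrow> 0 < m \<and> (\<forall>s<3 * m. lit s < 2 * nv)"

lemma gadget_wf_cnf:
  "wf_cnf nv m lit \<Longrightarrow>
    gadget (2 * nvar nv m) (npos nv m) (con_ty nv m) (con_a nv m) (con_b nv m lit) (con_c nv m)"
  by (rule gadget_cnf) (auto simp: wf_cnf_def)

definition cnf_graph :: "nat \<Rightarrow> nat \<Rightarrow> (nat \<Rightarrow> nat) \<Rightarrow> nat bgraph" where
  "cnf_graph nv m lit = label_graph {..<nvert nv m}
     (\<lambda>v. gadget.bet (con_ty nv m) (con_a nv m) (decode (npos nv m) v))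
     (\<lambda>v. gadget.tau (npos nv m) (con_ty nv m) (con_a nv m) (con_b nv m lit) (con_c nv m) (decode (npos nv m) v))"

definition cnf_bound :: "nat \<Rightarrow> nat \<Rightarrow> (nat \<Rightarrow> nat) \<Rightarrow> nat" where
  "cnf_bound nv m lit = card (edges (cnf_graph nv m lit)) - 3 * (nvert nv m) div 2"

context
  fixes nv m :: nat and lit :: "nat \<Rightarrow> nat"
  assumes wf: "wf_cnf nv m lit"
begin

lemma m: "0 < m" and lit: "s < 3 * m \<Longrightarrow> lit s < 2 * nv"
  using wf by (auto simp: wf_cnf_def)

interpretation gadget "2 * nvar nv m" "npos nv m" "con_ty nv m" "con_a nv m" "con_b nv m lit" "con_c nv m"
  by (rule gadget_wf_cnf[OF wf])

lemma even_nvert: "even (nvert nv m)"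
  by (simp add: nvert_def)

lemma bij_decode: "bij_betw (decode (npos nv m)) {..<nvert nv m} verts4"
  unfolding verts4_def nvert_def by (rule bij_betw_decode) (simp add: npos_def)

interpretation L: labelled "{..<nvert nv m}" "\<lambda>v. bet (decode (npos nv m) v)" "\<lambda>v. tau (decode (npos nv m) v)"
  by (rule labelled_vimage[OF bij_decode labelled_gadget])

lemma L_graph: "L.G = cnf_graph nv m lit"
  by (simp add: cnf_graph_def)

lemma L_many_edges: "3 * (nvert nv m) \<le> 2 * card (edges L.G)"
proof -
  interpret T: labelled verts4 bet tau by (rule labelled_gadget)
  let ?d = "decode (npos nv m)"
  have "vertex_degree L.G v = vertex_degree T.G (?d v)" if "v \<in> {..<nvert nv m}" for v
    using that bij_betw_apply[OF bij_decode that]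
      bij_betw_same_card[OF bij_betw_Collect[OF bij_decode, of "\<lambda>w. bet w = bet (?d v)"]]
      bij_betw_same_card[OF bij_betw_Collect[OF bij_decode, of "\<lambda>w. tau w = tau (?d v)"]]
    by (simp add: L.vertex_degree_G T.vertex_degree_G)
  then have "(\<Sum>v<nvert nv m. vertex_degree L.G v) =
    (\<Sum>v<nvert nv m. vertex_degree T.G (?d v))"
    by (intro sum.cong) auto
  also have "\<dots> = (\<Sum>v\<in>verts4. vertex_degree T.G v)"
    by (rule sum.reindex_bij_betw[OF bij_decode])
  finally have "card (edges L.G) = card (edges T.G)"
    by (simp add: L.sum_degrees T.sum_degrees)
  then show ?thesis
    using many_edges by (simp add: card_verts4 nvert_def)
qed

lemma cnf_graph_deletion: "two_colored_P4_deletion (cnf_graph nv m lit) (cnf_bound nv m lit) \<longleftrightarrow> cnf_sat m lit"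
proof -
  have "two_colored_P4_deletion L.G (card (edges L.G) - 3 * card {..<nvert nv m} div 2) \<longleftrightarrow>
    (\<exists>on. kept_cliques {..<nvert nv m} (\<lambda>v. bet (decode (npos nv m) v)) (\<lambda>v. tau (decode (npos nv m) v)) on)"
    by (rule L.deletion_iff_kept_cliques) (use L_many_edges even_nvert in simp_all)
  also have "\<dots> \<longleftrightarrow> cnf_sat m lit"
    unfolding ex_kept_cliques_vimage[OF bij_decode] kept_iff_sat by (rule sat_cnf[OF m lit])
  finally show ?thesis
    unfolding cnf_bound_def L_graph[symmetric] by simp
qed

lemma cnf_graph_class:
  "(cnf_graph nv m lit, k) \<in> bicolored_instances \<and> cluster_graph (verts (cnf_graph nv m lit)) (blue (cnf_graph nv m lit)) \<and>
   cluster_graph (verts (cnf_graph nv m lit)) (red (cnf_graph nv m lit)) \<and> max_degree (cnf_graph nv m lit) = 5"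
proof -
  have V: "verts L.G = {..<nvert nv m}"
    by (simp add: label_graph_def)
  have pos: "0 < nvar nv m" "0 < npos nv m"
    using m by (simp_all add: nvar_def npos_def)
  \<comment> \<open>Number 0 is a slot of a value clique. Its three blue and two red neighbors
    attain the maximum degree and show that both colors occur.\<close>
  obtain v0 where v0: "v0 < nvert nv m" "decode (npos nv m) v0 = (0, 0, 0, 0)"
    using pos by (intro that[of 0]) (simp_all add: decode_def nvert_def)
  have V0: "(0, 0, 0, 0) \<in> verts4" using pos by simp
  have b4: "card {w \<in> {..<nvert nv m}. bet (decode (npos nv m) w) = bet (decode (npos nv m) v0)} = 4"
    using bij_betw_same_card[OF bij_betw_Collect[OF bij_decode, of "\<lambda>w. bet w = bet (0, 0, 0, 0)"]] card_blue[OF V0] v0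
    by simp
  have r3: "card {w \<in> {..<nvert nv m}. tau (decode (npos nv m) w) = tau (decode (npos nv m) v0)} = 3"
    using bij_betw_same_card[OF bij_betw_Collect[OF bij_decode, of "\<lambda>w. tau w = tau (0, 0, 0, 0)"]]
      card_value_class[of 0 0 0] v0 pos by (simp add: red_class)
  have deg0: "vertex_degree L.G v0 = 5"
    using L.vertex_degree_G[of v0] v0(1) b4 r3 by simp
  have deg: "vertex_degree L.G v \<le> 5" if "v \<in> {..<nvert nv m}" for v
    using L.vertex_degree_G[OF that] L.blue_card[OF that] L.red_card[OF that] by auto
  have "max_degree L.G = 5"
    unfolding max_degree_def V by (rule Max_eqI) (use deg deg0 v0(1) in \<open>auto simp: image_iff intro!: bexI[of _ v0]\<close>)
  moreover have "bicolored_graph L.G"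
    unfolding bicolored_graph_def
  proof (intro conjI)
    show "finite (verts L.G)" by (simp add: V)
    show "edges L.G \<subseteq> {e. e \<subseteq> verts L.G \<and> card e = 2}"
      using L.edges_G by (auto simp: V)
    show "blue L.G \<inter> red L.G = {}"
    proof (rule ccontr)
      assume "blue L.G \<inter> red L.G \<noteq> {}"
      then obtain e where e: "e \<in> blue L.G" "e \<in> red L.G" by blast
      then obtain v w where "e = {v, w}"
        using L.edges_G[of e] by (auto simp: edges_def card_2_iff)
      then show False
        using e L.linear[of v w] by (simp add: L.blue_G L.red_G)
    qed
    have "\<not> {w \<in> {..<nvert nv m}. bet (decode (npos nv m) w) = bet (decode (npos nv m) v0)} \<subseteq> {v0}"
      using b4 card_mono[of "{v0}" "{w \<in> {..<nvert nv m}. bet (decode (npos nv m) w) = bet (decode (npos nv m) v0)}"]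
      by auto
    then obtain w where "w < nvert nv m" "w \<noteq> v0" "bet (decode (npos nv m) w) = bet (decode (npos nv m) v0)"
      by blast
    then have "{v0, w} \<in> blue L.G"
      using v0(1) by (simp add: L.blue_G)
    then show "blue L.G \<noteq> {}" by blast
    have "\<not> {w \<in> {..<nvert nv m}. tau (decode (npos nv m) w) = tau (decode (npos nv m) v0)} \<subseteq> {v0}"
      using r3 card_mono[of "{v0}" "{w \<in> {..<nvert nv m}. tau (decode (npos nv m) w) = tau (decode (npos nv m) v0)}"]
      by auto
    then obtain w where "w < nvert nv m" "w \<noteq> v0" "tau (decode (npos nv m) w) = tau (decode (npos nv m) v0)"
      by blast
    then have "{v0, w} \<in> red L.G"
      using v0(1) by (simp add: L.red_G)
    then show "red L.G \<noteq> {}" by blast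
  qed
  ultimately show ?thesis
    using L.cluster_graph_blue L.cluster_graph_red unfolding L_graph[symmetric] V bicolored_instances_def by (simp add: V)
qed

lemma encode_cnf_graph:
  defines "N \<equiv> nvert nv m"
  defines "B i j \<equiv> i \<noteq> j \<and> bet (decode (npos nv m) i) = bet (decode (npos nv m) j)"
    and "R i j \<equiv> i \<noteq> j \<and> tau (decode (npos nv m) i) = tau (decode (npos nv m) j)"
  shows "encode_instance (cnf_graph nv m lit, k) = concat (map (\<lambda>_. [True]) [0..<N]) @ [False] @
    concat (map (\<lambda>i. concat (map (\<lambda>j. [B i j] @ [R i j]) [0..<N])) [0..<N]) @ binary k"
proof -
  have "card (verts (cnf_graph nv m lit)) = N"
    by (simp add: cnf_graph_def label_graph_def N_def)
  moreover have "{i, j} \<in> blue (cnf_graph nv m lit) \<longleftrightarrow> B i j" "{i, j} \<in> red (cnf_graph nv m lit) \<longleftrightarrow> R i j"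
    if "i < N" "j < N" for i j
    using that unfolding L_graph[symmetric] by (auto simp: L.blue_G L.red_G N_def B_def R_def)
  ultimately show ?thesis
    unfolding encode_instance_def Let_def case_prod_conv concat_map_product replicate_eq_concat
    by (auto intro!: arg_cong[where f = concat] map_cong)
qed

lemma cnf_bound_eq:
  defines "N \<equiv> nvert nv m"
  shows "cnf_bound nv m lit = ((\<Sum>v<N. \<Sum>w<N. of_bool (bet (decode (npos nv m) w) = bet (decode (npos nv m) v)) +
      of_bool (tau (decode (npos nv m) w) = tau (decode (npos nv m) v))) - 2 * N) div 2 - 3 * N div 2"
proof -
  have "card (edges L.G) = 2 * card (edges L.G) div 2" by simp
  then show ?thesis
    unfolding cnf_bound_def L_graph[symmetric] L.card_edges N_def by simp
qed

end

context
  fixes nv m :: "bool list \<Rightarrow> nat" and lit :: "bool list \<Rightarrow> nat \<Rightarrow> nat"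
  assumes nv_expr [expr_intros]: "expressible (\<lambda>\<rho> x. nv x)" and m_expr [expr_intros]: "expressible (\<lambda>\<rho> x. m x)"
    and lit_expr [expr_intros]: "\<And>F. expressible F \<Longrightarrow> expressible (\<lambda>\<rho> x. lit x (F \<rho> x))"
    and wf: "\<And>x. wf_cnf (nv x) (m x) (lit x)"
begin

lemma npos_expr [expr_intros]: "expressible (\<lambda>\<rho> x. npos (nv x) (m x))"
  unfolding npos_def ncon_def nvar_def by (intro expr_intros)

lemma nvar_expr [expr_intros]: "expressible (\<lambda>\<rho> x. nvar (nv x) (m x))"
  unfolding nvar_def by (intro expr_intros)

lemma nvert_expr [expr_intros]: "expressible (\<lambda>\<rho> x. nvert (nv x) (m x))"
  unfolding nvert_def by (intro expr_intros)

lemma con_expr [expr_intros]: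
  assumes "expressible F"
  shows "expressible (\<lambda>\<rho> x. con_ty (nv x) (m x) (F \<rho> x))" "expressible (\<lambda>\<rho> x. con_a (nv x) (m x) (F \<rho> x))"
    "expressible (\<lambda>\<rho> x. con_b (nv x) (m x) (lit x) (F \<rho> x))" "expressible (\<lambda>\<rho> x. con_c (nv x) (m x) (F \<rho> x))"
  unfolding con_ty_def con_a_def con_b_def con_c_def Let_def ncon_def by (intro expr_intros assms)+

lemma bet_expr [expr_intros]:
  assumes "expressible F"
  shows "expressible3 (\<lambda>\<rho> x. gadget.bet (con_ty (nv x) (m x)) (con_a (nv x) (m x)) (decode (npos (nv x) (m x)) (F \<rho> x)))"
  unfolding decode_def gadget.bet.simps[OF gadget_wf_cnf[OF wf]] by (intro expr_intros assms)

lemma tau_expr [expr_intros]: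
  assumes "expressible F"
  shows "expressible3 (\<lambda>\<rho> x. gadget.tau (npos (nv x) (m x)) (con_ty (nv x) (m x)) (con_a (nv x) (m x))
    (con_b (nv x) (m x) (lit x)) (con_c (nv x) (m x)) (decode (npos (nv x) (m x)) (F \<rho> x)))"
  unfolding decode_def gadget.tau.simps[OF gadget_wf_cnf[OF wf]] gadget.xr_def[OF gadget_wf_cnf[OF wf]]
    gadget.pr_def[OF gadget_wf_cnf[OF wf]]
  by (intro expr_intros assms)

theorem cnf_reduction_computable:
  "poly_time_computable 1 (\<lambda>xs. encode_instance
     (cnf_graph (nv (xs ! 0)) (m (xs ! 0)) (lit (xs ! 0)), cnf_bound (nv (xs ! 0)) (m (xs ! 0)) (lit (xs ! 0))))"
proof (rule poly_time_computable_writable[where f = "\<lambda>x. encode_instance (cnf_graph (nv x) (m x) (lit x), cnf_bound (nv x) (m x) (lit x))"])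
  have "expressible (\<lambda>\<rho> x. cnf_bound (nv x) (m x) (lit x))"
    unfolding cnf_bound_eq[OF wf] by (intro expr_intros expressible_sum)
  then show "writable (\<lambda>\<rho> x. encode_instance (cnf_graph (nv x) (m x) (lit x), cnf_bound (nv x) (m x) (lit x)))"
    unfolding encode_cnf_graph[OF wf]
    by (intro writable_append writable_for writable_bit writable_binary) (intro expr_intros)+
qed

end

section \<open>The Cook--Levin theorem\<close>

text \<open>The number of cases is fixed, so they can be combined by nested conditionals; it is
  applied to the finite list of clause schemes.\<close>

lemma expressible3_cases:
  assumes "\<And>i. i < c \<Longrightarrow> expressible3 (G i)" "expressible F" "\<And>\<rho> x. F \<rho> x < c"
  shows "expressible3 (\<lambda>\<rho> x. G (F \<rho> x) \<rho> x)"
proof -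
  have "expressible3 (\<lambda>\<rho> x. if F \<rho> x < k then G (F \<rho> x) \<rho> x else (0, 0, 0))" if "k \<le> c" for k
    using that
  proof (induction k)
    case 0
    then show ?case by (simp add: expressible3_def expressible_const)
  next
    case (Suc k)
    have "(if F \<rho> x < Suc k then G (F \<rho> x) \<rho> x else (0, 0, 0)) =
      (if F \<rho> x = k then G k \<rho> x else if F \<rho> x < k then G (F \<rho> x) \<rho> x else (0, 0, 0))" for \<rho> x
      by auto
    moreover have IH: "expressible3 (\<lambda>\<rho> x. if F \<rho> x < k then G (F \<rho> x) \<rho> x else (0, 0, 0))"
      using Suc by simp
    moreover have "expressible3 (G k)"
      using Suc.prems by (intro assms(1)) simp
    ultimately show ?case
      by (simp only:) (intro expressible3_if[OF decidable_eq[OF assms(2) expressible_const]])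
  qed
  from this[of c] show ?thesis
    using assms(3) by simp
qed

text \<open>
  Atoms of the tableau at time \<open>t\<close>: \<open>AS j a\<close> (with a position) says that tape \<open>j\<close> contains \<open>a\<close>, \<open>AQ s\<close> that the
  state is \<open>s\<close>, and \<open>AC r (s, w)\<close> that the state is \<open>s\<close> and the first \<open>r\<close> heads scan the first \<open>r\<close> symbols of \<open>w\<close>.
\<close>

datatype atom = AS nat nat | AC nat "nat \<times> nat list" | AQ nat

text \<open>Clause schemes, each instantiated for all times and columns. The state and the scanned
  symbols are matched one head at a time, since a single implication from all of them would exceed
  three literals.\<close>

datatype rule =
    Match_State "nat \<times> nat list" | Match_Head nat "nat \<times> nat list"
  | Next_Cell "nat \<times> nat list" nat nat | Next_State "nat \<times> nat list"
  | Init_Input | Init_Blank nat | Init_Guess | Init_Guess_Blank | Init_State | Accept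

lemma mixed_radix_inject:
  fixes t I k :: nat
  assumes "(t * w + I) * l + k = (t' * w + I') * l + k'" "I < w" "I' < w" "k < l" "k' < l"
  shows "t = t' \<and> I = I' \<and> k = k'"
proof -
  have "((t * w + I) * l + k) div l = t * w + I" "((t' * w + I') * l + k') div l = t' * w + I'"
    using assms(4,5) by simp_all
  moreover have "((t * w + I) * l + k) mod l = k" "((t' * w + I') * l + k') mod l = k'"
    using assms(4,5) by simp_all
  ultimately have 1: "t * w + I = t' * w + I'" "k = k'"
    using assms(1) by metis+
  have "(t * w + I) div w = t" "(t' * w + I') div w = t'" "(t * w + I) mod w = I" "(t' * w + I') mod w = I'"
    using assms(2,3) by simp_all
  then show ?thesis
    using 1 by metis
qed

locale verifier =
  fixes M :: tm and p q :: "nat poly" and V :: "bool list \<Rightarrow> bool list \<Rightarrow> bool"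
  assumes wf: "wf_tm M" and two_tapes: "2 \<le> tm_tapes M"
    and run: "computes_within M [x, y] [V x y] (poly q (length x + length y))"
begin

abbreviation "K \<equiv> tm_tapes M"

definition ZZ :: "(nat \<times> nat list) set" where
  "ZZ = {..<tm_states M} \<times> {w. set w \<subseteq> {..<tm_symbols M} \<and> length w = K}"

text \<open>Halting becomes an idle transition, so a run can be continued to the fixed height of the
  tableau.\<close>

definition delta :: "nat \<times> nat list \<Rightarrow> nat \<times> (nat \<times> int) list" where
  "delta z = (if fst z = 1 then (1, map (\<lambda>a. (a, 0)) (snd z)) else tm_delta M (fst z) (snd z))"

definition cfg :: "bool list \<Rightarrow> bool list \<Rightarrow> nat \<Rightarrow> config" where
  "cfg x y t = (step M ^^ t) (init_config M [x, y])"

definition scan :: "config \<Rightarrow> nat \<times> nat list" where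
  "scan c = (fst c, map (\<lambda>u. u 0) (snd c))"

lemma finite_ZZ: "finite ZZ"
  unfolding ZZ_def by (intro finite_cartesian_product finite_lists_length_eq) auto

lemma wf_delta:
  assumes "z \<in> ZZ"
  shows "fst (delta z) < tm_states M" "length (snd (delta z)) = K"
    "j < K \<Longrightarrow> fst (snd (delta z) ! j) < tm_symbols M \<and> snd (snd (delta z) ! j) \<in> {-1, 0, 1}"
proof -
  obtain s w where z: "z = (s, w)" "s < tm_states M" "set w \<subseteq> {..<tm_symbols M}" "length w = K"
    using assms by (auto simp: ZZ_def)
  have 2: "2 \<le> tm_states M" using wf by (simp add: wf_tm_def)
  have *: "fst (delta z) < tm_states M \<and> length (snd (delta z)) = K \<and>
     set (snd (delta z)) \<subseteq> {..<tm_symbols M} \<times> {-1, 0, 1}"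
  proof (cases "s = 1")
    case True
    then show ?thesis using z 2 by (auto simp: delta_def)
  next
    case False
    have "case tm_delta M s w of (q', acts) \<Rightarrow> q' < tm_states M \<and> length acts = K \<and>
           set acts \<subseteq> {..<tm_symbols M} \<times> {-1, 0, 1}"
      using wf[unfolded wf_tm_def] z(2-4) by simp
    then show ?thesis using False z by (auto simp: delta_def split: prod.splits)
  qed
  then show "fst (delta z) < tm_states M" "length (snd (delta z)) = K" by auto
  assume "j < K"
  then have "snd (delta z) ! j \<in> {..<tm_symbols M} \<times> {-1, 0, 1}"
    using * nth_mem[of j "snd (delta z)"] by auto
  then show "fst (snd (delta z) ! j) < tm_symbols M \<and> snd (snd (delta z) ! j) \<in> {-1, 0, 1}"
    by (auto simp: mem_Times_iff)
qed

lemma step_delta: "step M c = (fst (delta (scan c)), map2 act (snd (delta (scan c))) (snd c))"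
proof (cases "fst c = 1")
  case True
  have "map2 act (map (\<lambda>a. (a, 0)) (map (\<lambda>u. u 0) (snd c))) (snd c) = snd c"
    by (rule nth_equalityI) (auto simp: act_def)
  then show ?thesis
    using True by (cases c) (simp add: step_def delta_def scan_def)
qed (auto simp: step_def delta_def scan_def split: prod.splits)

lemma cfg_0:
  "fst (cfg x y 0) = 0" "j < K \<Longrightarrow> snd (cfg x y 0) ! j = tape_of (if j = 0 then x else if j = 1 then y else [])"
  using two_tapes by (auto simp: cfg_def init_config_def nth_append nth_Cons')

lemma scan_in_ZZ:
  "fst c < tm_states M \<Longrightarrow> length (snd c) = K \<Longrightarrow> (\<And>j i. j < K \<Longrightarrow> (snd c ! j) i < tm_symbols M) \<Longrightarrow> scan c \<in> ZZ"
  by (auto simp: scan_def ZZ_def in_set_conv_nth)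

lemma cfg_invariant:
  "scan (cfg x y t) \<in> ZZ \<and> length (snd (cfg x y t)) = K \<and> (\<forall>j<K. \<forall>i. (snd (cfg x y t) ! j) i < tm_symbols M)"
proof (induction t)
  case 0
  have 3: "3 \<le> tm_symbols M" "2 \<le> tm_states M" using wf by (auto simp: wf_tm_def)
  have len: "length (snd (cfg x y 0)) = K"
    using two_tapes by (simp add: cfg_def init_config_def)
  have sym: "(snd (cfg x y 0) ! j) i < tm_symbols M" if "j < K" for j i
    using cfg_0(2)[OF that, of x y] tape_of_less_3 3(1) by (metis order_less_le_trans)
  show ?case
    using len sym scan_in_ZZ[OF _ len sym] 3 cfg_0(1)[of x y] by simp
next
  case (Suc t)
  let ?c = "cfg x y t" and ?z = "scan (cfg x y t)"
  have c: "cfg x y (Suc t) = (fst (delta ?z), map2 act (snd (delta ?z)) (snd ?c))"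
    by (simp add: cfg_def step_delta[symmetric])
  have z: "?z \<in> ZZ" and len: "length (snd ?c) = K" using Suc by auto
  have len': "length (snd (cfg x y (Suc t))) = K"
    using wf_delta(2)[OF z] len by (simp add: c)
  have sym: "(snd (cfg x y (Suc t)) ! j) i < tm_symbols M" if "j < K" for j i
    using that Suc wf_delta[OF z] len by (auto simp: c act_def)
  show ?case
    using len' sym scan_in_ZZ[OF _ len' sym] wf_delta(1)[OF z] by (simp add: c)
qed

lemma cfg_Suc:
  shows "fst (cfg x y (Suc t)) = fst (delta (scan (cfg x y t)))"
    and "j < K \<Longrightarrow> (snd (cfg x y (Suc t)) ! j) i =
      (let a = snd (delta (scan (cfg x y t))) ! j in if i + snd a = 0 then fst a else (snd (cfg x y t) ! j) (i + snd a))"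
proof -
  let ?z = "scan (cfg x y t)"
  have c: "cfg x y (Suc t) = (fst (delta ?z), map2 act (snd (delta ?z)) (snd (cfg x y t)))"
    by (simp add: cfg_def step_delta[symmetric])
  show "fst (cfg x y (Suc t)) = fst (delta ?z)" by (simp add: c)
  show "(snd (cfg x y (Suc t)) ! j) i =
      (let a = snd (delta ?z) ! j in if i + snd a = 0 then fst a else (snd (cfg x y t) ! j) (i + snd a))" if "j < K"
    using that cfg_invariant[of x y t] wf_delta(2)[of ?z] by (simp add: c act_def Let_def)
qed

definition guess :: "bool list \<Rightarrow> nat" where
  "guess x = poly p (length x)"

text \<open>This exceeds the running time for every admissible certificate, and it exceeds the
  length of the certificate, which therefore fits into the right half of the tableau.\<close>

definition bound :: "bool list \<Rightarrow> nat" where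
  "bound x = poly q (length x + guess x) + guess x + 1"

text \<open>Column \<open>I\<close> stands for the cell at distance \<open>I - bound x\<close> from
  the head, so the scanned cell is always in column \<open>bound x\<close>. Cells farther away
  cannot be reached in time.\<close>

definition width :: "bool list \<Rightarrow> nat" where
  "width x = 2 * bound x + 1"

lemma accepts:
  assumes "length y \<le> guess x"
  shows "(snd (cfg x y (bound x)) ! 0) 0 = (if V x y then 2 else 1)"
proof -
  obtain n ts where n: "n \<le> poly q (length x + length y)" "(step M ^^ n) (init_config M [x, y]) = (1, ts)"
    "\<forall>i\<in>{0..int (length [V x y])}. hd ts i = tape_of [V x y] i"
    using run[of x y] unfolding computes_within_def by blast
  have "poly q (length x + length y) \<le> poly q (length x + guess x)"
    using assms by (intro poly_nat_mono) simp
  then have "n \<le> bound x"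
    using n(1) by (simp add: bound_def)
  then obtain d where d: "bound x = d + n"
    by (metis le_add_diff_inverse2)
  have halt: "(step M ^^ k) (1, ts) = (1, ts)" for k
    by (induction k) (simp_all add: step_def)
  have "cfg x y (bound x) = (1, ts)"
    unfolding cfg_def d by (simp add: funpow_add n(2) halt[simplified])
  moreover have "length ts = K"
    using cfg_invariant[of x y "bound x"] \<open>cfg x y (bound x) = (1, ts)\<close> by simp
  then have "hd ts = ts ! 0"
    using two_tapes by (intro hd_conv_nth) auto
  ultimately show ?thesis
    using n(3) by (auto simp: tape_of_def)
qed

definition AA :: "atom set" where
  "AA = (\<lambda>(j, a). AS j a) ` ({..<K} \<times> {..<tm_symbols M}) \<union> (\<lambda>(r, z). AC r z) ` ({..K} \<times> ZZ) \<union> AQ ` {..<tm_states M}"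

lemma finite_AA: "finite AA"
  unfolding AA_def using finite_ZZ by auto

lemma in_AA [simp]: "AS j a \<in> AA \<longleftrightarrow> j < K \<and> a < tm_symbols M" "AC r z \<in> AA \<longleftrightarrow> r \<le> K \<and> z \<in> ZZ"
  "AQ s \<in> AA \<longleftrightarrow> s < tm_states M"
  by (auto simp: AA_def)

definition ix :: "atom \<Rightarrow> nat" where
  "ix = (SOME h. bij_betw h AA {0..<card AA})"

lemma ix: "bij_betw ix AA {0..<card AA}"
  using someI_ex[OF ex_bij_betw_finite_nat[OF finite_AA]] unfolding ix_def .

lemma ix_less: "A \<in> AA \<Longrightarrow> ix A < card AA"
  using ix by (auto simp: bij_betw_def)

lemma ix_inj: "A \<in> AA \<Longrightarrow> B \<in> AA \<Longrightarrow> ix A = ix B \<Longrightarrow> A = B"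
  using ix by (auto simp: bij_betw_def inj_on_def)

definition code :: "bool list \<Rightarrow> nat \<Rightarrow> nat \<Rightarrow> atom \<Rightarrow> nat" where
  "code x t I A = (t * width x + I) * card AA + ix A"

abbreviation "pos x t I A \<equiv> 2 * code x t I A"
abbreviation "neg x t I A \<equiv> 2 * code x t I A + 1"

text \<open>A filler at times and columns where a scheme does not apply, so that clauses can be
  numbered uniformly.\<close>

definition taut :: "bool list \<Rightarrow> nat \<times> nat \<times> nat" where
  "taut x = (pos x 0 0 (AQ 0), neg x 0 0 (AQ 0), neg x 0 0 (AQ 0))"

text \<open>Tapes move under fixed heads: after a move \<open>d\<close>, column \<open>I + 1\<close>
  receives the content of column \<open>I + 1 + d\<close>, or the written symbol if that is the
  scanned column. The offset by one keeps this index nonnegative. The two outermost columns of the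
  next row are left unconstrained. The certificate consists of bits followed by blanks, since a
  blank propagates to the right. \<open>Accept\<close> forbids the output
  \<open>False\<close>.\<close>

primrec clause :: "rule \<Rightarrow> bool list \<Rightarrow> nat \<Rightarrow> nat \<Rightarrow> nat \<times> nat \<times> nat" where
  "clause (Match_State z) x t I = (neg x t 0 (AQ (fst z)), neg x t 0 (AQ (fst z)), pos x t 0 (AC 0 z))"
| "clause (Match_Head r z) x t I =
     (neg x t 0 (AC r z), neg x t (bound x) (AS r (snd z ! r)), pos x t 0 (AC (Suc r) z))"
| "clause (Next_Cell z j a) x t I =
     (let b = snd (delta z) ! j; I' = I + nat (snd b + 1) in
      if I + 2 < width x
      then (neg x t 0 (AC K z), neg x t I' (AS j a),
        if I' = bound x then pos x (t + 1) (I + 1) (AS j (fst b)) else pos x (t + 1) (I + 1) (AS j a))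
      else taut x)"
| "clause (Next_State z) x t I = (neg x t 0 (AC K z), neg x t 0 (AC K z), pos x (t + 1) 0 (AQ (fst (delta z))))"
| "clause Init_Input x t I =
     (let l = if I < bound x \<or> tape_of x (int (I - bound x)) = 0 then pos x 0 I (AS 0 0)
        else if tape_of x (int (I - bound x)) = 1 then pos x 0 I (AS 0 1) else pos x 0 I (AS 0 2) in (l, l, l))"
| "clause (Init_Blank j) x t I = (let l = pos x 0 I (AS j 0) in (l, l, l))"
| "clause Init_Guess x t I =
     (if bound x \<le> I \<and> I < bound x + guess x then (pos x 0 I (AS 1 0), pos x 0 I (AS 1 1), pos x 0 I (AS 1 2))
      else (pos x 0 I (AS 1 0), pos x 0 I (AS 1 0), pos x 0 I (AS 1 0)))"
| "clause Init_Guess_Blank x t I =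
     (if bound x \<le> I \<and> I + 1 < bound x + guess x
      then (neg x 0 I (AS 1 0), neg x 0 I (AS 1 0), pos x 0 (I + 1) (AS 1 0)) else taut x)"
| "clause Init_State x t I = (let l = pos x 0 0 (AQ 0) in (l, l, l))"
| "clause Accept x t I = (let l = neg x (bound x) (bound x) (AS 0 1) in (l, l, l))"

definition rules :: "rule set" where
  "rules = Match_State ` ZZ \<union> (\<lambda>(r, z). Match_Head r z) ` ({..<K} \<times> ZZ) \<union>
     (\<lambda>(z, j, a). Next_Cell z j a) ` (ZZ \<times> {..<K} \<times> {..<tm_symbols M}) \<union> Next_State ` ZZ \<union>
     {Init_Input, Init_Guess, Init_Guess_Blank, Init_State, Accept} \<union> Init_Blank ` {2..<K}"

lemma finite_rules: "finite rules"
  unfolding rules_def using finite_ZZ by auto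

definition rule_list :: "rule list" where
  "rule_list = (SOME rs. set rs = rules)"

lemma rule_list: "set rule_list = rules"
  using someI_ex[OF finite_list[OF finite_rules]] unfolding rule_list_def .

lemma rule_list_pos: "0 < length rule_list"
  using rule_list by (auto simp: rules_def)

definition nvars :: "bool list \<Rightarrow> nat" where
  "nvars x = (bound x + 1) * width x * card AA"

definition nclauses :: "bool list \<Rightarrow> nat" where
  "nclauses x = bound x * width x * length rule_list"

definition literal :: "bool list \<Rightarrow> nat \<Rightarrow> nat" where
  "literal x s = (let c = s div 3; d = c div length rule_list;
     cl = clause (rule_list ! (c mod length rule_list)) x (d div width x) (d mod width x) in
     if s mod 3 = 0 then fst cl else if s mod 3 = 1 then fst (snd cl) else snd (snd cl))"

definition true_clause :: "(nat \<Rightarrow> bool) \<Rightarrow> nat \<times> nat \<times> nat \<Rightarrow> bool" where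
  "true_clause \<alpha> cl \<longleftrightarrow> holds \<alpha> (fst cl) \<or> holds \<alpha> (fst (snd cl)) \<or> holds \<alpha> (snd (snd cl))"

lemma cnf_sat_rules:
  "cnf_sat (nclauses x) (literal x) \<longleftrightarrow>
    (\<exists>\<alpha>. \<forall>rl\<in>rules. \<forall>t<bound x. \<forall>I<width x. true_clause \<alpha> (clause rl x t I))"
proof -
  have ex3: "(\<exists>e<3. P e) \<longleftrightarrow> P 0 \<or> P 1 \<or> P 2" for P :: "nat \<Rightarrow> bool"
    by (auto simp: less_Suc_eq numeral_3_eq_3 numeral_2_eq_2)
  have lit: "(\<exists>e<3. holds \<alpha> (literal x (3 * c + e))) \<longleftrightarrow>
    true_clause \<alpha> (clause (rule_list ! (c mod length rule_list)) x (c div length rule_list div width x) (c div length rule_list mod width x))"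
    for \<alpha> c
  proof -
    have "(3 * c + 1) mod 3 = 1" "(3 * c + 2) mod 3 = 2" "(3 * c + 1) div 3 = c" "(3 * c + 2) div 3 = c"
      by presburger+
    then show ?thesis
      unfolding ex3 literal_def true_clause_def Let_def by simp
  qed
  have all: "(\<forall>c<nclauses x. P (rule_list ! (c mod length rule_list)) (c div length rule_list div width x) (c div length rule_list mod width x)) \<longleftrightarrow>
    (\<forall>rl\<in>rules. \<forall>t<bound x. \<forall>I<width x. P rl t I)" for P
  proof
    assume *: "\<forall>c<nclauses x. P (rule_list ! (c mod length rule_list)) (c div length rule_list div width x) (c div length rule_list mod width x)"
    show "\<forall>rl\<in>rules. \<forall>t<bound x. \<forall>I<width x. P rl t I"
    proof (intro ballI allI impI)
      fix rl t I assume rl: "rl \<in> rules" and t: "t < bound x" and I: "I < width x"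
      obtain d where d: "d < length rule_list" "rule_list ! d = rl"
        using rl rule_list by (metis in_set_conv_nth)
      let ?c = "(t * width x + I) * length rule_list + d"
      have "t * width x + I < Suc t * width x" using I by simp
      also have "\<dots> \<le> bound x * width x" using t by (intro mult_right_mono) auto
      finally have "Suc (t * width x + I) * length rule_list \<le> nclauses x"
        unfolding nclauses_def by (intro mult_right_mono) auto
      then have "?c < nclauses x" using d(1) by simp
      moreover have "(A * l + k) mod l = k \<and> (A * l + k) div l = A" if "k < l" for A k l :: nat
        using that by simp
      note this[OF d(1)]
      moreover have "(t * width x + I) div width x = t" "(t * width x + I) mod width x = I"
        using I by simp_all
      ultimately show "P rl t I"
        using * d(2) by metis
    qed
  next
    assume *: "\<forall>rl\<in>rules. \<forall>t<bound x. \<forall>I<width x. P rl t I"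
    show "\<forall>c<nclauses x. P (rule_list ! (c mod length rule_list)) (c div length rule_list div width x) (c div length rule_list mod width x)"
    proof (intro allI impI)
      fix c assume "c < nclauses x"
      then have "c div length rule_list < bound x * width x"
        by (simp add: nclauses_def less_mult_imp_div_less)
      then have "c div length rule_list div width x < bound x"
        by (simp add: less_mult_imp_div_less)
      moreover have "c div length rule_list mod width x < width x"
        by (simp add: width_def)
      moreover have "rule_list ! (c mod length rule_list) \<in> rules"
        using rule_list_pos nth_mem[of "c mod length rule_list" rule_list] by (simp add: rule_list)
      ultimately show "P (rule_list ! (c mod length rule_list)) (c div length rule_list div width x) (c div length rule_list mod width x)"
        using * by blast
    qed
  qed
  show ?thesis
    unfolding cnf_sat_def lit all[of "\<lambda>rl t I. true_clause _ (clause rl x t I)"] ..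
qed

lemma holds_code [simp]: "holds \<alpha> (pos x t I A) \<longleftrightarrow> \<alpha> (code x t I A)" "holds \<alpha> (neg x t I A) \<longleftrightarrow> \<not> \<alpha> (code x t I A)"
  "holds \<alpha> (Suc (pos x t I A)) \<longleftrightarrow> \<not> \<alpha> (code x t I A)"
  by (auto simp: holds_def)

lemma bound_pos: "0 < bound x" "guess x < bound x" "bound x < width x"
  by (auto simp: bound_def width_def)

text \<open>A cell may carry several symbols in a satisfying assignment. This is harmless: the
  clauses are implications that force the facts of the actual run to be true, and the forbidden
  output symbol would be among them if the verifier rejected.\<close>

lemma sat_imp_accepts:
  assumes sat: "\<And>rl t I. rl \<in> rules \<Longrightarrow> t < bound x \<Longrightarrow> I < width x \<Longrightarrow> true_clause \<alpha> (clause rl x t I)"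
  shows "\<exists>y. length y \<le> guess x \<and> V x y"
proof -
  define T where "T = bound x"
  define F where "F t I A \<longleftrightarrow> \<alpha> (code x t I A)" for t I A
  note b = bound_pos[of x, folded T_def]
  have sat0: "true_clause \<alpha> (clause rl x 0 I)" if "rl \<in> rules" "I < width x" for rl I
    using sat[of rl 0 I] that b(1) by (simp add: T_def)
  have match_state: "F t 0 (AC 0 z)" if "z \<in> ZZ" "t < T" "F t 0 (AQ (fst z))" for t z
    using sat[of "Match_State z" t 0] that b by (simp add: rules_def true_clause_def F_def T_def)
  have match_head: "F t 0 (AC (Suc r) z)" if "z \<in> ZZ" "r < K" "t < T" "F t 0 (AC r z)" "F t T (AS r (snd z ! r))" for t z r
    using sat[of "Match_Head r z" t 0] that b by (simp add: rules_def true_clause_def F_def T_def image_iff)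
  have next_state: "F (t + 1) 0 (AQ (fst (delta z)))" if "z \<in> ZZ" "t < T" "F t 0 (AC K z)" for t z
    using sat[of "Next_State z" t 0] that b by (simp add: rules_def true_clause_def F_def T_def)
  have next_cell: "F (t + 1) (I + 1) (AS j (if I + nat (snd (snd (delta z) ! j) + 1) = T then fst (snd (delta z) ! j) else a))"
    if "z \<in> ZZ" "t < T" "F t 0 (AC K z)" "j < K" "a < tm_symbols M" "I + 2 < width x"
      "F t (I + nat (snd (snd (delta z) ! j) + 1)) (AS j a)" for t z I j a
    using sat[of "Next_Cell z j a" t I] that
    by (auto simp: rules_def true_clause_def F_def T_def Let_def image_iff split: if_splits)
  have init_state: "F 0 0 (AQ 0)"
    using sat0[of Init_State 0] b by (simp add: rules_def true_clause_def F_def Let_def)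
  have init_blank: "F 0 I (AS j 0)" if "2 \<le> j" "j < K" "I < width x" for j I
    using sat0[of "Init_Blank j" I] that by (simp add: rules_def true_clause_def F_def Let_def)
  have init_input: "F 0 I (AS 0 (tape_of x (int I - int T)))" if "I < width x" for I
  proof (cases "I < T")
    case True
    then show ?thesis
      using sat0[of Init_Input I] that by (simp add: rules_def true_clause_def F_def T_def tape_of_def Let_def)
  next
    case False
    then have eq: "int I - int T = int (I - T)" by simp
    define a where "a = tape_of x (int (I - bound x))"
    have a: "a = 0 \<or> a = 1 \<or> a = 2"
      by (simp add: a_def tape_of_def)
    have "true_clause \<alpha> (clause Init_Input x 0 I)"
      using that by (intro sat0) (simp_all add: rules_def)
    then have "F 0 I (AS 0 a)"
      using a False unfolding clause.simps a_def[symmetric] T_def F_def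
      by (elim disjE) (simp_all add: true_clause_def Let_def)
    then show ?thesis
      unfolding eq by (simp only: a_def T_def)
  qed
  have guess1: "F 0 I (AS 1 0) \<or> F 0 I (AS 1 1) \<or> F 0 I (AS 1 2)" if "T \<le> I" "I < T + guess x" "I < width x" for I
    using sat0[of Init_Guess I] that by (simp add: rules_def true_clause_def F_def T_def)
  have guess2: "F 0 I (AS 1 0)" if "\<not> (T \<le> I \<and> I < T + guess x)" "I < width x" for I
    using sat0[of Init_Guess I] that by (auto simp: rules_def true_clause_def F_def T_def split: if_splits)
  have guess3: "F 0 (I + 1) (AS 1 0)" if "T \<le> I" "I + 1 < T + guess x" "I < width x" "F 0 I (AS 1 0)" for I
    using sat0[of Init_Guess_Blank I] that by (simp add: rules_def true_clause_def F_def T_def)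
  have accept: "\<not> F T T (AS 0 1)"
    using sat0[of Accept 0] b by (simp add: rules_def true_clause_def F_def T_def Let_def)
  \<comment> \<open>The certificate ends at the first blank of its region, or fills the
    region.\<close>
  define l where "l = (LEAST i. guess x \<le> i \<or> F 0 (T + i) (AS 1 0))"
  have l: "guess x \<le> l \<or> F 0 (T + l) (AS 1 0)" "l \<le> guess x"
    unfolding l_def by (rule LeastI[of _ "guess x"], simp) (rule Least_le, simp)
  have not_l: "i < guess x \<and> \<not> F 0 (T + i) (AS 1 0)" if "i < l" for i
    using not_less_Least[of i "\<lambda>i. guess x \<le> i \<or> F 0 (T + i) (AS 1 0)"] that by (auto simp: l_def)
  define y where "y = map (\<lambda>i. F 0 (T + i) (AS 1 2)) [0..<l]"
  have tail: "F 0 (T + i) (AS 1 0)" if "l \<le> i" "i < guess x" for i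
    using that
  proof (induction i rule: dec_induct)
    case base
    then show ?case using l by auto
  next
    case (step i)
    then show ?case
      using guess3[of "T + i"] b by (simp add: width_def T_def)
  qed
  have init_guess: "F 0 I (AS 1 (tape_of y (int I - int T)))" if I: "I < width x" for I
  proof (cases "T \<le> I \<and> I < T + guess x")
    case False
    then have "tape_of y (int I - int T) = 0"
      using l(2) by (auto simp: tape_of_def y_def)
    then show ?thesis using guess2[OF False I] by simp
  next
    case True
    then obtain i where i: "I = T + i" "i < guess x"
      by (metis le_add_diff_inverse nat_add_left_cancel_less)
    show ?thesis
    proof (cases "i < l")
      case True
      then show ?thesis
        using not_l[OF True] guess1[of I] I i by (auto simp: tape_of_def y_def)
    next
      case False
      then show ?thesis
        using tail[of i] i by (simp add: tape_of_def y_def)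
    qed
  qed
  have len_y: "length y \<le> guess x" using l(2) by (simp add: y_def)
  \<comment> \<open>The unconstrained boundary columns spread inwards by one column per step. The
    trustworthy window shrinks to the scanned column \<open>T\<close> exactly at time
    \<open>T\<close>.\<close>
  have inv: "F t 0 (AQ (fst (cfg x y t))) \<and>
    (\<forall>j<K. \<forall>I. t \<le> I \<longrightarrow> I + t \<le> 2 * T \<longrightarrow> F t I (AS j ((snd (cfg x y t) ! j) (int I - int T))))" if "t \<le> T" for t
    using that
  proof (induction t)
    case 0
    have "F 0 I (AS j ((snd (cfg x y 0) ! j) (int I - int T)))" if j: "j < K" "I + 0 \<le> 2 * T" for j I
    proof -
      have "I < width x" using that by (simp add: width_def T_def)
      moreover have "tape_of [] i = 0" for i by (simp add: tape_of_def)
      moreover have "j = 0 \<or> j = 1 \<or> 2 \<le> j" by auto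
      ultimately show ?thesis
        using init_input[of I] init_guess[of I] init_blank[of j I] cfg_0(2)[OF j(1), of x y] j(1) by auto
    qed
    then show ?case
      using init_state by (simp add: cfg_0)
  next
    case (Suc t)
    then have t: "t < T" and IH: "F t 0 (AQ (fst (cfg x y t)))"
      "\<And>j I. j < K \<Longrightarrow> t \<le> I \<Longrightarrow> I + t \<le> 2 * T \<Longrightarrow> F t I (AS j ((snd (cfg x y t) ! j) (int I - int T)))"
      by auto
    define z where "z = scan (cfg x y t)"
    have z: "z \<in> ZZ" and len: "length (snd (cfg x y t)) = K" and sym: "\<And>j i. j < K \<Longrightarrow> (snd (cfg x y t) ! j) i < tm_symbols M"
      using cfg_invariant[of x y t] by (auto simp: z_def)
    have "F t 0 (AC r z)" if "r \<le> K" for r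
      using that
    proof (induction r)
      case 0
      then show ?case
        using match_state[OF z t] IH(1) by (simp add: z_def scan_def)
    next
      case (Suc r)
      have "snd z ! r = (snd (cfg x y t) ! r) (int T - int T)"
        using Suc.prems len by (simp add: z_def scan_def)
      then have "F t T (AS r (snd z ! r))"
        using IH(2)[of r T] Suc.prems t by simp
      then show ?case
        using match_head[OF z _ t] Suc by simp
    qed
    then have CK: "F t 0 (AC K z)" by simp
    have "F (Suc t) I (AS j ((snd (cfg x y (Suc t)) ! j) (int I - int T)))"
      if j: "j < K" and I: "Suc t \<le> I" "I + Suc t \<le> 2 * T" for j I
    proof -
      define I0 where "I0 = I - 1"
      have I0: "I = I0 + 1" using I by (simp add: I0_def)
      let ?b = "snd (delta z) ! j"
      have mv: "snd ?b \<in> {-1, 0, 1}" using wf_delta(3)[OF z j] by simp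
      define J where "J = I0 + nat (snd ?b + 1)"
      have J: "int J = int I + snd ?b" "t \<le> J" "J + t \<le> 2 * T"
        using mv I I0 unfolding J_def by auto
      have "I0 + 2 < width x" using I I0 by (simp add: width_def T_def)
      then have "F (t + 1) (I0 + 1) (AS j (if J = T then fst ?b else (snd (cfg x y t) ! j) (int J - int T)))"
        using next_cell[OF z t CK j sym[OF j]] IH(2)[OF j J(2,3)] unfolding J_def by blast
      moreover have "(snd (cfg x y (Suc t)) ! j) (int I - int T) =
        (if J = T then fst ?b else (snd (cfg x y t) ! j) (int J - int T))"
        using cfg_Suc(2)[OF j, of x y t "int I - int T"] J(1) by (simp add: z_def Let_def algebra_simps)
      ultimately show ?thesis
        using I0 by simp
    qed
    then show ?case
      using next_state[OF z t CK] cfg_Suc(1)[of x y t] by (simp add: z_def)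
  qed
  have "F T T (AS 0 ((snd (cfg x y T) ! 0) 0))"
    using inv[of T] two_tapes by auto
  then have "(snd (cfg x y T) ! 0) 0 \<noteq> 1"
    using accept by metis
  then have "V x y"
    using accepts[OF len_y] by (simp add: T_def split: if_splits)
  then show ?thesis using len_y by blast
qed

text \<open>The atoms are interpreted as facts about the run on \<open>y\<close>;
  \<open>code\<close> separates them, so this defines an assignment to their variables.\<close>

lemma accepts_imp_sat:
  assumes y: "length y \<le> guess x" "V x y"
  shows "\<exists>\<alpha>. \<forall>rl\<in>rules. \<forall>t<bound x. \<forall>I<width x. true_clause \<alpha> (clause rl x t I)"
proof -
  define T where "T = bound x"
  note b = bound_pos[of x, folded T_def]
  define st tp where "st t = fst (cfg x y t)" and "tp t j = snd (cfg x y t) ! j" for t j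
  define fact where "fact t I A = (case A of AS j a \<Rightarrow> tp t j (int I - int T) = a
     | AC r z \<Rightarrow> st t = fst z \<and> (\<forall>r'<r. tp t r' 0 = snd z ! r') | AQ s \<Rightarrow> st t = s)" for t I A
  define \<alpha> where "\<alpha> v \<longleftrightarrow> (\<exists>t I A. A \<in> AA \<and> I < width x \<and> v = code x t I A \<and> fact t I A)" for v
  have \<alpha>: "\<alpha> (code x t I A) \<longleftrightarrow> fact t I A" if A: "A \<in> AA" "I < width x" for t I A
  proof
    assume "\<alpha> (code x t I A)"
    then obtain t' I' A' where *: "A' \<in> AA" "I' < width x" "code x t I A = code x t' I' A'" "fact t' I' A'"
      unfolding \<alpha>_def by blast
    then have "t = t' \<and> I = I' \<and> ix A = ix A'"
      using A unfolding code_def by (intro mixed_radix_inject) (auto intro: ix_less)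
    then show "fact t I A"
      using ix_inj[OF A(1) *(1)] *(4) by simp
  qed (use A in \<open>auto simp: \<alpha>_def\<close>)
  have fact_simps [simp]: "fact t I (AS j a) \<longleftrightarrow> tp t j (int I - int T) = a"
    "fact t I (AC r z) \<longleftrightarrow> st t = fst z \<and> (\<forall>r'<r. tp t r' 0 = snd z ! r')" "fact t I (AQ s) \<longleftrightarrow> st t = s" for t I j a r z s
    by (simp_all add: fact_def)
  have scan_eq: "scan (cfg x y t) = z" if "z \<in> ZZ" "st t = fst z" "\<forall>r'<K. tp t r' 0 = snd z ! r'" for t z
  proof -
    have "map (\<lambda>u. u 0) (snd (cfg x y t)) = snd z"
      using that cfg_invariant[of x y t] by (intro nth_equalityI) (auto simp: ZZ_def tp_def)
    then show ?thesis
      using that by (simp add: scan_def st_def prod_eq_iff)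
  qed
  have tp0: "tp 0 j = tape_of (if j = 0 then x else if j = 1 then y else [])" if "j < K" for j
    using cfg_0(2)[OF that, of x y] by (simp add: tp_def)
  have ZZ0: "fst z < tm_states M" "r < K \<Longrightarrow> snd z ! r < tm_symbols M" if "z \<in> ZZ" for z r
    using that by (auto simp: ZZ_def intro!: nth_less)
  have M: "3 \<le> tm_symbols M" "2 \<le> tm_states M" "0 < K" "1 < K" "Suc 0 < K"
    using wf two_tapes by (auto simp: wf_tm_def)
  have taut: "true_clause \<alpha> (taut x)"
    by (auto simp: true_clause_def taut_def)
  have "true_clause \<alpha> (clause rl x t I)" if rl: "rl \<in> rules" and t: "t < T" and I: "I < width x" for rl t I
  proof (cases rl)
    case (Match_State z)
    then have "z \<in> ZZ" using rl by (auto simp: rules_def)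
    then show ?thesis
      using ZZ0[of z] b by (simp add: Match_State true_clause_def \<alpha>)
  next
    case (Match_Head r z)
    then have z: "z \<in> ZZ" "r < K" using rl by (auto simp: rules_def)
    then show ?thesis
      using ZZ0(1)[of z] ZZ0(2)[of z r] b by (auto simp: Match_Head true_clause_def \<alpha> less_Suc_eq T_def[symmetric])
  next
    case (Next_Cell z j a)
    then have z: "z \<in> ZZ" "j < K" "a < tm_symbols M" using rl by (auto simp: rules_def)
    show ?thesis
    proof (cases "I + 2 < width x")
      case True
      define d where "d = snd (delta z) ! j"
      define I' where "I' = I + nat (snd d + 1)"
      have d: "fst d < tm_symbols M" "snd d \<in> {-1, 0, 1}"
        using wf_delta(3)[OF z(1,2)] by (auto simp: d_def)
      then have I': "int I' = int I + 1 + snd d" "I' < width x"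
        using True by (auto simp: I'_def)
      have "tp (t + 1) j (int (I + 1) - int T) = (if I' = T then fst d else a)"
        if C: "st t = fst z" "\<forall>r'<K. tp t r' 0 = snd z ! r'" and a: "tp t j (int I' - int T) = a"
      proof -
        have h1: "tp (t + 1) j (int (I + 1) - int T) =
          (if int (I + 1) - int T + snd d = 0 then fst d else tp t j (int (I + 1) - int T + snd d))"
          using cfg_Suc(2)[OF z(2), of x y t] scan_eq[OF z(1) C] by (simp add: tp_def d_def Let_def)
        have h2: "int (I + 1) - int T + snd d = int I' - int T"
          using I'(1) by simp
        show ?thesis
          unfolding h1 h2 using a by simp
      qed
      then have "\<not> fact t 0 (AC K z) \<or> \<not> fact t I' (AS j a) \<or> fact (t + 1) (I + 1) (AS j (if I' = T then fst d else a))"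
        unfolding fact_simps by blast
      moreover have "\<alpha> (code x t 0 (AC K z)) = fact t 0 (AC K z)" "\<alpha> (code x t I' (AS j a)) = fact t I' (AS j a)"
        "\<alpha> (code x (t + 1) (I + 1) (AS j (if I' = T then fst d else a))) =
          fact (t + 1) (I + 1) (AS j (if I' = T then fst d else a))"
        using z d I' b True by (intro \<alpha>; simp)+
      moreover have "clause rl x t I = (neg x t 0 (AC K z), neg x t I' (AS j a),
        pos x (t + 1) (I + 1) (AS j (if I' = T then fst d else a)))"
        using True by (simp add: Next_Cell Let_def d_def I'_def T_def)
      ultimately show ?thesis
        by (simp only: true_clause_def fst_conv snd_conv holds_code)
    qed (simp add: Next_Cell taut Let_def)
  next
    case (Next_State z)
    then have z: "z \<in> ZZ" using rl by (auto simp: rules_def)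
    then show ?thesis
      using scan_eq[OF z, of t] cfg_Suc(1)[of x y t] wf_delta(1)[OF z] b
      by (auto simp: Next_State true_clause_def \<alpha> st_def[symmetric])
  next
    case Init_Input
    define a where "a = tape_of x (int (I - bound x))"
    have a: "a = 0 \<or> a = 1 \<or> a = 2"
      by (simp add: a_def tape_of_def)
    have "tp 0 0 (int I - int T) = (if I < T then 0 else a)"
      using tp0[of 0] M by (auto simp: a_def T_def tape_of_def)
    then show ?thesis
      using a I M unfolding Init_Input clause.simps a_def[symmetric]
      by (elim disjE) (auto simp: true_clause_def \<alpha> Let_def T_def)
  next
    case (Init_Blank j)
    then have j: "2 \<le> j" "j < K" using rl by (auto simp: rules_def)
    then show ?thesis
      using tp0[of j] I M by (auto simp: Init_Blank true_clause_def \<alpha> Let_def tape_of_def)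
  next
    case Init_Guess
    have "tp 0 1 (int I - int T) \<in> (if T \<le> I \<and> I < T + guess x then {0, 1, 2} else {0})"
      using tp0[of 1] M y(1) by (auto simp: tape_of_def)
    then show ?thesis
      using I M by (auto simp: Init_Guess true_clause_def \<alpha> T_def[symmetric] split: if_splits)
  next
    case Init_Guess_Blank
    show ?thesis
    proof (cases "T \<le> I \<and> I + 1 < T + guess x")
      case True
      then have "I + 1 < width x"
        using b by (simp add: width_def T_def)
      moreover have "tp 0 1 (int I - int T) \<noteq> 0 \<or> tp 0 1 (int (I + 1) - int T) = 0"
        using tp0[of 1] M True by (auto simp: tape_of_def split: if_splits)
      ultimately show ?thesis
        using True I M by (auto simp: Init_Guess_Blank true_clause_def \<alpha> T_def[symmetric])
    next
      case False
      then show ?thesis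
        using taut unfolding Init_Guess_Blank clause.simps T_def by (simp only: if_False)
    qed
  next
    case Init_State
    then show ?thesis
      using M b cfg_0(1)[of x y] by (auto simp: true_clause_def \<alpha> Let_def st_def)
  next
    case Accept
    then show ?thesis
      using M b accepts[OF y(1)] y(2) by (auto simp: true_clause_def \<alpha> Let_def tp_def T_def)
  qed
  then show ?thesis
    unfolding T_def by blast
qed

theorem cnf_sat_iff: "cnf_sat (nclauses x) (literal x) \<longleftrightarrow> (\<exists>y. length y \<le> poly p (length x) \<and> V x y)"
  unfolding cnf_sat_rules guess_def[symmetric] using sat_imp_accepts[of x] accepts_imp_sat[of _ x] by blast

section \<open>The formula as a function of the input\<close>

lemma code_less: "t \<le> bound x \<Longrightarrow> I < width x \<Longrightarrow> A \<in> AA \<Longrightarrow> code x t I A < nvars x"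
proof -
  assume *: "t \<le> bound x" "I < width x" "A \<in> AA"
  have "t * width x + I < (bound x + 1) * width x"
  proof -
    have "t * width x + I < Suc t * width x" using * by simp
    also have "\<dots> \<le> (bound x + 1) * width x" using * by (intro mult_right_mono) auto
    finally show ?thesis .
  qed
  then have "Suc (t * width x + I) * card AA \<le> nvars x"
    unfolding nvars_def by (intro mult_right_mono) auto
  then show ?thesis
    using ix_less[OF *(3)] by (simp add: code_def)
qed

lemma wf_literals: "wf_cnf (nvars x) (nclauses x) (literal x)"
proof -
  have lits: "fst cl < 2 * nvars x \<and> fst (snd cl) < 2 * nvars x \<and> snd (snd cl) < 2 * nvars x"
    if cl: "cl = clause rl x t I" and rl: "rl \<in> rules" and t: "t < bound x" and I: "I < width x" for cl rl t I
  proof -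
    have lit: "pos x t' I' A < 2 * nvars x" "neg x t' I' A < 2 * nvars x"
      if "t' \<le> bound x" "I' < width x" "A \<in> AA" for t' I' A
      using code_less[OF that] by simp_all
    have M: "3 \<le> tm_symbols M" "2 \<le> tm_states M" "0 < K" "1 < K" "Suc 0 < K"
      using wf two_tapes by (auto simp: wf_tm_def)
    have ZZ0: "fst z < tm_states M" "r < K \<Longrightarrow> snd z ! r < tm_symbols M" if "z \<in> ZZ" for z r
      using that by (auto simp: ZZ_def intro!: nth_less)
    have taut: "fst (taut x) < 2 * nvars x \<and> fst (snd (taut x)) < 2 * nvars x \<and> snd (snd (taut x)) < 2 * nvars x"
      using lit[of 0 0 "AQ 0"] bound_pos[of x] M by (simp add: taut_def)
    show ?thesis
    proof (cases rl)
      case (Match_State z)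
      then have "z \<in> ZZ" using rl by (auto simp: rules_def)
      then show ?thesis
        using lit[of t 0] t bound_pos[of x] ZZ0[of z] by (simp add: cl Match_State)
    next
      case (Match_Head r z)
      then have "z \<in> ZZ" "r < K" using rl by (auto simp: rules_def)
      then show ?thesis
        using lit[of t] t bound_pos[of x] ZZ0[of z] by (simp add: cl Match_Head)
    next
      case (Next_Cell z j a)
      then have z: "z \<in> ZZ" "j < K" "a < tm_symbols M" using rl by (auto simp: rules_def)
      show ?thesis
      proof (cases "I + 2 < width x")
        case True
        moreover have "I + nat (snd (snd (delta z) ! j) + 1) < width x"
          using wf_delta(3)[OF z(1,2)] True by auto
        ultimately show ?thesis
          using lit[of t] lit[of "t + 1" "I + 1"] t z bound_pos[of x] wf_delta(3)[OF z(1,2)]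
          by (simp add: cl Next_Cell Let_def)
      qed (use taut in \<open>simp add: cl Next_Cell Let_def\<close>)
    next
      case (Next_State z)
      then have "z \<in> ZZ" using rl by (auto simp: rules_def)
      then show ?thesis
        using lit[of t 0] lit[of "t + 1" 0] t bound_pos[of x] wf_delta(1)[of z] by (simp add: cl Next_State)
    next
      case Init_Input
      then show ?thesis
        using lit[of 0 I] I M by (simp add: cl Let_def)
    next
      case (Init_Blank j)
      then have "j < K" using rl by (auto simp: rules_def)
      then show ?thesis
        using lit[of 0 I] I M by (simp add: cl Init_Blank Let_def)
    next
      case Init_Guess
      then show ?thesis
        using lit[of 0 I] I M by (simp add: cl)
    next
      case Init_Guess_Blank
      show ?thesis
      proof (cases "bound x \<le> I \<and> I + 1 < bound x + guess x")
        case True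
        then have "I + 1 < width x"
          using bound_pos[of x] by (simp add: width_def)
        then show ?thesis
          using True lit[of 0 I] lit[of 0 "I + 1"] I M by (simp add: cl Init_Guess_Blank)
      next
        case False
        then show ?thesis
          using taut unfolding cl Init_Guess_Blank clause.simps by (simp only: if_False)
      qed
    next
      case Init_State
      then show ?thesis
        using lit[of 0 0] bound_pos[of x] M by (simp add: cl Let_def)
    next
      case Accept
      then show ?thesis
        using lit[of "bound x" "bound x"] bound_pos[of x] M by (simp add: cl Let_def)
    qed
  qed
  have "literal x s < 2 * nvars x" if s: "s < 3 * nclauses x" for s
  proof -
    define c where "c = s div 3"
    have "c < nclauses x" using s by (simp add: c_def less_mult_imp_div_less)
    then have "c div length rule_list < bound x * width x"
      by (simp add: nclauses_def less_mult_imp_div_less)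
    then have "c div length rule_list div width x < bound x"
      by (simp add: less_mult_imp_div_less)
    moreover have "c div length rule_list mod width x < width x"
      by (simp add: width_def)
    moreover have "rule_list ! (c mod length rule_list) \<in> rules"
      using rule_list_pos nth_mem[of "c mod length rule_list" rule_list] by (simp add: rule_list)
    ultimately show ?thesis
      using lits[OF refl] by (simp add: literal_def Let_def c_def)
  qed
  moreover have "0 < nclauses x"
    using bound_pos[of x] rule_list_pos by (simp add: nclauses_def width_def)
  ultimately show ?thesis
    by (simp add: wf_cnf_def)
qed

lemma size_expr [expr_intros]: "expressible (\<lambda>\<rho> x. guess x)" "expressible (\<lambda>\<rho> x. bound x)" "expressible (\<lambda>\<rho> x. width x)"
  "expressible (\<lambda>\<rho> x. nvars x)" "expressible (\<lambda>\<rho> x. nclauses x)"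
  unfolding nvars_def nclauses_def width_def bound_def guess_def by (intro expr_intros)+

lemma code_expr [expr_intros]:
  "expressible F \<Longrightarrow> expressible G \<Longrightarrow> expressible (\<lambda>\<rho> x. code x (F \<rho> x) (G \<rho> x) A)"
  unfolding code_def by (intro expr_intros)

lemma clause_expr:
  assumes "expressible F" "expressible G"
  shows "expressible3 (\<lambda>\<rho> x. clause rl x (F \<rho> x) (G \<rho> x))"
  by (cases rl; simp only: clause.simps Let_def taut_def; intro expr_intros assms)

text \<open>The remainder of the clause number selects one of finitely many schemes, and for a fixed
  scheme the literals are arithmetic in time and column.\<close>

lemma literal_expr: "expressible F \<Longrightarrow> expressible (\<lambda>\<rho> x. literal x (F \<rho> x))"
proof -
  assume F: "expressible F"
  let ?d = "\<lambda>\<rho> x. F \<rho> x div 3 div length rule_list"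
  have "expressible3 (\<lambda>\<rho> x. clause (rule_list ! (F \<rho> x div 3 mod length rule_list)) x (?d \<rho> x div width x) (?d \<rho> x mod width x))"
    by (rule expressible3_cases[where c = "length rule_list" and F = "\<lambda>\<rho> x. F \<rho> x div 3 mod length rule_list"
        and G = "\<lambda>i \<rho> x. clause (rule_list ! i) x (?d \<rho> x div width x) (?d \<rho> x mod width x)"])
      (intro clause_expr expr_intros F, intro expr_intros F, use rule_list_pos in simp)
  then show ?thesis
    unfolding literal_def Let_def expressible3_def by (intro expr_intros F) auto
qed

end

theorem theorem21:
  "NP_hard encode_instance
     {(G, k). (G, k) \<in> bicolored_instances \<and>
        cluster_graph (verts G) (blue G) \<and> cluster_graph (verts G) (red G) \<and> max_degree G = 5}
     {(G, k). two_colored_P4_deletion G k}"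
  unfolding NP_hard_def
proof
  fix L assume "L \<in> NP"
  then obtain V p where V: "poly_time_computable 2 (\<lambda>xs. [V (xs ! 0) (xs ! 1)])"
    and L: "\<And>x. x \<in> L \<longleftrightarrow> (\<exists>y. length y \<le> poly p (length x) \<and> V x y)"
    unfolding NP_def by blast
  obtain M q where M: "wf_tm M" "2 \<le> tm_tapes M"
    and run: "\<And>xs. length xs = 2 \<Longrightarrow> computes_within M xs [V (xs ! 0) (xs ! 1)] (poly q (sum_list (map length xs)))"
    using V unfolding poly_time_computable_def by blast
  interpret verifier M p q V
  proof
    show "computes_within M [x, y] [V x y] (poly q (length x + length y))" for x y
      using run[of "[x, y]"] by simp
  qed (rule M)+
  define g where "g x = (cnf_graph (nvars x) (nclauses x) (literal x), cnf_bound (nvars x) (nclauses x) (literal x))" for x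
  have 1: "poly_time_computable 1 (\<lambda>xs. encode_instance (g (xs ! 0)))"
    unfolding g_def by (rule cnf_reduction_computable[OF size_expr(4,5) literal_expr wf_literals])
  have 2: "g x \<in> {(G, k). (G, k) \<in> bicolored_instances \<and>
        cluster_graph (verts G) (blue G) \<and> cluster_graph (verts G) (red G) \<and> max_degree G = 5}" for x
    unfolding g_def using cnf_graph_class[OF wf_literals[of x]] by simp
  have 3: "x \<in> L \<longleftrightarrow> g x \<in> {(G, k). two_colored_P4_deletion G k}" for x
    unfolding g_def using cnf_graph_deletion[OF wf_literals[of x]] cnf_sat_iff[of x] L[of x] by simp
  show "\<exists>g. poly_time_computable 1 (\<lambda>xs. encode_instance (g (xs ! 0))) \<and>
     (\<forall>x. g x \<in> {(G, k). (G, k) \<in> bicolored_instances \<and>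
        cluster_graph (verts G) (blue G) \<and> cluster_graph (verts G) (red G) \<and> max_degree G = 5} \<and>
       (x \<in> L \<longleftrightarrow> g x \<in> {(G, k). two_colored_P4_deletion G k}))"
    by (intro exI[of _ g] conjI allI 1 2 3)
qed

end
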